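(* Let $\mathcal U$ be a variety in a signature $\tau$ containing the affine datum $(Q,A^{\alpha,\tau},\ast)$, and suppose the datum is realized by an extension $\pi:A\to Q$ with $A\in\mathcal U$ and $\alpha=\ker\pi$, with associated 2-cocycle $T$. Then the sequence $$1 \longrightarrow \mathrm{Der}(Q,A^{\alpha,\tau},\ast) \longrightarrow \mathrm{Aut}_{\alpha} A \stackrel{\psi}{\longrightarrow} C(Q,A^{\alpha,\tau},\ast) \stackrel{W_{T}}{\longrightarrow} H^{2}_{\mathcal U}(Q,A^{\alpha,\tau},\ast)$$ is exact. Here the first two nontrivial maps are group homomorphisms, $W_T$ is a map of sets, and exactness at $C(Q,A^{\alpha,\tau},\ast)$ means $\mathrm{im}\,\psi=\{(\sigma,\kappa): W_T(\sigma,\kappa)=0\}$.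
   Context: **Affine datum and its realization.** $A\in\mathcal U$ is an algebra of signature $\tau$, $\pi:A\to Q$ is a surjective homomorphism, and $\alpha=\ker\pi$ is affine: $\alpha$ is abelian ($[\alpha,\alpha]=0$ for the term-condition commutator) and there is a ternary term $m$ with $m(a,a,b)=b=m(b,a,a)$ whenever $(a,b)\in\alpha$. $A(\alpha)$ is the subalgebra of $A\times A$ with universe $\alpha$; its elements are written as columns $\begin{bmatrix} a\\ b\end{bmatrix}$. $\Delta_{\alpha\alpha}$ is the congruence of $A(\alpha)$ generated by all pairs $\left(\begin{bmatrix} u\\ u\end{bmatrix},\begin{bmatrix} v\\ v\end{bmatrix}\right)$ with $(u,v)\in\alpha$. Write $D=A(\alpha)/\Delta_{\alpha\alpha}$ (the semidirect product of the datum), with operations $F_f$ ($f\in\tau$), and let $\rho:D\to Q$, $\begin{bmatrix} a\\ b\end{bmatrix}/\Delta_{\alpha\alpha}\mapsto\pi(a)$, and $\delta:A\to D$, $\delta(a)=\begin{bmatrix} a\\ a\end{bmatrix}/\Delta_{\alpha\alpha}$. A lifting is a map $l:Q\to A$ with $\pi\circ l=\mathrm{id}_Q$; $\delta\circ l$ does not depend on $l$. Each fibre $\rho^{-1}(q)$ is an abelian group under $x+_u y=m(x,\delta(u),y)$, where $u=l(q)$, with zero $\delta(u)$; $-_u$ denotes subtraction. The action $\ast$ consists, for $f\in\tau$ of arity $n\ge1$ and $1\le i\le n$, of the maps $a(f,i)(q_1,\dots,q_{i-1},x,q_{i+1},\dots,q_n)=F_f(\delta l(q_1),\dots,\delta l(q_{i-1}),x,\delta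 l(q_{i+1}),\dots,\delta l(q_n))$ for $q_j\in Q$, $x\in D$ (for $i=1$ this is the partial operation $f^\Delta$ of the partial structure $A^{\alpha,\tau}$). One has $F_f(\vec x)=\sum_i a(f,i)(\rho(x_1),\dots,x_i,\dots,\rho(x_n))$, the sum being taken in the fibre over $f^Q(\rho(\vec x))$. The affine datum $(Q,A^{\alpha,\tau},\ast)$ is $Q$ together with this structure on $A(\alpha)/\Delta_{\alpha\alpha}$; it is contained in $\mathcal U$ when its semidirect product $D$ is in $\mathcal U$. **2-cocycles and cohomology.** A 2-cocycle is a family $T=\{T_f:f\in\tau\}$ of maps $T_f:Q^{\mathrm{ar} f}\to D$ with $\rho(T_f(\vec q))=f^Q(\vec q)$. $A_T(Q,A^{\alpha,\tau},\ast)$ is the algebra on the set $D$ with operations $F^T_f(\vec x)=F_f(\vec x)+_u T_f(\rho(\vec x))$, $u=l(f^Q(\rho(\vec x)))$. $T$ is $\mathcal U$-compatible if $A_T(Q,A^{\alpha,\tau},\ast)\in\mathcal U$. Two 2-cocycles $S,T$ are equivalent ($S\sim T$) if there is $h:Q\to D$ with $\rho\circ h=\mathrm{id}_Q$ and $S_f(\vec q)-_uT_f(\vec q)=F_f(h(\vec q))-_u h(f^Q(\vec q))$ for all $f\in\tau$, $\vec q\in Q^{\mathrm{ar} f}$, where $u=l(f^Q(\vec q))$. $H^2_{\mathcal U}(Q,A^{\alpha,\tau},\ast)$ is the abelian group of classes $[T]$ of $\mathcal U$-compatible 2-cocycles under fibrewise addition. The 2-cocycle associated to $\pi:A\to Q$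 and a lifting $l$ is $T_f(\vec q)=\begin{bmatrix} l(f^Q(\vec q))\\ f^A(l(\vec q))\end{bmatrix}/\Delta_{\alpha\alpha}$; its class does not depend on $l$, and $\gamma(x)=\begin{bmatrix} l(\pi(x))\\ x\end{bmatrix}/\Delta_{\alpha\alpha}$ is an isomorphism $A\to A_T(Q,A^{\alpha,\tau},\ast)$. **Derivations.** $\mathrm{Der}(Q,A^{\alpha,\tau},\ast)$ is the abelian group, under fibrewise addition, of maps $d:Q\to D$ with $\rho\circ d=\mathrm{id}_Q$ and $d(f^Q(\vec q))=F_f(d(\vec q))$ for all $f\in\tau$. Its map to $\mathrm{Aut}_\alpha A$ sends $d$ to $\gamma^{-1}\circ\overline d\circ\gamma$, where $\overline d(x)=x+_u d(\rho(x))$, $u=l(\rho(x))$. **Automorphisms.** $\mathrm{Aut}_\alpha A=\{\phi\in\mathrm{Aut}\,A:\phi(\alpha)=\alpha\}$. The group of compatible automorphisms $C(Q,A^{\alpha,\tau},\ast)$ consists of all $(\sigma,\kappa)\in\mathrm{Aut}\,D\times\mathrm{Aut}\,Q$ such that: (C1) $\sigma(a(f,i)(\vec p,x,\vec q))=a(f,i)(\kappa(\vec p),\sigma(x),\kappa(\vec q))$ for all $f\in\tau$ of arity $n\ge 1$, $1\le i\le n$, $\vec p\in Q^{i-1}$, $\vec q\in Q^{n-i}$, $x\in D$; (C2) $\rho\circ\sigma=\kappa\circ\rho$; (C3) for each $x\in A$ there is $y\in A$ with $\sigma(\delta(x))=\delta(y)$. The map $\psi$ is $\psi(\phi)=(\widehat\phi,\phi_l)$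 with $\widehat\phi\left(\begin{bmatrix} a\\ b\end{bmatrix}/\Delta_{\alpha\alpha}\right)=\begin{bmatrix}\phi(a)\\ \phi(b)\end{bmatrix}/\Delta_{\alpha\alpha}$ and $\phi_l=\pi\circ\phi\circ l$ (independent of $l$). **Wells map.** For $(\sigma,\kappa)\in C(Q,A^{\alpha,\tau},\ast)$ put $T^{(\sigma,\kappa)}_f(\vec q)=\sigma(T_f(\kappa^{-1}(\vec q)))$, and let $W_T(\sigma,\kappa)=[T-T^{(\sigma,\kappa)}]$ (fibrewise difference). *)

theory Defs
  imports "HOL-Algebra.Bij" "HOL-Algebra.Coset"
begin

section \<open>Universal algebra\<close>

record 'f signature =
  symbols :: "'f set"
  arity :: "'f \<Rightarrow> nat"

(* Operations take the list of their arguments; only lists of elements of the carrier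
   whose length is the arity matter. *)
record ('f, 'a) ualgebra = "'a partial_object" +
  oper :: "'f \<Rightarrow> 'a list \<Rightarrow> 'a"

definition tuples :: "'a set \<Rightarrow> nat \<Rightarrow> 'a list set"
  where "tuples X n = {xs. set xs \<subseteq> X \<and> length xs = n}"

definition is_algebra :: "'f signature \<Rightarrow> ('f, 'a) ualgebra \<Rightarrow> bool"
  where "is_algebra \<tau> A \<longleftrightarrow> carrier A \<noteq> {} \<and>
    (\<forall>f\<in>symbols \<tau>. \<forall>xs\<in>tuples (carrier A) (arity \<tau> f). oper A f xs \<in> carrier A)"

definition ua_hom :: "'f signature \<Rightarrow> ('f, 'a) ualgebra \<Rightarrow> ('f, 'b) ualgebra \<Rightarrow> ('a \<Rightarrow> 'b) set"
  where "ua_hom \<tau> A B = {h \<in> carrier A \<rightarrow> carrier B.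
    \<forall>f\<in>symbols \<tau>. \<forall>xs\<in>tuples (carrier A) (arity \<tau> f). h (oper A f xs) = oper B f (map h xs)}"

definition ua_auto :: "'f signature \<Rightarrow> ('f, 'a) ualgebra \<Rightarrow> ('a \<Rightarrow> 'a) set"
  where "ua_auto \<tau> A = ua_hom \<tau> A A \<inter> Bij (carrier A)"

definition ua_AutoGroup :: "'f signature \<Rightarrow> ('f, 'a) ualgebra \<Rightarrow> ('a \<Rightarrow> 'a) monoid"
  where "ua_AutoGroup \<tau> A = BijGroup (carrier A) \<lparr>carrier := ua_auto \<tau> A\<rparr>"

definition congruence :: "'f signature \<Rightarrow> ('f, 'a) ualgebra \<Rightarrow> ('a \<times> 'a) set \<Rightarrow> bool"
  where "congruence \<tau> A \<theta> \<longleftrightarrow> equiv (carrier A) \<theta> \<and>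
    (\<forall>f\<in>symbols \<tau>. \<forall>xs\<in>tuples (carrier A) (arity \<tau> f). \<forall>ys\<in>tuples (carrier A) (arity \<tau> f).
       list_all2 (\<lambda>x y. (x, y) \<in> \<theta>) xs ys \<longrightarrow> (oper A f xs, oper A f ys) \<in> \<theta>)"

definition gen_congruence ::
    "'f signature \<Rightarrow> ('f, 'a) ualgebra \<Rightarrow> ('a \<times> 'a) set \<Rightarrow> ('a \<times> 'a) set"
  where "gen_congruence \<tau> A R = \<Inter>{\<theta>. congruence \<tau> A \<theta> \<and> R \<subseteq> \<theta>}"

(* An operation is applied to all choices of representatives; for a congruence the union
   below is a union of equal classes. *)
definition quotient_alg :: "('f, 'a) ualgebra \<Rightarrow> ('a \<times> 'a) set \<Rightarrow> ('f, 'a set) ualgebra"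
  where "quotient_alg A \<theta> =
    \<lparr>carrier = carrier A // \<theta>, oper = (\<lambda>f Xs. \<Union>xs\<in>listset Xs. \<theta> `` {oper A f xs})\<rparr>"

definition kernel_rel :: "('f, 'a) ualgebra \<Rightarrow> ('a \<Rightarrow> 'q) \<Rightarrow> ('a \<times> 'a) set"
  where "kernel_rel A \<pi> = {(a, b). a \<in> carrier A \<and> b \<in> carrier A \<and> \<pi> a = \<pi> b}"

definition pair_alg :: "('f, 'a) ualgebra \<Rightarrow> ('a \<times> 'a) set \<Rightarrow> ('f, 'a \<times> 'a) ualgebra"
  where "pair_alg A \<alpha> =
    \<lparr>carrier = \<alpha>, oper = (\<lambda>f zs. (oper A f (map fst zs), oper A f (map snd zs)))\<rparr>"

datatype (dead 'f, vars: 'v) trm = Var 'v | App 'f "('f, 'v) trm list"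

primrec wf_trm :: "'f signature \<Rightarrow> ('f, 'v) trm \<Rightarrow> bool" where
  "wf_trm \<tau> (Var v) \<longleftrightarrow> True"
| "wf_trm \<tau> (App f ts) \<longleftrightarrow>
     f \<in> symbols \<tau> \<and> length ts = arity \<tau> f \<and> list_all (wf_trm \<tau>) ts"

primrec eval_trm :: "('f, 'a) ualgebra \<Rightarrow> ('v \<Rightarrow> 'a) \<Rightarrow> ('f, 'v) trm \<Rightarrow> 'a" where
  "eval_trm A e (Var v) = e v"
| "eval_trm A e (App f ts) = oper A f (map (eval_trm A e) ts)"

type_synonym 'f identity = "('f, nat) trm \<times> ('f, nat) trm"

definition identities :: "'f signature \<Rightarrow> 'f identity set \<Rightarrow> bool"
  where "identities \<tau> E \<longleftrightarrow> (\<forall>(s, t)\<in>E. wf_trm \<tau> s \<and> wf_trm \<tau> t)"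

(* A variety is the class of all algebras (on any type) satisfying a set E of identities. *)
definition in_variety :: "'f signature \<Rightarrow> 'f identity set \<Rightarrow> ('f, 'a) ualgebra \<Rightarrow> bool"
  where "in_variety \<tau> E A \<longleftrightarrow> is_algebra \<tau> A \<and>
    (\<forall>(s, t)\<in>E. \<forall>e. range e \<subseteq> carrier A \<longrightarrow> eval_trm A e s = eval_trm A e t)"

(* The two summands of the type of variables are the two blocks of variables of the
   term condition. *)
definition centralizes ::
    "'f signature \<Rightarrow> ('f, 'a) ualgebra \<Rightarrow> ('a \<times> 'a) set \<Rightarrow> ('a \<times> 'a) set \<Rightarrow> ('a \<times> 'a) set \<Rightarrow> bool"
  where "centralizes \<tau> A \<alpha> \<beta> \<delta> \<longleftrightarrow>
    (\<forall>(t :: ('f, nat + nat) trm) a b c d.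
       wf_trm \<tau> t \<longrightarrow> (\<forall>i. (a i, b i) \<in> \<alpha>) \<longrightarrow> (\<forall>i. (c i, d i) \<in> \<beta>) \<longrightarrow>
       (eval_trm A (case_sum a c) t, eval_trm A (case_sum a d) t) \<in> \<delta> \<longrightarrow>
       (eval_trm A (case_sum b c) t, eval_trm A (case_sum b d) t) \<in> \<delta>)"

definition commutator ::
    "'f signature \<Rightarrow> ('f, 'a) ualgebra \<Rightarrow> ('a \<times> 'a) set \<Rightarrow> ('a \<times> 'a) set \<Rightarrow> ('a \<times> 'a) set"
  where "commutator \<tau> A \<alpha> \<beta> = \<Inter>{\<delta>. congruence \<tau> A \<delta> \<and> centralizes \<tau> A \<alpha> \<beta> \<delta>}"

definition abelian_congruence :: "'f signature \<Rightarrow> ('f, 'a) ualgebra \<Rightarrow> ('a \<times> 'a) set \<Rightarrow> bool"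
  where "abelian_congruence \<tau> A \<alpha> \<longleftrightarrow>
    congruence \<tau> A \<alpha> \<and> commutator \<tau> A \<alpha> \<alpha> = Id_on (carrier A)"

definition ternary_trm :: "'f signature \<Rightarrow> ('f, nat) trm \<Rightarrow> bool"
  where "ternary_trm \<tau> m \<longleftrightarrow> wf_trm \<tau> m \<and> vars m \<subseteq> {0, 1, 2}"

definition ternary_op :: "('f, 'a) ualgebra \<Rightarrow> ('f, nat) trm \<Rightarrow> 'a \<Rightarrow> 'a \<Rightarrow> 'a \<Rightarrow> 'a"
  where "ternary_op A m x y z = eval_trm A (\<lambda>i. if i = 0 then x else if i = 1 then y else z) m"


section \<open>Affine datum of an extension\<close>

(* The term m and the lifting l are arbitrary but fixed. *)
locale affine_extension =
  fixes \<tau> :: "'f signature"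
    and A :: "('f, 'a) ualgebra"
    and Q :: "('f, 'q) ualgebra"
    and \<pi> :: "'a \<Rightarrow> 'q"
    and m :: "('f, nat) trm"
    and l :: "'q \<Rightarrow> 'a"
  assumes algebra_A: "is_algebra \<tau> A"
    and algebra_Q: "is_algebra \<tau> Q"
    and hom_\<pi>: "\<pi> \<in> ua_hom \<tau> A Q"
    and surj_\<pi>: "\<pi> ` carrier A = carrier Q"
    and abelian: "abelian_congruence \<tau> A (kernel_rel A \<pi>)"
    and ternary_m: "ternary_trm \<tau> m"
    and maltsev: "\<And>a b. (a, b) \<in> kernel_rel A \<pi> \<Longrightarrow>
      ternary_op A m a a b = b \<and> ternary_op A m b a a = b"
    and lifting: "l \<in> carrier Q \<rightarrow> carrier A" "\<And>q. q \<in> carrier Q \<Longrightarrow> \<pi> (l q) = q"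
begin

definition \<alpha> :: "('a \<times> 'a) set"
  where "\<alpha> = kernel_rel A \<pi>"

definition \<Delta> :: "(('a \<times> 'a) \<times> ('a \<times> 'a)) set"
  where "\<Delta> = gen_congruence \<tau> (pair_alg A \<alpha>) {((u, u), (v, v)) |u v. (u, v) \<in> \<alpha>}"

definition D :: "('f, ('a \<times> 'a) set) ualgebra"
  where "D = quotient_alg (pair_alg A \<alpha>) \<Delta>"

definition col :: "'a \<Rightarrow> 'a \<Rightarrow> ('a \<times> 'a) set"
  where "col a b = \<Delta> `` {(a, b)}"

definition \<rho> :: "('a \<times> 'a) set \<Rightarrow> 'q"
  where "\<rho> X = the_elem (\<pi> ` fst ` X)"

definition \<delta> :: "'a \<Rightarrow> ('a \<times> 'a) set"
  where "\<delta> a = col a a"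

definition fibre :: "'q \<Rightarrow> ('a \<times> 'a) set set"
  where "fibre q = {x \<in> carrier D. \<rho> x = q}"

definition fibre_group :: "'q \<Rightarrow> ('a \<times> 'a) set monoid"
  where "fibre_group q =
    \<lparr>carrier = fibre q, monoid.mult = (\<lambda>x y. ternary_op D m x (\<delta> (l q)) y), one = \<delta> (l q)\<rparr>"

definition fadd :: "'q \<Rightarrow> ('a \<times> 'a) set \<Rightarrow> ('a \<times> 'a) set \<Rightarrow> ('a \<times> 'a) set"
  where "fadd q x y = x \<otimes>\<^bsub>fibre_group q\<^esub> y"

definition fsub :: "'q \<Rightarrow> ('a \<times> 'a) set \<Rightarrow> ('a \<times> 'a) set \<Rightarrow> ('a \<times> 'a) set"
  where "fsub q x y = x \<otimes>\<^bsub>fibre_group q\<^esub> inv\<^bsub>fibre_group q\<^esub> y"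

(* The map a(f,i) is act f p _ q with p of length i - 1 and q of length n - i. *)
definition act :: "'f \<Rightarrow> 'q list \<Rightarrow> ('a \<times> 'a) set \<Rightarrow> 'q list \<Rightarrow> ('a \<times> 'a) set"
  where "act f p x q = oper D f (map (\<delta> \<circ> l) p @ [x] @ map (\<delta> \<circ> l) q)"

definition sections :: "('q \<Rightarrow> ('a \<times> 'a) set) set"
  where "sections = (\<Pi>\<^sub>E q\<in>carrier Q. fibre q)"

subsection \<open>Cocycles and second cohomology\<close>

type_synonym (in -) ('f, 'a, 'q) cochain = "'f \<Rightarrow> 'q list \<Rightarrow> ('a \<times> 'a) set"

definition cocycles :: "('f, 'a, 'q) cochain set"
  where "cocycles =
    (\<Pi>\<^sub>E f\<in>symbols \<tau>. \<Pi>\<^sub>E qs\<in>tuples (carrier Q) (arity \<tau> f). fibre (oper Q f qs))"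

definition mk_cochain :: "('f, 'a, 'q) cochain \<Rightarrow> ('f, 'a, 'q) cochain"
  where "mk_cochain T = (\<lambda>f\<in>symbols \<tau>. \<lambda>qs\<in>tuples (carrier Q) (arity \<tau> f). T f qs)"

definition cocycle_zero :: "('f, 'a, 'q) cochain"
  where "cocycle_zero = mk_cochain (\<lambda>f qs. \<delta> (l (oper Q f qs)))"

definition cocycle_add ::
    "('f, 'a, 'q) cochain \<Rightarrow> ('f, 'a, 'q) cochain \<Rightarrow> ('f, 'a, 'q) cochain"
  where "cocycle_add S T = mk_cochain (\<lambda>f qs. fadd (oper Q f qs) (S f qs) (T f qs))"

definition cocycle_sub ::
    "('f, 'a, 'q) cochain \<Rightarrow> ('f, 'a, 'q) cochain \<Rightarrow> ('f, 'a, 'q) cochain"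
  where "cocycle_sub S T = mk_cochain (\<lambda>f qs. fsub (oper Q f qs) (S f qs) (T f qs))"

definition A_alg :: "('f, 'a, 'q) cochain \<Rightarrow> ('f, ('a \<times> 'a) set) ualgebra"
  where "A_alg T = \<lparr>carrier = carrier D,
    oper = (\<lambda>f xs. fadd (oper Q f (map \<rho> xs)) (oper D f xs) (T f (map \<rho> xs)))\<rparr>"

definition compatible_cocycles :: "'f identity set \<Rightarrow> ('f, 'a, 'q) cochain set"
  where "compatible_cocycles E = {T \<in> cocycles. in_variety \<tau> E (A_alg T)}"

definition equivalent :: "('f, 'a, 'q) cochain \<Rightarrow> ('f, 'a, 'q) cochain \<Rightarrow> bool"
  where "equivalent S T \<longleftrightarrow> (\<exists>h\<in>sections.
    \<forall>f\<in>symbols \<tau>. \<forall>qs\<in>tuples (carrier Q) (arity \<tau> f).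
      fsub (oper Q f qs) (S f qs) (T f qs)
        = fsub (oper Q f qs) (oper D f (map h qs)) (h (oper Q f qs)))"

definition equiv_rel ::
    "'f identity set \<Rightarrow> (('f, 'a, 'q) cochain \<times> ('f, 'a, 'q) cochain) set"
  where "equiv_rel E =
    {(S, T). S \<in> compatible_cocycles E \<and> T \<in> compatible_cocycles E \<and> equivalent S T}"

definition cls :: "'f identity set \<Rightarrow> ('f, 'a, 'q) cochain \<Rightarrow> ('f, 'a, 'q) cochain set"
  where "cls E T = equiv_rel E `` {T}"

definition H2 :: "'f identity set \<Rightarrow> ('f, 'a, 'q) cochain set monoid"
  where "H2 E = \<lparr>carrier = compatible_cocycles E // equiv_rel E,
    monoid.mult = (\<lambda>X Y. \<Union>S\<in>X. \<Union>T\<in>Y. cls E (cocycle_add S T)), one = cls E cocycle_zero\<rparr>"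

definition assoc_cocycle :: "('f, 'a, 'q) cochain"
  where "assoc_cocycle = mk_cochain (\<lambda>f qs. col (l (oper Q f qs)) (oper A f (map l qs)))"

subsection \<open>Derivations and automorphisms\<close>

definition Der :: "('q \<Rightarrow> ('a \<times> 'a) set) monoid"
  where "Der = \<lparr>carrier = {d \<in> sections. \<forall>f\<in>symbols \<tau>. \<forall>qs\<in>tuples (carrier Q) (arity \<tau> f).
        d (oper Q f qs) = oper D f (map d qs)},
    monoid.mult = (\<lambda>d e. \<lambda>q\<in>carrier Q. fadd q (d q) (e q)), one = (\<lambda>q\<in>carrier Q. \<delta> (l q))\<rparr>"

definition Aut_\<alpha> :: "('a \<Rightarrow> 'a) monoid"
  where "Aut_\<alpha> = ua_AutoGroup \<tau> A \<lparr>carrier := {\<phi> \<in> ua_auto \<tau> A. map_prod \<phi> \<phi> ` \<alpha> = \<alpha>}\<rparr>"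

definition \<gamma> :: "'a \<Rightarrow> ('a \<times> 'a) set"
  where "\<gamma> x = col (l (\<pi> x)) x"

definition der_bar :: "('q \<Rightarrow> ('a \<times> 'a) set) \<Rightarrow> ('a \<times> 'a) set \<Rightarrow> ('a \<times> 'a) set"
  where "der_bar d x = fadd (\<rho> x) x (d (\<rho> x))"

definition der_to_aut :: "('q \<Rightarrow> ('a \<times> 'a) set) \<Rightarrow> 'a \<Rightarrow> 'a"
  where "der_to_aut d = (\<lambda>a\<in>carrier A. inv_into (carrier A) \<gamma> (der_bar d (\<gamma> a)))"

definition C :: "((('a \<times> 'a) set \<Rightarrow> ('a \<times> 'a) set) \<times> ('q \<Rightarrow> 'q)) monoid"
  where "C = (ua_AutoGroup \<tau> D \<times>\<times> ua_AutoGroup \<tau> Q) \<lparr>carrier :=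
    {(\<sigma>, \<kappa>) \<in> ua_auto \<tau> D \<times> ua_auto \<tau> Q.
       (\<forall>f\<in>symbols \<tau>. \<forall>i\<in>{1..arity \<tau> f}. \<forall>p\<in>tuples (carrier Q) (i - 1).
          \<forall>q\<in>tuples (carrier Q) (arity \<tau> f - i). \<forall>x\<in>carrier D.
            \<sigma> (act f p x q) = act f (map \<kappa> p) (\<sigma> x) (map \<kappa> q)) \<and>
       (\<forall>x\<in>carrier D. \<rho> (\<sigma> x) = \<kappa> (\<rho> x)) \<and>
       (\<forall>x\<in>carrier A. \<exists>y\<in>carrier A. \<sigma> (\<delta> x) = \<delta> y)}\<rparr>"

(* As for quotient_alg, the union runs over all representatives of X. *)
definition hat :: "('a \<Rightarrow> 'a) \<Rightarrow> ('a \<times> 'a) set \<Rightarrow> ('a \<times> 'a) set"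
  where "hat \<phi> = (\<lambda>X\<in>carrier D. \<Union>(a, b)\<in>X. col (\<phi> a) (\<phi> b))"

definition \<psi> :: "('a \<Rightarrow> 'a) \<Rightarrow> (('a \<times> 'a) set \<Rightarrow> ('a \<times> 'a) set) \<times> ('q \<Rightarrow> 'q)"
  where "\<psi> \<phi> = (hat \<phi>, \<lambda>q\<in>carrier Q. \<pi> (\<phi> (l q)))"

definition cocycle_conj :: "(('a \<times> 'a) set \<Rightarrow> ('a \<times> 'a) set) \<times> ('q \<Rightarrow> 'q) \<Rightarrow>
    ('f, 'a, 'q) cochain \<Rightarrow> ('f, 'a, 'q) cochain"
  where "cocycle_conj = (\<lambda>(\<sigma>, \<kappa>) T.
    mk_cochain (\<lambda>f qs. \<sigma> (T f (map (inv_into (carrier Q) \<kappa>) qs))))"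

definition wells :: "'f identity set \<Rightarrow> ('f, 'a, 'q) cochain \<Rightarrow>
    (('a \<times> 'a) set \<Rightarrow> ('a \<times> 'a) set) \<times> ('q \<Rightarrow> 'q) \<Rightarrow> ('f, 'a, 'q) cochain set"
  where "wells E T \<sigma>\<kappa> = cls E (cocycle_sub T (cocycle_conj \<sigma>\<kappa> T))"

end

end

theory Submission
  imports Defs "HOL-Algebra.Product_Groups"
begin

text \<open>
  On the blocks of an abelian congruence \<open>\<alpha>\<close> the term \<open>m\<close> commutes with all operations, so
  \<open>((a, b), (c, d)) \<in> \<Delta>\<close> means that all four elements lie in one block and \<open>d = m(b, a, c)\<close>.
  Hence \<open>col a b\<close> behaves like a difference vector: \<open>col a b + col b c = col a c\<close> in the fibre, and the
  operations of the semidirect product are additive on fibres.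

  A derivation \<open>d\<close> acts on \<open>A\<close> by moving \<open>a\<close> to the unique \<open>b\<close> with \<open>col a b = d (\<pi> a)\<close>; an
  automorphism \<open>\<phi>\<close> in the kernel of \<open>\<psi>\<close> preserves all difference vectors, so \<open>col a (\<phi> a)\<close> depends
  on \<open>\<pi> a\<close> only and is such a derivation. If \<open>T - cocycle_conj (\<sigma>, \<kappa>) T\<close> is the coboundary of \<open>h\<close>, then
  \<open>x \<mapsto> \<sigma> x - h (\<kappa> (\<rho> x))\<close> is an automorphism of \<open>A_alg T\<close>, and its transport along \<open>\<gamma>\<close> is
  a preimage of \<open>(\<sigma>, \<kappa>)\<close>; conversely \<open>h (\<kappa> q) = col (\<phi> (l q)) (l (\<kappa> q))\<close> works for
  \<open>(\<sigma>, \<kappa>) = \<psi> \<phi>\<close>.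
\<close>

section \<open>Terms, homomorphisms and varieties\<close>

text \<open>The term condition speaks about syntactic terms, so commutation of \<open>m\<close> with
  all operations is proved through a composite term with \<open>m\<close> both inside and outside.
  Since \<open>m\<close> is itself a term, commutativity and associativity of \<open>m\<close> on a
  block are instances of the same fact. The generated congruence \<Delta> gives no direct access to
  its members; its explicit form supplies, for every class and every point a over its fibre, exactly
  one b with class \<open>col a b\<close>. Base points are therefore chosen so that columns follow
  one another, and most identities compare two paths with common ends. Operations take lists, hence
  parallel tuples are functions mapped over one index list. Sections and cochains are products of
  fibre groups joined by the coboundary homomorphism: derivations are its kernel, and equivalent
  cocycles differ by its image. Elements of \<open>H2\<close> come from compatible cocycles, so each
  construction of a cocycle is accompanied by a homomorphism onto its algebra; sums are the
  exception, there evaluations are added fibrewise.\<close>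

lemma tuples_iff: "xs \<in> tuples X n \<longleftrightarrow> set xs \<subseteq> X \<and> length xs = n"
  by (simp add: tuples_def)

lemma listset_iff: "xs \<in> listset Xs \<longleftrightarrow> list_all2 (\<in>) xs Xs"
  by (induction Xs arbitrary: xs) (auto simp: set_Cons_def list_all2_Cons2)

lemma is_algebra_closed:
  "is_algebra \<tau> A \<Longrightarrow> f \<in> symbols \<tau> \<Longrightarrow> set xs \<subseteq> carrier A \<Longrightarrow> length xs = arity \<tau> f
    \<Longrightarrow> oper A f xs \<in> carrier A"
  by (auto simp: is_algebra_def tuples_iff)

lemma ua_hom_closed: "h \<in> ua_hom \<tau> A B \<Longrightarrow> a \<in> carrier A \<Longrightarrow> h a \<in> carrier B"
  by (auto simp: ua_hom_def)

lemma ua_hom_oper: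
  "h \<in> ua_hom \<tau> A B \<Longrightarrow> f \<in> symbols \<tau> \<Longrightarrow> set xs \<subseteq> carrier A \<Longrightarrow> length xs = arity \<tau> f
    \<Longrightarrow> h (oper A f xs) = oper B f (map h xs)"
  by (auto simp: ua_hom_def tuples_iff)

lemma ua_homI:
  assumes "\<And>a. a \<in> carrier A \<Longrightarrow> h a \<in> carrier B"
    and "\<And>f xs. f \<in> symbols \<tau> \<Longrightarrow> set xs \<subseteq> carrier A \<Longrightarrow> length xs = arity \<tau> f
      \<Longrightarrow> h (oper A f xs) = oper B f (map h xs)"
  shows "h \<in> ua_hom \<tau> A B"
  using assms by (auto simp: ua_hom_def tuples_iff)

lemma congruence_oper:
  assumes "congruence \<tau> A \<theta>" "f \<in> symbols \<tau>" "length xs = arity \<tau> f"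
    and "list_all2 (\<lambda>x y. (x, y) \<in> \<theta>) xs ys"
  shows "(oper A f xs, oper A f ys) \<in> \<theta>"
proof -
  have "\<theta> \<subseteq> carrier A \<times> carrier A"
    using assms(1) by (simp add: congruence_def equiv_def refl_on_def)
  then have "set xs \<subseteq> carrier A" "set ys \<subseteq> carrier A"
    using assms(4) by (fastforce simp: list_all2_conv_all_nth in_set_conv_nth)+
  then have "xs \<in> tuples (carrier A) (arity \<tau> f)" "ys \<in> tuples (carrier A) (arity \<tau> f)"
    using assms(3) list_all2_lengthD[OF assms(4)] by (auto simp: tuples_iff)
  then show ?thesis
    using assms unfolding congruence_def by blast
qed

lemma eval_trm_closed:
  assumes "is_algebra \<tau> A" "wf_trm \<tau> t" "range e \<subseteq> carrier A"
  shows "eval_trm A e t \<in> carrier A"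
  using assms(2)
proof (induction t)
  case (Var v)
  then show ?case using assms(3) by auto
next
  case (App f ts)
  then show ?case
    by (auto simp: list_all_iff intro!: is_algebra_closed[OF assms(1)])
qed

lemma eval_trm_hom:
  assumes "is_algebra \<tau> A" "h \<in> ua_hom \<tau> A B" "wf_trm \<tau> t" "range e \<subseteq> carrier A"
  shows "h (eval_trm A e t) = eval_trm B (h \<circ> e) t"
proof -
  define g where "g = h \<circ> e"
  have "h (eval_trm A e t) = eval_trm B g t"
    using assms(3)
  proof (induction t)
    case (App f ts)
    then have "h (oper A f (map (eval_trm A e) ts)) = oper B f (map h (map (eval_trm A e) ts))"
      by (intro ua_hom_oper[OF assms(2)])
        (auto simp: list_all_iff intro: eval_trm_closed[OF assms(1) _ assms(4)])
    also have "map h (map (eval_trm A e) ts) = map (eval_trm B g) ts"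
      using App by (auto simp: list_all_iff)
    finally show ?case by simp
  qed (simp add: g_def)
  then show ?thesis by (simp add: g_def)
qed

lemma eval_trm_congruence:
  assumes "congruence \<tau> A \<theta>" "wf_trm \<tau> t" "\<And>v. (e v, e' v) \<in> \<theta>"
  shows "(eval_trm A e t, eval_trm A e' t) \<in> \<theta>"
  using assms(2)
proof (induction t)
  case (App f ts)
  then have "list_all2 (\<lambda>x y. (x, y) \<in> \<theta>) (map (eval_trm A e) ts) (map (eval_trm A e') ts)"
    by (auto simp: list_all2_map1 list_all2_map2 list_all_iff intro!: list.rel_refl_strong)
  then show ?case
    using App.prems by (auto intro!: congruence_oper[OF assms(1)])
qed (use assms(3) in simp)

text \<open>The term condition quantifies over syntactic terms. Substitution makes composites of
  \<open>m\<close> with other terms available as terms, and \<open>eval_subst_trm\<close> computes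
  their values.\<close>

primrec subst_trm :: "('v \<Rightarrow> ('f, 'w) trm) \<Rightarrow> ('f, 'v) trm \<Rightarrow> ('f, 'w) trm" where
  "subst_trm s (Var v) = s v"
| "subst_trm s (App f ts) = App f (map (subst_trm s) ts)"

lemma eval_subst_trm: "eval_trm A e (subst_trm s t) = eval_trm A (\<lambda>v. eval_trm A e (s v)) t"
  by (induction t) (auto simp: comp_def cong: map_cong)

lemma wf_subst_trm: "wf_trm \<tau> t \<Longrightarrow> (\<And>v. wf_trm \<tau> (s v)) \<Longrightarrow> wf_trm \<tau> (subst_trm s t)"
  by (induction t) (auto simp: list_all_iff)

definition subst3 ::
    "('f, nat) trm \<Rightarrow> ('f, 'w) trm \<Rightarrow> ('f, 'w) trm \<Rightarrow> ('f, 'w) trm \<Rightarrow> ('f, 'w) trm"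
  where "subst3 m s t u = subst_trm (\<lambda>i. if i = 0 then s else if i = 1 then t else u) m"

lemma eval_subst3:
  "eval_trm A e (subst3 m s t u)
    = ternary_op A m (eval_trm A e s) (eval_trm A e t) (eval_trm A e u)"
  by (auto simp: subst3_def ternary_op_def eval_subst_trm intro!: arg_cong2[where f = "eval_trm A"])

lemma wf_subst3:
  "wf_trm \<tau> m \<Longrightarrow> wf_trm \<tau> s \<Longrightarrow> wf_trm \<tau> t \<Longrightarrow> wf_trm \<tau> u \<Longrightarrow> wf_trm \<tau> (subst3 m s t u)"
  unfolding subst3_def by (rule wf_subst_trm) auto

lemma ternary_op_hom:
  assumes "is_algebra \<tau> A" "wf_trm \<tau> m" "h \<in> ua_hom \<tau> A B"
    and "x \<in> carrier A" "y \<in> carrier A" "z \<in> carrier A"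
  shows "h (ternary_op A m x y z) = ternary_op B m (h x) (h y) (h z)"
proof -
  have "h (ternary_op A m x y z)
      = eval_trm B (h \<circ> (\<lambda>i. if i = 0 then x else if i = 1 then y else z)) m"
    unfolding ternary_op_def using assms by (intro eval_trm_hom) auto
  also have "h \<circ> (\<lambda>i::nat. if i = 0 then x else if i = 1 then y else z)
      = (\<lambda>i. if i = 0 then h x else if i = 1 then h y else h z)"
    by auto
  finally show ?thesis by (simp add: ternary_op_def)
qed

lemma ternary_op_congruence:
  assumes "congruence \<tau> A \<theta>" "wf_trm \<tau> m" "(x, x') \<in> \<theta>" "(y, y') \<in> \<theta>" "(z, z') \<in> \<theta>"
  shows "(ternary_op A m x y z, ternary_op A m x' y' z') \<in> \<theta>"
  unfolding ternary_op_def using assms by (intro eval_trm_congruence) auto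

text \<open>Every environment in B is the image of one in A, so identities are carried along h.
  Apart from sums of cocycles, the basic memberships in the variety below are obtained this
  way.\<close>

lemma in_variety_hom_image:
  assumes E: "identities \<tau> E" and A: "in_variety \<tau> E A" and h: "h \<in> ua_hom \<tau> A B"
    and surj: "h ` carrier A = carrier B"
  shows "in_variety \<tau> E B"
proof -
  have alg: "is_algebra \<tau> A" using A by (simp add: in_variety_def)
  have lift: "\<exists>e'. range e' \<subseteq> carrier A \<and> h \<circ> e' = e" if "range e \<subseteq> carrier B" for e :: "'v \<Rightarrow> _"
    using that surj by (intro exI[of _ "inv_into (carrier A) h \<circ> e"])
      (auto simp: fun_eq_iff f_inv_into_f image_subset_iff inv_into_into)
  have "is_algebra \<tau> B"
    unfolding is_algebra_def
  proof (intro conjI ballI)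
    show "carrier B \<noteq> {}" using alg surj by (auto simp: is_algebra_def)
    fix f xs assume f: "f \<in> symbols \<tau>" and "xs \<in> tuples (carrier B) (arity \<tau> f)"
    then have xs: "set xs \<subseteq> h ` carrier A" "length xs = arity \<tau> f"
      using surj by (auto simp: tuples_iff)
    define ys where "ys = map (inv_into (carrier A) h) xs"
    have ys: "set ys \<subseteq> carrier A" "length ys = arity \<tau> f" and "map h ys = xs"
      using xs by (auto simp: ys_def inv_into_into f_inv_into_f subset_iff intro!: map_idI)
    then have "oper B f xs = h (oper A f ys)"
      using ua_hom_oper[OF h f] by simp
    then show "oper B f xs \<in> carrier B"
      using is_algebra_closed[OF alg f ys] ua_hom_closed[OF h] by simp
  qed
  moreover have "eval_trm B e s = eval_trm B e t" if st: "(s, t) \<in> E" and "range e \<subseteq> carrier B" for s t e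
  proof -
    obtain e' where e': "range e' \<subseteq> carrier A" and "h \<circ> e' = e"
      using lift \<open>range e \<subseteq> carrier B\<close> by blast
    moreover have "wf_trm \<tau> s" "wf_trm \<tau> t" using E st by (auto simp: identities_def)
    moreover have "eval_trm A e' s = eval_trm A e' t"
      using A st e' by (auto simp: in_variety_def)
    ultimately show ?thesis
      using eval_trm_hom[OF alg h _ e'] by metis
  qed
  ultimately show ?thesis by (auto simp: in_variety_def)
qed

section \<open>Affine congruences\<close>

context affine_extension
begin

abbreviation mm :: "'a \<Rightarrow> 'a \<Rightarrow> 'a \<Rightarrow> 'a"
  where "mm \<equiv> ternary_op A m"

lemma \<alpha>_iff: "(a, b) \<in> \<alpha> \<longleftrightarrow> a \<in> carrier A \<and> b \<in> carrier A \<and> \<pi> a = \<pi> b"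
  by (simp add: \<alpha>_def kernel_rel_def)

lemma wf_m: "wf_trm \<tau> m"
  using ternary_m by (simp add: ternary_trm_def)

lemma congruence_\<alpha>: "congruence \<tau> A \<alpha>"
  using abelian by (simp add: abelian_congruence_def \<alpha>_def)

lemma \<pi>_closed: "a \<in> carrier A \<Longrightarrow> \<pi> a \<in> carrier Q"
  using surj_\<pi> by blast

lemma l_closed: "q \<in> carrier Q \<Longrightarrow> l q \<in> carrier A"
  using lifting by auto

lemma \<pi>_oper:
  "f \<in> symbols \<tau> \<Longrightarrow> set xs \<subseteq> carrier A \<Longrightarrow> length xs = arity \<tau> f
    \<Longrightarrow> \<pi> (oper A f xs) = oper Q f (map \<pi> xs)"
  by (rule ua_hom_oper[OF hom_\<pi>])

lemma mm_left: "(a, b) \<in> \<alpha> \<Longrightarrow> mm a a b = b"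
  using maltsev by (simp add: \<alpha>_def)

lemma mm_right: "(a, b) \<in> \<alpha> \<Longrightarrow> mm b a a = b"
  using maltsev by (simp add: \<alpha>_def)

text \<open>Replacing x by y inside its block changes m(x, y, z) into m(y, y, z) = z up to
  \<alpha>.\<close>

lemma mm_block: "(x, y) \<in> \<alpha> \<Longrightarrow> (y, z) \<in> \<alpha> \<Longrightarrow> (mm x y z, z) \<in> \<alpha>"
  using ternary_op_congruence[OF congruence_\<alpha> wf_m, of x y y y z z] mm_left[of y z]
  by (auto simp: \<alpha>_iff)

text \<open>A pair of equal values lies in the commutator, hence in every congruence that
  centralizes. The term condition for each of these puts the second pair into their intersection,
  which is the identity relation.\<close>

lemma term_condition:
  fixes t :: "('f, nat + nat) trm"
  assumes "wf_trm \<tau> t" "\<And>i. (a i, b i) \<in> \<alpha>" "\<And>i. (c i, d i) \<in> \<alpha>"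
    and "eval_trm A (case_sum a c) t = eval_trm A (case_sum a d) t"
  shows "eval_trm A (case_sum b c) t = eval_trm A (case_sum b d) t"
proof -
  let ?x = "\<lambda>e. eval_trm A (case_sum e c) t" and ?y = "\<lambda>e. eval_trm A (case_sum e d) t"
  have com: "commutator \<tau> A \<alpha> \<alpha> = Id_on (carrier A)"
    using abelian by (simp add: abelian_congruence_def \<alpha>_def)
  have "?x a \<in> carrier A"
    using assms(2,3) by (intro eval_trm_closed[OF algebra_A assms(1)])
      (auto simp: \<alpha>_iff split: sum.split)
  then have "(?x a, ?y a) \<in> commutator \<tau> A \<alpha> \<alpha>"
    using com assms(4) by auto
  then have "(?x b, ?y b) \<in> commutator \<tau> A \<alpha> \<alpha>"
    using assms(1-3) unfolding commutator_def centralizes_def by blast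
  then show ?thesis using com by auto
qed

section \<open>The difference term m commutes with terms and operations\<close>

lemma eval_trm_mm:
  fixes t :: "('f, nat) trm"
  assumes t: "wf_trm \<tau> t" and xy: "\<And>i. (x i, y i) \<in> \<alpha>" and yz: "\<And>i. (y i, z i) \<in> \<alpha>"
  shows "eval_trm A (\<lambda>i. mm (x i) (y i) (z i)) t
    = mm (eval_trm A x t) (eval_trm A y t) (eval_trm A z t)"
proof -
  define u where "u = eval_trm A (\<lambda>i. mm (x i) (y i) (z i)) t"
  define v where "v = mm (eval_trm A x t) (eval_trm A y t) (eval_trm A z t)"
  define w where "w = eval_trm A y t"
  \<comment> \<open>In \<open>s\<close> the first block of variables carries \<open>x\<close> (even indices) and the parameters \<open>y\<close> (odd
    indices). For \<open>x = y\<close> the value of \<open>s\<close> is \<open>w\<close> whatever \<open>z\<close> is, so the term condition makes it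
    independent of \<open>z\<close> for every \<open>x\<close>, and \<open>z = y\<close> gives \<open>mm u v w = w\<close>. A second application
    of the term condition cancels \<open>w\<close>.\<close>
  define X Y Z where "X = (\<lambda>i. Var (Inl (2 * i)) :: ('f, nat + nat) trm)"
    and "Y = (\<lambda>i. Var (Inl (2 * i + 1)) :: ('f, nat + nat) trm)"
    and "Z = (\<lambda>i. Var (Inr i) :: ('f, nat + nat) trm)"
  define s where "s = subst3 m (subst_trm (\<lambda>i. subst3 m (X i) (Y i) (Z i)) t)
    (subst3 m (subst_trm X t) (subst_trm Y t) (subst_trm Z t)) (subst_trm Y t)"
  define e where "e = (\<lambda>(x'::nat \<Rightarrow> 'a) i. if even i then x' (i div 2) else y (i div 2))"
  have e[simp]: "e x' (2 * i) = x' i" "e x' (Suc (2 * i)) = y i" for x' i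
    by (auto simp: e_def)
  have wf_s: "wf_trm \<tau> s"
    unfolding s_def X_def Y_def Z_def
    by (intro wf_subst3 wf_subst_trm wf_m t) simp_all
  have eval_s: "eval_trm A (case_sum (e x') z') s
      = mm (eval_trm A (\<lambda>i. mm (x' i) (y i) (z' i)) t)
          (mm (eval_trm A x' t) (eval_trm A y t) (eval_trm A z' t)) (eval_trm A y t)" for x' z'
    unfolding s_def eval_subst3 eval_subst_trm X_def Y_def Z_def by simp
  have yy: "(y i, y i) \<in> \<alpha>" for i using xy[of i] by (auto simp: \<alpha>_iff)
  have xw: "(eval_trm A x t, w) \<in> \<alpha>" unfolding w_def
    by (rule eval_trm_congruence[OF congruence_\<alpha> t xy])
  have wz: "(w, eval_trm A z t) \<in> \<alpha>" unfolding w_def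
    by (rule eval_trm_congruence[OF congruence_\<alpha> t yz])
  have ww: "(w, w) \<in> \<alpha>" using xw by (auto simp: \<alpha>_iff)
  have "(u, eval_trm A z t) \<in> \<alpha>" unfolding u_def
    using xy yz by (intro eval_trm_congruence[OF congruence_\<alpha> t] mm_block)
  then have uw: "(u, w) \<in> \<alpha>" using wz by (auto simp: \<alpha>_iff)
  have "(v, eval_trm A z t) \<in> \<alpha>" unfolding v_def
    using xw wz mm_block by (auto simp: w_def)
  then have vw: "(v, w) \<in> \<alpha>" using wz by (auto simp: \<alpha>_iff)
  have zw: "(eval_trm A z t, w) \<in> \<alpha>" using wz by (auto simp: \<alpha>_iff)
  have wx: "(w, eval_trm A x t) \<in> \<alpha>" using xw by (auto simp: \<alpha>_iff)
  have yx: "(y i, x i) \<in> \<alpha>" for i using xy[of i] by (auto simp: \<alpha>_iff)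
  have "eval_trm A (case_sum (e y) z) s = w"
    unfolding eval_s by (simp only: mm_left[OF yz] mm_left[OF wz] mm_left[OF zw] flip: w_def)
  moreover have "eval_trm A (case_sum (e y) y) s = w"
    unfolding eval_s by (simp only: mm_left[OF yy] mm_left[OF ww] flip: w_def)
  ultimately have "eval_trm A (case_sum (e y) z) s = eval_trm A (case_sum (e y) y) s"
    by simp
  then have "eval_trm A (case_sum (e x) z) s = eval_trm A (case_sum (e x) y) s"
  proof (rule term_condition[OF wf_s, rotated 2])
    show "(e y i, e x i) \<in> \<alpha>" for i by (simp add: e_def yy yx)
    show "(z i, y i) \<in> \<alpha>" for i using yz[of i] by (auto simp: \<alpha>_iff)
  qed
  also have "\<dots> = w"
    unfolding eval_s
    by (simp only: mm_right[OF yx] mm_right[OF wx] mm_left[OF xw] flip: w_def)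
  finally have "mm u v w = w"
    by (simp only: eval_s u_def v_def w_def)
  \<comment> \<open>With parameters (v, w) the term r takes the value w both at u and at v. The term
    condition moves the parameters to (v, v), where r returns u and v themselves.\<close>
  define r where "r = (subst3 m (Var (Inr 0)) (Var (Inl 0)) (Var (Inl 1)) :: ('f, nat + nat) trm)"
  have eval_r: "eval_trm A (case_sum p q) r = mm (q 0) (p 0) (p 1)" for p q
    by (simp add: r_def eval_subst3)
  have "eval_trm A (case_sum (\<lambda>i. v) (\<lambda>i. u)) r = eval_trm A (case_sum (\<lambda>i. v) (\<lambda>i. v)) r"
  proof (rule term_condition[where a = "\<lambda>i. if i = 0 then v else w"])
    show "wf_trm \<tau> r" unfolding r_def by (intro wf_subst3 wf_m) simp_all
  qed (use uw vw mm_left[OF vw] \<open>mm u v w = w\<close> in \<open>auto simp: \<alpha>_iff eval_r\<close>)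
  then have "u = v"
    unfolding eval_r using mm_right[of v u] mm_right[of v v] uw vw by (auto simp: \<alpha>_iff)
  then show ?thesis by (simp add: u_def v_def)
qed

text \<open>An operation symbol applied to distinct variables is a term, so
  \<open>eval_trm_mm\<close> applies. Tuples are functions over an index list js because parallel
  tuples have to be matched position by position; later statements about operations keep this
  format.\<close>

lemma oper_mm:
  assumes f: "f \<in> symbols \<tau>" and len: "length js = arity \<tau> f"
    and xy: "\<And>j. j \<in> set js \<Longrightarrow> (x j, y j) \<in> \<alpha>" and yz: "\<And>j. j \<in> set js \<Longrightarrow> (y j, z j) \<in> \<alpha>"
  shows "oper A f (map (\<lambda>j. mm (x j) (y j) (z j)) js)
    = mm (oper A f (map x js)) (oper A f (map y js)) (oper A f (map z js))"
proof -
  obtain a where a: "a \<in> carrier A" using algebra_A by (auto simp: is_algebra_def)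
  define n where "n = arity \<tau> f"
  \<comment> \<open>An environment assigns a value to every natural number; from the arity on it
    takes the default a, which is \<alpha>-related to itself.\<close>
  define ex where "ex = (\<lambda>x'. \<lambda>i. if i < n then x' (js ! i) else a)"
  have ex: "map (ex x') [0..<n] = map x' js" for x'
    using len by (intro nth_equalityI) (auto simp: ex_def n_def)
  have "map (\<lambda>i. mm (ex x i) (ex y i) (ex z i)) [0..<n] = map (\<lambda>j. mm (x j) (y j) (z j)) js"
    using len by (intro nth_equalityI) (auto simp: ex_def n_def)
  moreover have "eval_trm A (\<lambda>i. mm (ex x i) (ex y i) (ex z i)) (App f (map Var [0..<n]))
      = mm (eval_trm A (ex x) (App f (map Var [0..<n]))) (eval_trm A (ex y) (App f (map Var [0..<n])))
          (eval_trm A (ex z) (App f (map Var [0..<n])))"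
    using xy yz a f len by (intro eval_trm_mm) (auto simp: ex_def n_def \<alpha>_iff list_all_iff)
  ultimately show ?thesis
    by (simp add: comp_def ex)
qed

text \<open>This is \<open>eval_trm_mm\<close> for the term m itself: a 3 by 3 array has the same
  value by rows and by columns. Arrays padded with a base point yield commutativity and
  associativity.\<close>

lemma mm_mm:
  assumes "(x1, y1) \<in> \<alpha>" "(y1, z1) \<in> \<alpha>" "(x2, y2) \<in> \<alpha>" "(y2, z2) \<in> \<alpha>" "(x3, y3) \<in> \<alpha>" "(y3, z3) \<in> \<alpha>"
  shows "mm (mm x1 y1 z1) (mm x2 y2 z2) (mm x3 y3 z3)
    = mm (mm x1 x2 x3) (mm y1 y2 y3) (mm z1 z2 z3)"
proof -
  define e :: "'a \<Rightarrow> 'a \<Rightarrow> 'a \<Rightarrow> nat \<Rightarrow> 'a"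
    where "e = (\<lambda>x y z i. if i = 0 then x else if i = 1 then y else z)"
  have "(\<lambda>i. mm (e x1 x2 x3 i) (e y1 y2 y3 i) (e z1 z2 z3 i))
      = e (mm x1 y1 z1) (mm x2 y2 z2) (mm x3 y3 z3)"
    by (auto simp: e_def)
  moreover have "eval_trm A (\<lambda>i. mm (e x1 x2 x3 i) (e y1 y2 y3 i) (e z1 z2 z3 i)) m
      = mm (eval_trm A (e x1 x2 x3) m) (eval_trm A (e y1 y2 y3) m) (eval_trm A (e z1 z2 z3) m)"
    using assms by (intro eval_trm_mm wf_m) (auto simp: e_def)
  ultimately show ?thesis by (simp add: ternary_op_def e_def)
qed

text \<open>Eckmann-Hilton: in the array with rows (y, y, x), (y, y, y), (z, y, y) the rows collapse
  to x, y, z and the columns to z, y, x.\<close>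

lemma mm_commute:
  assumes xy: "(x, y) \<in> \<alpha>" and yz: "(y, z) \<in> \<alpha>"
  shows "mm x y z = mm z y x"
proof -
  have yx: "(y, x) \<in> \<alpha>" and yy: "(y, y) \<in> \<alpha>" using xy by (auto simp: \<alpha>_iff)
  have zy: "(z, y) \<in> \<alpha>" using yz by (auto simp: \<alpha>_iff)
  have "mm (mm y y x) (mm y y y) (mm z y y) = mm (mm y y z) (mm y y y) (mm x y y)"
    using mm_mm[OF yy yx yy yy zy yy] .
  then show ?thesis
    by (simp only: mm_left[OF yx] mm_left[OF yy] mm_right[OF yz] mm_left[OF yz] mm_right[OF yx])
qed

text \<open>In the array with rows (x, y, z), (y, y, u), (y, y, v) the rows collapse to m(x, y, z),
  u, v and the columns to x, y, m(z, u, v).\<close>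

lemma mm_assoc:
  assumes xy: "(x, y) \<in> \<alpha>" and yz: "(y, z) \<in> \<alpha>" and zu: "(z, u) \<in> \<alpha>" and uv: "(u, v) \<in> \<alpha>"
  shows "mm (mm x y z) u v = mm x y (mm z u v)"
proof -
  have yy: "(y, y) \<in> \<alpha>" and yu: "(y, u) \<in> \<alpha>" and yv: "(y, v) \<in> \<alpha>" and yx: "(y, x) \<in> \<alpha>"
    using assms by (auto simp: \<alpha>_iff)
  have "mm (mm x y z) (mm y y u) (mm y y v) = mm (mm x y y) (mm y y y) (mm z u v)"
    using mm_mm[OF xy yz yy yu yy yv] .
  then show ?thesis
    by (simp only: mm_left[OF yu] mm_left[OF yy] mm_left[OF yv] mm_right[OF yx])
qed

subsection \<open>The congruence \<open>\<Delta>\<close> and the semidirect product\<close>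

lemma pair_alg_simps:
  "carrier (pair_alg A \<alpha>) = \<alpha>"
  "oper (pair_alg A \<alpha>) f zs = (oper A f (map fst zs), oper A f (map snd zs))"
  by (simp_all add: pair_alg_def)

lemma oper_\<alpha>:
  assumes "f \<in> symbols \<tau>" "length js = arity \<tau> f" "\<And>j. j \<in> set js \<Longrightarrow> (x j, y j) \<in> \<alpha>"
  shows "(oper A f (map x js), oper A f (map y js)) \<in> \<alpha>"
  using assms by (intro congruence_oper[OF congruence_\<alpha>])
    (auto simp: list_all2_map1 list_all2_map2 intro!: list.rel_refl_strong)

lemma algebra_pair_alg: "is_algebra \<tau> (pair_alg A \<alpha>)"
  unfolding is_algebra_def pair_alg_simps
proof (intro conjI ballI)
  obtain a where "a \<in> carrier A" using algebra_A by (auto simp: is_algebra_def)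
  then show "\<alpha> \<noteq> {}" using \<alpha>_iff by blast
qed (auto simp: tuples_iff intro!: oper_\<alpha>)

lemma fst_hom: "fst \<in> ua_hom \<tau> (pair_alg A \<alpha>) A" and snd_hom: "snd \<in> ua_hom \<tau> (pair_alg A \<alpha>) A"
  by (auto simp: ua_hom_def pair_alg_simps \<alpha>_iff)

lemma ternary_op_pair_alg:
  assumes "(a, a') \<in> \<alpha>" "(b, b') \<in> \<alpha>" "(c, c') \<in> \<alpha>"
  shows "ternary_op (pair_alg A \<alpha>) m (a, a') (b, b') (c, c') = (mm a b c, mm a' b' c')"
  using ternary_op_hom[OF algebra_pair_alg wf_m fst_hom, of "(a, a')" "(b, b')" "(c, c')"]
    ternary_op_hom[OF algebra_pair_alg wf_m snd_hom, of "(a, a')" "(b, b')" "(c, c')"] assms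
  by (simp add: pair_alg_simps prod_eq_iff)

text \<open>The parallelogram relation on a block: d - c = b - a in additive notation, solved for d
  so that it becomes an equation in m.\<close>

definition \<Delta>0 :: "(('a \<times> 'a) \<times> ('a \<times> 'a)) set"
  where "\<Delta>0 = {((a, b), (c, d)). (a, b) \<in> \<alpha> \<and> (a, c) \<in> \<alpha> \<and> d = mm b a c}"

lemma \<Delta>0_D: "((a, b), (c, d)) \<in> \<Delta>0 \<Longrightarrow> (a, b) \<in> \<alpha> \<and> (a, c) \<in> \<alpha> \<and> (c, d) \<in> \<alpha> \<and> d = mm b a c"
  using mm_block[of b a c] by (auto simp: \<Delta>0_def \<alpha>_iff)

text \<open>Reflexivity is m(b, a, a) = b; symmetry and transitivity are translations that telescope
  by \<open>mm_assoc\<close>; compatibility with an operation is \<open>oper_mm\<close>.\<close>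

lemma congruence_\<Delta>0: "congruence \<tau> (pair_alg A \<alpha>) \<Delta>0"
  unfolding congruence_def pair_alg_simps
proof (intro conjI ballI impI equivI)
  show "\<Delta>0 \<subseteq> \<alpha> \<times> \<alpha>" using \<Delta>0_D by auto
  show "refl_on \<alpha> \<Delta>0"
    by (auto simp: refl_on_def \<Delta>0_def \<alpha>_iff mm_right)
  show "sym \<Delta>0"
  proof (rule symI, clarify)
    fix a b c d assume "((a, b), (c, d)) \<in> \<Delta>0"
    from \<Delta>0_D[OF this] have ab: "(a, b) \<in> \<alpha>" and ac: "(a, c) \<in> \<alpha>" and cd: "(c, d) \<in> \<alpha>"
      and d: "d = mm b a c" by auto
    have ba: "(b, a) \<in> \<alpha>" and cc: "(c, c) \<in> \<alpha>" and ca: "(c, a) \<in> \<alpha>"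
      using ab ac by (auto simp: \<alpha>_iff)
    have "mm d c a = b"
      using mm_assoc[OF ba ac cc ca] by (simp only: d mm_left[OF ca] mm_right[OF ab])
    then show "((c, d), (a, b)) \<in> \<Delta>0"
      using cd ca by (simp add: \<Delta>0_def)
  qed
  show "trans \<Delta>0"
  proof (rule transI, clarify)
    fix a b c d e g assume "((a, b), (c, d)) \<in> \<Delta>0" "((c, d), (e, g)) \<in> \<Delta>0"
    from \<Delta>0_D[OF this(1)] \<Delta>0_D[OF this(2)] have ab: "(a, b) \<in> \<alpha>" and ac: "(a, c) \<in> \<alpha>"
      and d: "d = mm b a c" and ce: "(c, e) \<in> \<alpha>" and g: "g = mm d c e" by auto
    have ba: "(b, a) \<in> \<alpha>" and cc: "(c, c) \<in> \<alpha>" and ae: "(a, e) \<in> \<alpha>"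
      using ab ac ce by (auto simp: \<alpha>_iff)
    have "g = mm b a e"
      using mm_assoc[OF ba ac cc ce] by (simp only: g d mm_left[OF ce])
    then show "((a, b), (e, g)) \<in> \<Delta>0"
      using ab ae by (simp add: \<Delta>0_def)
  qed
  fix f xs ys assume f: "f \<in> symbols \<tau>" and "xs \<in> tuples \<alpha> (arity \<tau> f)" "ys \<in> tuples \<alpha> (arity \<tau> f)"
    and rel: "list_all2 (\<lambda>x y. (x, y) \<in> \<Delta>0) xs ys"
  then have len: "length (zip xs ys) = arity \<tau> f" and len_eq: "length xs = length ys"
    by (auto simp: tuples_iff)
  \<comment> \<open>Reading the four coordinates off the zipped list gives four tuples over one
    index list, as \<open>oper_mm\<close> requires.\<close>
  define a b c d :: "('a \<times> 'a) \<times> ('a \<times> 'a) \<Rightarrow> 'a"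
    where "a = fst \<circ> fst" and "b = snd \<circ> fst" and "c = fst \<circ> snd" and "d = snd \<circ> snd"
  have mem: "((a j, b j), (c j, d j)) \<in> \<Delta>0" if "j \<in> set (zip xs ys)" for j
    using rel that by (auto simp: list_all2_iff a_def b_def c_def d_def)
  have ab: "(a j, b j) \<in> \<alpha>" and ac: "(a j, c j) \<in> \<alpha>" and d: "d j = mm (b j) (a j) (c j)"
    and ba: "(b j, a j) \<in> \<alpha>" if "j \<in> set (zip xs ys)" for j
    using \<Delta>0_D[OF mem[OF that]] by (auto simp: \<alpha>_iff)
  have maps: "map fst xs = map a (zip xs ys)" "map snd xs = map b (zip xs ys)"
    "map fst ys = map c (zip xs ys)" "map snd ys = map d (zip xs ys)"
    using len_eq by (auto simp: a_def b_def c_def d_def simp flip: map_map)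
  have "map d (zip xs ys) = map (\<lambda>j. mm (b j) (a j) (c j)) (zip xs ys)"
    using d by (intro map_cong) simp_all
  moreover have "oper A f (map (\<lambda>j. mm (b j) (a j) (c j)) (zip xs ys)) = mm (oper A f (map b (zip xs ys)))
      (oper A f (map a (zip xs ys))) (oper A f (map c (zip xs ys)))"
    by (intro oper_mm[OF f len] ba ac)
  ultimately have "oper A f (map d (zip xs ys)) = mm (oper A f (map b (zip xs ys)))
      (oper A f (map a (zip xs ys))) (oper A f (map c (zip xs ys)))"
    by (simp only:)
  then show "((oper A f (map fst xs), oper A f (map snd xs)), oper A f (map fst ys), oper A f (map snd ys)) \<in> \<Delta>0"
    using oper_\<alpha>[OF f len ab] oper_\<alpha>[OF f len ac] by (simp add: \<Delta>0_def maps)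
qed

text \<open>One inclusion is minimality of the generated congruence. For the other, m translates a
  generating pair to any pair of the parallelogram relation.\<close>

lemma \<Delta>_eq: "\<Delta> = \<Delta>0"
proof
  have "{((u, u), (v, v)) |u v. (u, v) \<in> \<alpha>} \<subseteq> \<Delta>0"
    by (auto simp: \<Delta>0_def \<alpha>_iff mm_left)
  then show "\<Delta> \<subseteq> \<Delta>0"
    using congruence_\<Delta>0 by (auto simp: \<Delta>_def gen_congruence_def)
  show "\<Delta>0 \<subseteq> \<Delta>"
    unfolding \<Delta>_def gen_congruence_def
  proof (clarify)
    fix a b c d \<theta>
    assume abcd: "((a, b), (c, d)) \<in> \<Delta>0" and \<theta>: "congruence \<tau> (pair_alg A \<alpha>) \<theta>"
      and gen: "{((u, u), (v, v)) |u v. (u, v) \<in> \<alpha>} \<subseteq> \<theta>"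
    from \<Delta>0_D[OF abcd] have ab: "(a, b) \<in> \<alpha>" and ac: "(a, c) \<in> \<alpha>" and d: "mm b a c = d"
      by auto
    have aa: "(a, a) \<in> \<alpha>" and cc: "(c, c) \<in> \<alpha>" using ac by (auto simp: \<alpha>_iff)
    have refl: "(p, p) \<in> \<theta>" if "p \<in> \<alpha>" for p
      using \<theta> that by (simp add: congruence_def pair_alg_simps equiv_def refl_on_def)
    \<comment> \<open>The translation m((a, b), (a, a), -) sends (a, a) to (a, b) and the related
      element (c, c) to (c, m(b, a, c)) = (c, d).\<close>
    have "(ternary_op (pair_alg A \<alpha>) m (a, b) (a, a) (a, a),
        ternary_op (pair_alg A \<alpha>) m (a, b) (a, a) (c, c)) \<in> \<theta>"
      using ab aa ac gen by (intro ternary_op_congruence[OF \<theta> wf_m] refl) auto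
    moreover have "ternary_op (pair_alg A \<alpha>) m (a, b) (a, a) (a, a) = (a, b)"
      by (simp only: ternary_op_pair_alg[OF ab aa aa] mm_left[OF aa] mm_right[OF ab])
    moreover have "ternary_op (pair_alg A \<alpha>) m (a, b) (a, a) (c, c) = (c, d)"
      by (simp only: ternary_op_pair_alg[OF ab aa cc] mm_left[OF ac] d)
    ultimately show "((a, b), (c, d)) \<in> \<theta>" by simp
  qed
qed

lemma \<Delta>_iff:
  "((a, b), (c, d)) \<in> \<Delta> \<longleftrightarrow> (a, b) \<in> \<alpha> \<and> (a, c) \<in> \<alpha> \<and> (c, d) \<in> \<alpha> \<and> d = mm b a c"
  using \<Delta>0_D[of a b c d] by (auto simp: \<Delta>_eq \<Delta>0_def)

lemma congruence_\<Delta>: "congruence \<tau> (pair_alg A \<alpha>) \<Delta>"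
  by (simp add: \<Delta>_eq congruence_\<Delta>0)

lemma equiv_\<Delta>: "equiv \<alpha> \<Delta>"
  using congruence_\<Delta> by (simp add: congruence_def pair_alg_simps)

lemma carrier_D: "carrier D = \<alpha> // \<Delta>"
  by (simp add: D_def quotient_alg_def pair_alg_simps)

lemma col_closed: "(a, b) \<in> \<alpha> \<Longrightarrow> col a b \<in> carrier D"
  by (simp add: carrier_D col_def quotientI)

lemma col_eqI:
  assumes "(a, b) \<in> \<alpha>" "(a, c) \<in> \<alpha>" "mm b a c = d"
  shows "col a b = col c d"
proof -
  have "((a, b), (c, d)) \<in> \<Delta>"
    using assms mm_block[of b a c] by (auto simp: \<Delta>_iff \<alpha>_iff)
  then show ?thesis unfolding col_def by (rule equiv_class_eq[OF equiv_\<Delta>])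
qed

text \<open>For equal first coordinates the parallelogram relation reads c = m(b, a, a) = b.\<close>

lemma col_inject:
  assumes "(a, b) \<in> \<alpha>" "(a, c) \<in> \<alpha>"
  shows "col a b = col a c \<longleftrightarrow> b = c"
proof
  assume "col a b = col a c"
  then have "((a, b), (a, c)) \<in> \<Delta>"
    unfolding col_def by (rule eq_equiv_class[OF _ equiv_\<Delta> assms(2)])
  then show "b = c" using mm_right[OF assms(1)] by (simp add: \<Delta>_iff)
qed simp

text \<open>\<open>\<rho>\<close> is \<open>the_elem\<close> of the images of all representatives;
  related pairs lie over one point of Q, so this image is a singleton.\<close>

lemma \<rho>_col:
  assumes "(a, b) \<in> \<alpha>"
  shows "\<rho> (col a b) = \<pi> a"
proof -
  have "\<pi> ` fst ` col a b = {\<pi> a}"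
  proof (intro equalityI subsetI)
    fix q assume "q \<in> \<pi> ` fst ` col a b"
    then obtain c d where "((a, b), (c, d)) \<in> \<Delta>" "q = \<pi> c" by (auto simp: col_def)
    then show "q \<in> {\<pi> a}" by (auto simp: \<Delta>_iff \<alpha>_iff)
  next
    fix q assume "q \<in> {\<pi> a}"
    moreover have "(a, b) \<in> col a b"
      unfolding col_def by (rule equiv_class_self[OF equiv_\<Delta> assms])
    ultimately show "q \<in> \<pi> ` fst ` col a b" by force
  qed
  then show ?thesis by (simp add: \<rho>_def)
qed

text \<open>A representative (c, d) translates to (a, m(d, c, a)). The free choice of a is what
  allows columns to be placed end to end.\<close>

lemma carrier_D_cases:
  assumes "x \<in> carrier D" "a \<in> carrier A" "\<pi> a = \<rho> x"
  obtains b where "(a, b) \<in> \<alpha>" "x = col a b"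
proof -
  obtain c d where cd: "(c, d) \<in> \<alpha>" and x: "x = col c d"
    using assms(1) by (auto simp: carrier_D col_def elim!: quotientE)
  then have ca: "(c, a) \<in> \<alpha>" using assms \<rho>_col[OF cd] by (simp add: \<alpha>_iff)
  have "(mm d c a, a) \<in> \<alpha>" using cd ca by (intro mm_block) (auto simp: \<alpha>_iff)
  then have "(a, mm d c a) \<in> \<alpha>" by (simp add: \<alpha>_iff)
  with col_eqI[OF cd ca refl] x show thesis using that by blast
qed

lemma \<rho>_closed:
  assumes "x \<in> carrier D" shows "\<rho> x \<in> carrier Q"
proof -
  obtain c d where "(c, d) \<in> \<alpha>" and "x = col c d"
    using assms by (auto simp: carrier_D col_def elim!: quotientE)
  then show ?thesis using \<rho>_col \<pi>_closed by (auto simp: \<alpha>_iff)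
qed

text \<open>The operation of the quotient is a union over all lists of representatives. The classes
  in it coincide because \<Delta> is a congruence, and the given pairs are among the
  representatives.\<close>

lemma oper_D_col:
  assumes f: "f \<in> symbols \<tau>" and len: "length js = arity \<tau> f"
    and ab: "\<And>j. j \<in> set js \<Longrightarrow> (a j, b j) \<in> \<alpha>"
  shows "oper D f (map (\<lambda>j. col (a j) (b j)) js) = col (oper A f (map a js)) (oper A f (map b js))"
proof -
  let ?Xs = "map (\<lambda>j. col (a j) (b j)) js" and ?zs = "map (\<lambda>j. (a j, b j)) js"
  have zs: "?zs \<in> listset ?Xs"
    using ab equiv_class_self[OF equiv_\<Delta>]
    by (auto simp: listset_iff list_all2_map1 list_all2_map2 col_def intro!: list.rel_refl_strong)
  have "\<Delta> `` {oper (pair_alg A \<alpha>) f xs} = \<Delta> `` {oper (pair_alg A \<alpha>) f ?zs}" if "xs \<in> listset ?Xs" for xs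
  proof -
    have "list_all2 (\<lambda>z x. (z, x) \<in> \<Delta>) ?zs xs"
      using that by (auto simp: listset_iff list_all2_conv_all_nth col_def)
    then have "(oper (pair_alg A \<alpha>) f ?zs, oper (pair_alg A \<alpha>) f xs) \<in> \<Delta>"
      using len by (intro congruence_oper[OF congruence_\<Delta> f]) auto
    then show ?thesis using equiv_class_eq[OF equiv_\<Delta>] by metis
  qed
  then have "(\<Union>xs\<in>listset ?Xs. \<Delta> `` {oper (pair_alg A \<alpha>) f xs}) = \<Delta> `` {oper (pair_alg A \<alpha>) f ?zs}"
    using zs by blast
  then show ?thesis by (simp add: D_def quotient_alg_def col_def pair_alg_simps comp_def)
qed

lemma col_hom: "(\<lambda>z. col (fst z) (snd z)) \<in> ua_hom \<tau> (pair_alg A \<alpha>) D"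
  using oper_D_col[where a = fst and b = snd]
  by (intro ua_homI) (auto simp: pair_alg_simps intro!: col_closed)

lemma ternary_op_D:
  assumes "(a, a') \<in> \<alpha>" "(b, b') \<in> \<alpha>" "(c, c') \<in> \<alpha>"
  shows "ternary_op D m (col a a') (col b b') (col c c') = col (mm a b c) (mm a' b' c')"
  using ternary_op_hom[OF algebra_pair_alg wf_m col_hom, of "(a, a')" "(b, b')" "(c, c')"] assms
  by (simp add: pair_alg_simps ternary_op_pair_alg)

section \<open>The fibres as abelian groups\<close>

lemma fibre_iff: "x \<in> fibre q \<longleftrightarrow> x \<in> carrier D \<and> \<rho> x = q"
  by (simp add: fibre_def)

lemma col_fibre: "(a, b) \<in> \<alpha> \<Longrightarrow> \<pi> a = q \<Longrightarrow> col a b \<in> fibre q"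
  by (simp add: fibre_iff col_closed \<rho>_col)

lemma fibre_base: "x \<in> fibre q \<Longrightarrow> q \<in> carrier Q"
  using \<rho>_closed by (auto simp: fibre_iff)

lemma fibre_cases:
  assumes "x \<in> fibre q" "a \<in> carrier A" "\<pi> a = q"
  obtains b where "(a, b) \<in> \<alpha>" "x = col a b"
  using assms carrier_D_cases[of x a] by (auto simp: fibre_iff)

lemma \<delta>_eq: "(a, b) \<in> \<alpha> \<Longrightarrow> \<delta> a = col b b"
  unfolding \<delta>_def by (rule col_eqI) (auto simp: \<alpha>_iff mm_left)

text \<open>The zero of a fibre can be written \<open>col a a\<close> at any a over it; computations
  pick the a that suits them.\<close>

lemma \<delta>_l: "a \<in> carrier A \<Longrightarrow> \<delta> (l (\<pi> a)) = col a a"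
  using lifting \<pi>_closed by (intro \<delta>_eq) (auto simp: \<alpha>_iff)

lemma \<delta>_fibre: "q \<in> carrier Q \<Longrightarrow> \<delta> (l q) \<in> fibre q"
  using lifting unfolding \<delta>_def by (intro col_fibre) (auto simp: \<alpha>_iff)

text \<open>Writing the zero as \<open>col b b\<close> gives the coordinates m(a, b, b) = a and m(b,
  b, c) = c.\<close>

lemma fadd_col:
  assumes ab: "(a, b) \<in> \<alpha>" and bc: "(b, c) \<in> \<alpha>" and q: "\<pi> a = q"
  shows "fadd q (col a b) (col b c) = col a c"
proof -
  have bb: "(b, b) \<in> \<alpha>" and ba: "(b, a) \<in> \<alpha>" and b: "\<delta> (l q) = col b b"
    using ab q \<delta>_l[of b] by (auto simp: \<alpha>_iff)
  have "fadd q (col a b) (col b c) = ternary_op D m (col a b) (col b b) (col b c)"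
    by (simp add: fadd_def fibre_group_def b)
  also have "\<dots> = col (mm a b b) (mm b b c)"
    by (rule ternary_op_D[OF ab bb bc])
  finally show ?thesis by (simp only: mm_right[OF ba] mm_left[OF bc])
qed

text \<open>With common first coordinate a the two sums end at m(b, a, c) and m(c, a, b), which
  agree by commutativity of m.\<close>

lemma fadd_commute_col:
  assumes ab: "(a, b) \<in> \<alpha>" and ac: "(a, c) \<in> \<alpha>" and q: "\<pi> a = q"
  shows "fadd q (col a b) (col a c) = fadd q (col a c) (col a b)"
proof -
  have aa: "(a, a) \<in> \<alpha>" and ba: "(b, a) \<in> \<alpha>" and a: "\<delta> (l q) = col a a"
    using ab q \<delta>_l[of a] by (auto simp: \<alpha>_iff)
  show ?thesis
    unfolding fadd_def fibre_group_def monoid.simps a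
    by (simp only: ternary_op_D ab ac aa mm_commute[OF ba ac])
qed

text \<open>Columns are chained through u, b, c, e, so associativity is composition of steps and
  \<open>col b u\<close> is the inverse of \<open>col u b\<close>. Commutativity is checked with a
  common first coordinate instead.\<close>

lemma comm_group_fibre:
  assumes q: "q \<in> carrier Q"
  shows "comm_group (fibre_group q)"
proof -
  have mult: "x \<otimes>\<^bsub>fibre_group q\<^esub> y = fadd q x y" for x y by (simp add: fadd_def)
  have car: "carrier (fibre_group q) = fibre q" "\<one>\<^bsub>fibre_group q\<^esub> = \<delta> (l q)"
    by (simp_all add: fibre_group_def)
  define u where "u = l q"
  have u: "u \<in> carrier A" "\<pi> u = q" using lifting q by (auto simp: u_def)
  have uu: "(u, u) \<in> \<alpha>" and zero: "\<delta> (l q) = col u u"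
    using u \<delta>_l[of u] by (auto simp: \<alpha>_iff)
  show ?thesis
  proof (rule comm_groupI, unfold mult car)
    show "\<delta> (l q) \<in> fibre q" by (rule \<delta>_fibre[OF q])
    fix x assume x: "x \<in> fibre q"
    obtain b where ub: "(u, b) \<in> \<alpha>" and xb: "x = col u b" using fibre_cases[OF x u] .
    have b: "b \<in> carrier A" "\<pi> b = q" and bu: "(b, u) \<in> \<alpha>"
      using ub u by (auto simp: \<alpha>_iff)
    show "fadd q (\<delta> (l q)) x = x" 
      by (simp only: zero xb fadd_col[OF uu ub u(2)])
    show "\<exists>y\<in>fibre q. fadd q y x = \<delta> (l q)"
    proof (intro bexI)
      show "fadd q (col b u) x = \<delta> (l q)"
        unfolding xb fadd_col[OF bu ub b(2)] using \<delta>_l[OF b(1)] b by simp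
    qed (use bu b in \<open>simp add: col_fibre\<close>)
    fix y assume y: "y \<in> fibre q"
    obtain c where bc: "(b, c) \<in> \<alpha>" and yc: "y = col b c" using fibre_cases[OF y b] .
    have uc: "(u, c) \<in> \<alpha>" and c: "c \<in> carrier A" "\<pi> c = q" using ub bc u by (auto simp: \<alpha>_iff)
    show "fadd q x y \<in> fibre q"
      unfolding xb yc fadd_col[OF ub bc u(2)] by (rule col_fibre[OF uc u(2)])
    obtain d where "(u, d) \<in> \<alpha>" "y = col u d" using fibre_cases[OF y u] .
    then show "fadd q x y = fadd q y x"
      unfolding xb using fadd_commute_col[OF ub _ u(2)] by simp
    fix z assume z: "z \<in> fibre q"
    obtain e where ce: "(c, e) \<in> \<alpha>" and ze: "z = col c e" using fibre_cases[OF z c] .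
    have be: "(b, e) \<in> \<alpha>" using bc ce by (auto simp: \<alpha>_iff)
    show "fadd q (fadd q x y) z = fadd q x (fadd q y z)"
      unfolding xb yc ze
      by (simp only: fadd_col[OF ub bc u(2)] fadd_col[OF uc ce u(2)] fadd_col[OF bc ce b(2)] fadd_col[OF ub be u(2)])
  qed
qed

lemma fibre_group_simps:
  "carrier (fibre_group q) = fibre q" "\<one>\<^bsub>fibre_group q\<^esub> = \<delta> (l q)"
  "x \<otimes>\<^bsub>fibre_group q\<^esub> y = fadd q x y"
  by (simp_all add: fibre_group_def fadd_def)

section \<open>Operations of the semidirect product are additive on fibres\<close>

lemma oper_Q_closed: "f \<in> symbols \<tau> \<Longrightarrow> length js = arity \<tau> f \<Longrightarrow> (\<And>j. j \<in> set js \<Longrightarrow> r j \<in> carrier Q)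
    \<Longrightarrow> oper Q f (map r js) \<in> carrier Q"
  by (intro is_algebra_closed[OF algebra_Q]) auto

lemma \<pi>_oper_l:
  assumes f: "f \<in> symbols \<tau>" and len: "length js = arity \<tau> f"
    and r: "\<And>j. j \<in> set js \<Longrightarrow> r j \<in> carrier Q"
  shows "\<pi> (oper A f (map (\<lambda>j. l (r j)) js)) = oper Q f (map r js)"
proof -
  have "map (\<pi> \<circ> (\<lambda>j. l (r j))) js = map r js"
    using lifting(2)[OF r] by simp
  moreover have "set (map (\<lambda>j. l (r j)) js) \<subseteq> carrier A"
    using l_closed[OF r] by auto
  ultimately show ?thesis
    using \<pi>_oper[OF f, of "map (\<lambda>j. l (r j)) js"] len by (simp only: length_map map_map)
qed

lemma oper_D_fibre:
  assumes f: "f \<in> symbols \<tau>" and len: "length js = arity \<tau> f"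
    and x: "\<And>j. j \<in> set js \<Longrightarrow> x j \<in> fibre (r j)"
  shows "oper D f (map x js) \<in> fibre (oper Q f (map r js))"
proof -
  have rQ: "r j \<in> carrier Q" if "j \<in> set js" for j
    using fibre_base[OF x[OF that]] .
  have "\<exists>b. (l (r j), b) \<in> \<alpha> \<and> x j = col (l (r j)) b" if "j \<in> set js" for j
    using fibre_cases[OF x[OF that] l_closed[OF rQ[OF that]] lifting(2)[OF rQ[OF that]]] by metis
  then obtain b where b: "\<And>j. j \<in> set js \<Longrightarrow> (l (r j), b j) \<in> \<alpha>"
    and xb: "\<And>j. j \<in> set js \<Longrightarrow> x j = col (l (r j)) (b j)"
    by metis
  have "map x js = map (\<lambda>j. col (l (r j)) (b j)) js" using xb by simp
  moreover have "oper D f (map (\<lambda>j. col (l (r j)) (b j)) js)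
      = col (oper A f (map (\<lambda>j. l (r j)) js)) (oper A f (map b js))"
    by (intro oper_D_col[OF f len] b)
  moreover have "col (oper A f (map (\<lambda>j. l (r j)) js)) (oper A f (map b js)) \<in> fibre (oper Q f (map r js))"
    by (intro col_fibre oper_\<alpha>[OF f len] \<pi>_oper_l[OF f len] b rQ)
  ultimately show ?thesis by (simp only:)
qed

lemma \<rho>_hom: "\<rho> \<in> ua_hom \<tau> D Q" and algebra_D: "is_algebra \<tau> D"
proof -
  have *: "oper D f xs \<in> carrier D \<and> \<rho> (oper D f xs) = oper Q f (map \<rho> xs)"
    if "f \<in> symbols \<tau>" "set xs \<subseteq> carrier D" "length xs = arity \<tau> f" for f xs
    using oper_D_fibre[OF that(1,3), of "\<lambda>x. x" \<rho>] that(2) by (auto simp: fibre_iff)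
  then show "\<rho> \<in> ua_hom \<tau> D Q" using \<rho>_closed by (intro ua_homI) auto
  have "carrier D \<noteq> {}"
    using algebra_A col_closed[of a a for a] by (auto simp: is_algebra_def \<alpha>_iff)
  with * show "is_algebra \<tau> D" by (auto simp: is_algebra_def tuples_iff)
qed

text \<open>At each index the two columns are chained through a common middle point b. An operation
  acts on both coordinates separately and so maps chains to chains.\<close>

lemma oper_D_add:
  assumes f: "f \<in> symbols \<tau>" and len: "length js = arity \<tau> f"
    and x: "\<And>j. j \<in> set js \<Longrightarrow> x j \<in> fibre (r j)" and y: "\<And>j. j \<in> set js \<Longrightarrow> y j \<in> fibre (r j)"
  shows "oper D f (map (\<lambda>j. fadd (r j) (x j) (y j)) js)
    = fadd (oper Q f (map r js)) (oper D f (map x js)) (oper D f (map y js))"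
proof -
  have rQ: "r j \<in> carrier Q" if "j \<in> set js" for j
    using fibre_base[OF x[OF that]] .
  have "\<exists>b c. (l (r j), b) \<in> \<alpha> \<and> x j = col (l (r j)) b \<and> (b, c) \<in> \<alpha> \<and> y j = col b c" if j: "j \<in> set js" for j
  proof -
    obtain b where b: "(l (r j), b) \<in> \<alpha>" "x j = col (l (r j)) b"
      using fibre_cases[OF x[OF j] l_closed[OF rQ[OF j]] lifting(2)[OF rQ[OF j]]] .
    moreover have "b \<in> carrier A" "\<pi> b = r j"
      using b(1) lifting(2)[OF rQ[OF j]] by (auto simp: \<alpha>_iff)
    then obtain c where "(b, c) \<in> \<alpha>" "y j = col b c"
      using fibre_cases[OF y[OF j]] by metis
    ultimately show ?thesis by blast
  qed
  then obtain b c where b: "\<And>j. j \<in> set js \<Longrightarrow> (l (r j), b j) \<in> \<alpha>" "\<And>j. j \<in> set js \<Longrightarrow> x j = col (l (r j)) (b j)"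
    and c: "\<And>j. j \<in> set js \<Longrightarrow> (b j, c j) \<in> \<alpha>" "\<And>j. j \<in> set js \<Longrightarrow> y j = col (b j) (c j)"
    by metis
  have lc: "(l (r j), c j) \<in> \<alpha>" if "j \<in> set js" for j
    using b(1)[OF that] c(1)[OF that] by (simp add: \<alpha>_iff)
  let ?l = "\<lambda>j. l (r j)"
  have "map x js = map (\<lambda>j. col (?l j) (b j)) js" "map y js = map (\<lambda>j. col (b j) (c j)) js"
    using b c by simp_all
  moreover have "map (\<lambda>j. fadd (r j) (x j) (y j)) js = map (\<lambda>j. col (?l j) (c j)) js"
    using fadd_col[OF b(1) c(1) lifting(2)[OF rQ]] b(2) c(2) by simp
  moreover have "oper D f (map (\<lambda>j. col (?l j) (b j)) js) = col (oper A f (map ?l js)) (oper A f (map b js))"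
    "oper D f (map (\<lambda>j. col (b j) (c j)) js) = col (oper A f (map b js)) (oper A f (map c js))"
    "oper D f (map (\<lambda>j. col (?l j) (c j)) js) = col (oper A f (map ?l js)) (oper A f (map c js))"
    by (intro oper_D_col[OF f len] b(1) c(1) lc; assumption)+
  moreover have "fadd (oper Q f (map r js)) (col (oper A f (map ?l js)) (oper A f (map b js)))
      (col (oper A f (map b js)) (oper A f (map c js))) = col (oper A f (map ?l js)) (oper A f (map c js))"
    by (intro fadd_col oper_\<alpha>[OF f len] \<pi>_oper_l[OF f len] b(1) c(1) rQ)
  ultimately show ?thesis by (simp only:)
qed

lemma oper_D_zero:
  assumes f: "f \<in> symbols \<tau>" and len: "length js = arity \<tau> f"
    and r: "\<And>j. j \<in> set js \<Longrightarrow> r j \<in> carrier Q"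
  shows "oper D f (map (\<lambda>j. \<delta> (l (r j))) js) = \<delta> (l (oper Q f (map r js)))"
proof -
  have "oper A f (map (\<lambda>j. l (r j)) js) \<in> carrier A"
    using l_closed[OF r] len by (intro is_algebra_closed[OF algebra_A f]) auto
  then have "\<delta> (l (oper Q f (map r js))) = col (oper A f (map (\<lambda>j. l (r j)) js)) (oper A f (map (\<lambda>j. l (r j)) js))"
    using \<delta>_l[of "oper A f (map (\<lambda>j. l (r j)) js)"] by (simp only: \<pi>_oper_l[OF f len r])
  moreover have "oper D f (map (\<lambda>j. col (l (r j)) (l (r j))) js)
      = col (oper A f (map (\<lambda>j. l (r j)) js)) (oper A f (map (\<lambda>j. l (r j)) js))"
    using l_closed[OF r] by (intro oper_D_col[OF f len]) (simp add: \<alpha>_iff)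
  ultimately show ?thesis by (simp add: \<delta>_def)
qed

abbreviation fneg :: "'q \<Rightarrow> ('a \<times> 'a) set \<Rightarrow> ('a \<times> 'a) set"
  where "fneg q x \<equiv> inv\<^bsub>fibre_group q\<^esub> x"

lemma fneg_fibre: "x \<in> fibre q \<Longrightarrow> fneg q x \<in> fibre q"
  using group.inv_closed[OF comm_group.axioms(2)[OF comm_group_fibre]] \<rho>_closed
  by (metis fibre_group_simps(1) fibre_iff)

text \<open>By additivity and preservation of zeros, the value at the negatives is an inverse of the
  value at x; inverses are unique.\<close>

lemma oper_D_neg:
  assumes f: "f \<in> symbols \<tau>" and len: "length js = arity \<tau> f"
    and x: "\<And>j. j \<in> set js \<Longrightarrow> x j \<in> fibre (r j)"
  shows "oper D f (map (\<lambda>j. fneg (r j) (x j)) js) = fneg (oper Q f (map r js)) (oper D f (map x js))"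
proof -
  have r: "r j \<in> carrier Q" if "j \<in> set js" for j
    using fibre_base[OF x[OF that]] .
  interpret comm_group "fibre_group (oper Q f (map r js))"
    by (intro comm_group_fibre oper_Q_closed f len r)
  have "fadd (r j) (fneg (r j) (x j)) (x j) = \<delta> (l (r j))" if "j \<in> set js" for j
    using group.l_inv[OF comm_group.axioms(2)[OF comm_group_fibre[OF r[OF that]]], of "x j"] x[OF that]
    by (simp add: fibre_group_simps)
  then have "oper D f (map (\<lambda>j. fadd (r j) (fneg (r j) (x j)) (x j)) js) = \<delta> (l (oper Q f (map r js)))"
    using oper_D_zero[OF f len, of r] r by (simp cong: map_cong)
  then have "fadd (oper Q f (map r js)) (oper D f (map (\<lambda>j. fneg (r j) (x j)) js)) (oper D f (map x js))
      = \<delta> (l (oper Q f (map r js)))"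
    by (subst (asm) oper_D_add[OF f len]) (auto intro: x fneg_fibre)
  then show ?thesis
    using oper_D_fibre[OF f len, of x r] oper_D_fibre[OF f len, of "\<lambda>j. fneg (r j) (x j)" r] x fneg_fibre
    by (intro inv_equality[symmetric]) (simp_all add: fibre_group_simps)
qed

end

section \<open>Commutative groups: products, subgroups and interchange\<close>

lemma comm_group_product_group:
  assumes "\<And>i. i \<in> I \<Longrightarrow> comm_group (G i)"
  shows "comm_group (product_group I G)"
proof (rule group.group_comm_groupI)
  show "group (product_group I G)"
    using assms by (intro product_group) (rule comm_group.axioms)
  fix x y assume "x \<in> carrier (product_group I G)" "y \<in> carrier (product_group I G)"
  then show "x \<otimes>\<^bsub>product_group I G\<^esub> y = y \<otimes>\<^bsub>product_group I G\<^esub> x"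
    using assms by (auto simp: PiE_iff comm_groupE(4) intro!: restrict_ext)
qed

lemma (in comm_group) comm_group_subgroup: "subgroup H G \<Longrightarrow> comm_group (G\<lparr>carrier := H\<rparr>)"
  by (intro group.group_comm_groupI subgroup.subgroup_is_group)
    (auto intro: m_comm subgroup.mem_carrier is_group)

lemma (in comm_group) m_interchange:
  "a \<in> carrier G \<Longrightarrow> b \<in> carrier G \<Longrightarrow> c \<in> carrier G \<Longrightarrow> d \<in> carrier G
    \<Longrightarrow> (a \<otimes> b) \<otimes> (c \<otimes> d) = (a \<otimes> c) \<otimes> (b \<otimes> d)"
  by (simp add: m_ac)

context affine_extension
begin

section \<open>Second cohomology\<close>

text \<open>A nested product over symbols and argument tuples. Its unit and product are
  \<open>cocycle_zero\<close> and \<open>cocycle_add\<close>, so the group laws for cocycles come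
  from those of the fibres.\<close>

definition cocycle_group :: "('f, 'a, 'q) cochain monoid"
  where "cocycle_group = product_group (symbols \<tau>)
    (\<lambda>f. product_group (tuples (carrier Q) (arity \<tau> f)) (\<lambda>qs. fibre_group (oper Q f qs)))"

definition section_group :: "('q \<Rightarrow> ('a \<times> 'a) set) monoid"
  where "section_group = product_group (carrier Q) fibre_group"

lemma oper_Q_tuples:
  "f \<in> symbols \<tau> \<Longrightarrow> qs \<in> tuples (carrier Q) (arity \<tau> f) \<Longrightarrow> oper Q f qs \<in> carrier Q"
  using algebra_Q by (auto simp: is_algebra_def)

lemma cocycle_group_simps:
  "carrier cocycle_group = cocycles"
  "\<one>\<^bsub>cocycle_group\<^esub> = cocycle_zero"
  "S \<otimes>\<^bsub>cocycle_group\<^esub> T = cocycle_add S T"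
  by (simp_all add: cocycle_group_def cocycles_def cocycle_zero_def cocycle_add_def mk_cochain_def
      fibre_group_simps)

lemma section_group_simps:
  "carrier section_group = sections"
  "\<one>\<^bsub>section_group\<^esub> = (\<lambda>q\<in>carrier Q. \<delta> (l q))"
  "d \<otimes>\<^bsub>section_group\<^esub> e = (\<lambda>q\<in>carrier Q. fadd q (d q) (e q))"
  by (simp_all add: section_group_def sections_def fibre_group_simps)

lemma group_fibre: "q \<in> carrier Q \<Longrightarrow> group (fibre_group q)"
  using comm_group_fibre comm_group.axioms(2) by blast

lemma comm_group_cocycle_group: "comm_group cocycle_group"
  unfolding cocycle_group_def
  by (intro comm_group_product_group comm_group_fibre oper_Q_tuples)

lemma comm_group_section_group: "comm_group section_group"
  unfolding section_group_def by (intro comm_group_product_group comm_group_fibre)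

text \<open>Inverses in a product are componentwise, applied here at both levels. This identifies
  \<open>cocycle_sub\<close> with subtraction in the group.\<close>

lemma inv_cocycle_group:
  assumes "T \<in> cocycles"
  shows "inv\<^bsub>cocycle_group\<^esub> T = mk_cochain (\<lambda>f qs. fneg (oper Q f qs) (T f qs))"
proof -
  let ?G = "\<lambda>f. product_group (tuples (carrier Q) (arity \<tau> f)) (\<lambda>qs. fibre_group (oper Q f qs))"
  have G: "group (?G f)" if "f \<in> symbols \<tau>" for f
    using that by (intro product_group group_fibre oper_Q_tuples)
  have "inv\<^bsub>cocycle_group\<^esub> T = (\<lambda>f\<in>symbols \<tau>. inv\<^bsub>?G f\<^esub> (T f))"
    unfolding cocycle_group_def using assms G
    by (intro inv_product_group) (auto simp: cocycles_def fibre_group_simps)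
  also have "\<dots> = mk_cochain (\<lambda>f qs. fneg (oper Q f qs) (T f qs))"
    unfolding mk_cochain_def using assms
    by (intro restrict_ext inv_product_group group_fibre oper_Q_tuples)
      (auto simp: cocycles_def fibre_group_simps)
  finally show ?thesis .
qed

lemma mk_cochain_apply:
  "f \<in> symbols \<tau> \<Longrightarrow> qs \<in> tuples (carrier Q) (arity \<tau> f) \<Longrightarrow> mk_cochain T f qs = T f qs"
  by (simp add: mk_cochain_def)

lemma mk_cochain_cong:
  "(\<And>f qs. f \<in> symbols \<tau> \<Longrightarrow> qs \<in> tuples (carrier Q) (arity \<tau> f) \<Longrightarrow> S f qs = T f qs)
    \<Longrightarrow> mk_cochain S = mk_cochain T"
  unfolding mk_cochain_def by (intro restrict_ext) simp

lemma mk_cochain_cocycle: "T \<in> cocycles \<Longrightarrow> mk_cochain T = T"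
  unfolding mk_cochain_def cocycles_def
  by (intro ext) (auto simp: restrict_def PiE_iff extensional_def)

lemma mk_cochain_in_cocycles:
  "(\<And>f qs. f \<in> symbols \<tau> \<Longrightarrow> qs \<in> tuples (carrier Q) (arity \<tau> f) \<Longrightarrow> T f qs \<in> fibre (oper Q f qs))
    \<Longrightarrow> mk_cochain T \<in> cocycles"
  by (auto simp: mk_cochain_def cocycles_def)

lemma cocycle_fibre:
  "T \<in> cocycles \<Longrightarrow> f \<in> symbols \<tau> \<Longrightarrow> qs \<in> tuples (carrier Q) (arity \<tau> f)
    \<Longrightarrow> T f qs \<in> fibre (oper Q f qs)"
  unfolding cocycles_def by blast

lemma cocycle_eqI:
  assumes "S \<in> cocycles" "T \<in> cocycles"
    and "\<And>f qs. f \<in> symbols \<tau> \<Longrightarrow> qs \<in> tuples (carrier Q) (arity \<tau> f) \<Longrightarrow> S f qs = T f qs"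
  shows "S = T"
  using mk_cochain_cong[of S T] assms by (simp add: mk_cochain_cocycle)

lemma cocycle_sub_eq:
  assumes "T \<in> cocycles"
  shows "cocycle_sub S T = S \<otimes>\<^bsub>cocycle_group\<^esub> inv\<^bsub>cocycle_group\<^esub> T"
  unfolding cocycle_group_simps inv_cocycle_group[OF assms] cocycle_sub_def cocycle_add_def
  by (intro mk_cochain_cong) (simp add: mk_cochain_apply fsub_def fibre_group_simps)

lemma section_fibre: "h \<in> sections \<Longrightarrow> q \<in> carrier Q \<Longrightarrow> h q \<in> fibre q"
  by (auto simp: sections_def)

lemma fadd_fibre: "x \<in> fibre q \<Longrightarrow> y \<in> fibre q \<Longrightarrow> fadd q x y \<in> fibre q"
  using monoid.m_closed[OF group.is_monoid[OF group_fibre]] fibre_base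
  by (metis fibre_group_simps(1,3))

lemma fsub_fibre: "x \<in> fibre q \<Longrightarrow> y \<in> fibre q \<Longrightarrow> fsub q x y \<in> fibre q"
  by (simp add: fsub_def fibre_group_simps fadd_fibre fneg_fibre)

lemma fadd_interchange:
  assumes "a \<in> fibre q" "b \<in> fibre q" "c \<in> fibre q" "d \<in> fibre q"
  shows "fadd q (fadd q a b) (fadd q c d) = fadd q (fadd q a c) (fadd q b d)"
  using comm_group.m_interchange[OF comm_group_fibre[OF fibre_base[OF assms(1)]], of a b c d] assms
  by (simp add: fibre_group_simps)

lemma fneg_fadd:
  assumes "a \<in> fibre q" "b \<in> fibre q"
  shows "fneg q (fadd q a b) = fadd q (fneg q a) (fneg q b)"
  using comm_group.inv_mult[OF comm_group_fibre[OF fibre_base[OF assms(1)]], of a b] assms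
  by (simp add: fibre_group_simps)

lemma fneg_fneg: "a \<in> fibre q \<Longrightarrow> fneg q (fneg q a) = a"
  using group.inv_inv[OF group_fibre[OF fibre_base], of a q a] by (simp add: fibre_group_simps)

lemma fadd_zero: "a \<in> fibre q \<Longrightarrow> fadd q a (\<delta> (l q)) = a"
  using monoid.r_one[OF group.is_monoid[OF group_fibre[OF fibre_base]], of a q a]
  by (simp add: fibre_group_simps)

lemma sections_oper_tuple:
  assumes "h \<in> sections" "f \<in> symbols \<tau>" "qs \<in> tuples (carrier Q) (arity \<tau> f)"
  shows "oper D f (map h qs) \<in> fibre (oper Q f qs)" "h (oper Q f qs) \<in> fibre (oper Q f qs)"
proof -
  have qs: "set qs \<subseteq> carrier Q" "length qs = arity \<tau> f" using assms(3) by (auto simp: tuples_iff)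
  then show "oper D f (map h qs) \<in> fibre (oper Q f qs)"
    using oper_D_fibre[OF assms(2) qs(2), of h "\<lambda>q. q"] section_fibre[OF assms(1)] by auto
  show "h (oper Q f qs) \<in> fibre (oper Q f qs)"
    by (intro section_fibre oper_Q_tuples assms)
qed

text \<open>The defect of a section h in commuting with the operations. Equivalent cocycles differ
  by such a defect, and derivations are the sections without defect.\<close>

definition coboundary :: "('q \<Rightarrow> ('a \<times> 'a) set) \<Rightarrow> ('f, 'a, 'q) cochain"
  where "coboundary h = mk_cochain (\<lambda>f qs. fsub (oper Q f qs) (oper D f (map h qs)) (h (oper Q f qs)))"

text \<open>Operations of D are additive on fibres, and the interchange law separates the resulting
  differences.\<close>

lemma coboundary_hom: "coboundary \<in> hom section_group cocycle_group"
proof (rule homI, unfold section_group_simps cocycle_group_simps)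
  fix d e assume d: "d \<in> sections" and e: "e \<in> sections"
  show "coboundary d \<in> cocycles"
    unfolding coboundary_def by (intro mk_cochain_in_cocycles fsub_fibre sections_oper_tuple d)
  let ?s = "\<lambda>q\<in>carrier Q. fadd q (d q) (e q)"
  show "coboundary ?s = cocycle_add (coboundary d) (coboundary e)"
    unfolding cocycle_add_def coboundary_def
  proof (intro mk_cochain_cong)
    fix f qs assume f: "f \<in> symbols \<tau>" and qs: "qs \<in> tuples (carrier Q) (arity \<tau> f)"
    let ?q = "oper Q f qs"
    have mem: "set qs \<subseteq> carrier Q" "length qs = arity \<tau> f" using qs by (auto simp: tuples_iff)
    have "map ?s qs = map (\<lambda>q. fadd q (d q) (e q)) qs" using mem by auto
    moreover have "oper D f (map (\<lambda>q. fadd q (d q) (e q)) qs)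
        = fadd (oper Q f (map (\<lambda>q. q) qs)) (oper D f (map d qs)) (oper D f (map e qs))"
      using mem(1) by (intro oper_D_add[OF f mem(2)] section_fibre d e) auto
    ultimately have "oper D f (map ?s qs) = fadd ?q (oper D f (map d qs)) (oper D f (map e qs))"
      by (simp only: map_ident)
    moreover have "?s ?q = fadd ?q (d ?q) (e ?q)" using oper_Q_tuples[OF f qs] by simp
    ultimately have "fsub ?q (oper D f (map ?s qs)) (?s ?q)
        = fadd ?q (fsub ?q (oper D f (map d qs)) (d ?q)) (fsub ?q (oper D f (map e qs)) (e ?q))"
      using sections_oper_tuple[OF d f qs] sections_oper_tuple[OF e f qs]
      by (simp add: fsub_def fibre_group_simps fneg_fadd fadd_interchange fneg_fibre)
    then show "fsub ?q (oper D f (map ?s qs)) (?s ?q)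
        = fadd ?q (mk_cochain (\<lambda>f qs. fsub (oper Q f qs) (oper D f (map d qs)) (d (oper Q f qs))) f qs)
            (mk_cochain (\<lambda>f qs. fsub (oper Q f qs) (oper D f (map e qs)) (e (oper Q f qs))) f qs)"
      by (simp add: mk_cochain_apply f qs)
  qed
qed

lemma group_hom_coboundary: "group_hom section_group cocycle_group coboundary"
  by (intro group_hom.intro group_hom_axioms.intro coboundary_hom
      comm_group.axioms(2) comm_group_section_group comm_group_cocycle_group)

text \<open>The pointwise condition in \<open>equivalent\<close> is an equality of the extensional
  functions \<open>cocycle_sub S T\<close> and \<open>coboundary h\<close>. Equivalence thereby
  becomes the coset relation of the coboundaries.\<close>

lemma equivalent_iff:
  assumes S: "S \<in> cocycles" and T: "T \<in> cocycles"
  shows "equivalent S T \<longleftrightarrow> S \<otimes>\<^bsub>cocycle_group\<^esub> inv\<^bsub>cocycle_group\<^esub> T \<in> coboundary ` sections"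
proof -
  have "(\<forall>f\<in>symbols \<tau>. \<forall>qs\<in>tuples (carrier Q) (arity \<tau> f).
      fsub (oper Q f qs) (S f qs) (T f qs)
        = fsub (oper Q f qs) (oper D f (map h qs)) (h (oper Q f qs)))
    \<longleftrightarrow> cocycle_sub S T = coboundary h" for h
    unfolding cocycle_sub_def coboundary_def
  proof
    assume eq: "mk_cochain (\<lambda>f qs. fsub (oper Q f qs) (S f qs) (T f qs))
      = mk_cochain (\<lambda>f qs. fsub (oper Q f qs) (oper D f (map h qs)) (h (oper Q f qs)))"
      (is "mk_cochain ?L = mk_cochain ?R")
    show "\<forall>f\<in>symbols \<tau>. \<forall>qs\<in>tuples (carrier Q) (arity \<tau> f). ?L f qs = ?R f qs"
    proof (intro ballI)
      fix f qs assume "f \<in> symbols \<tau>" "qs \<in> tuples (carrier Q) (arity \<tau> f)"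
      then show "?L f qs = ?R f qs"
        using mk_cochain_apply[of f qs ?L] mk_cochain_apply[of f qs ?R] by (simp only: eq)
    qed
  qed (intro mk_cochain_cong, blast)
  then show ?thesis
    unfolding equivalent_def cocycle_sub_eq[OF T, symmetric] by auto
qed

subsection \<open>The algebras \<open>A_alg T\<close> and compatibility\<close>

lemma A_alg_simps:
  "carrier (A_alg T) = carrier D"
  "oper (A_alg T) f xs = fadd (oper Q f (map \<rho> xs)) (oper D f xs) (T f (map \<rho> xs))"
  by (simp_all add: A_alg_def)

lemma map_\<rho>_tuples: "set xs \<subseteq> carrier D \<Longrightarrow> length xs = n \<Longrightarrow> map \<rho> xs \<in> tuples (carrier Q) n"
  using \<rho>_closed by (auto simp: tuples_iff)

lemma oper_A_alg_fibre:
  assumes T: "T \<in> cocycles" and f: "f \<in> symbols \<tau>" and xs: "set xs \<subseteq> carrier D" "length xs = arity \<tau> f"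
  shows "oper D f xs \<in> fibre (oper Q f (map \<rho> xs))" "T f (map \<rho> xs) \<in> fibre (oper Q f (map \<rho> xs))"
    "oper (A_alg T) f xs \<in> fibre (oper Q f (map \<rho> xs))"
proof -
  show "oper D f xs \<in> fibre (oper Q f (map \<rho> xs))"
    using ua_hom_oper[OF \<rho>_hom f xs] is_algebra_closed[OF algebra_D f xs] by (simp add: fibre_iff)
  moreover show "T f (map \<rho> xs) \<in> fibre (oper Q f (map \<rho> xs))"
    by (intro cocycle_fibre[OF T f] map_\<rho>_tuples xs)
  ultimately show "oper (A_alg T) f xs \<in> fibre (oper Q f (map \<rho> xs))"
    by (simp add: A_alg_simps fadd_fibre)
qed

lemma algebra_A_alg: "T \<in> cocycles \<Longrightarrow> is_algebra \<tau> (A_alg T)"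
  using algebra_D oper_A_alg_fibre(3)[of T]
  by (auto simp: is_algebra_def A_alg_simps(1) tuples_iff fibre_iff)

lemma \<rho>_hom_A_alg: "T \<in> cocycles \<Longrightarrow> \<rho> \<in> ua_hom \<tau> (A_alg T) Q"
  using oper_A_alg_fibre(3)[of T] \<rho>_closed
  by (intro ua_homI) (auto simp: A_alg_simps(1) fibre_iff)

lemma eval_A_alg_fibre:
  assumes "T \<in> cocycles" "wf_trm \<tau> t" "range x \<subseteq> carrier D"
  shows "eval_trm (A_alg T) x t \<in> fibre (eval_trm Q (\<rho> \<circ> x) t)"
  using eval_trm_closed[OF algebra_A_alg[OF assms(1)] assms(2), of x]
    eval_trm_hom[OF algebra_A_alg[OF assms(1)] \<rho>_hom_A_alg[OF assms(1)] assms(2), of x] assms(3)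
  by (simp add: fibre_iff A_alg_simps(1))

text \<open>Fibrewise addition is a homomorphism from the fibre product of \<open>A_alg S\<close> and \<open>A_alg T\<close>
  over \<open>Q\<close> to \<open>A_alg (cocycle_add S T)\<close>.\<close>

lemma eval_A_alg_add:
  assumes S: "S \<in> cocycles" and T: "T \<in> cocycles" and t: "wf_trm \<tau> t"
    and x: "\<And>v. x v \<in> fibre (e v)" and y: "\<And>v. y v \<in> fibre (e v)"
  shows "eval_trm (A_alg (cocycle_add S T)) (\<lambda>v. fadd (e v) (x v) (y v)) t
    = fadd (eval_trm Q e t) (eval_trm (A_alg S) x t) (eval_trm (A_alg T) y t)"
  using t
proof (induction t)
  case (App f ts)
  let ?z = "\<lambda>v. fadd (e v) (x v) (y v)"
  have f: "f \<in> symbols \<tau>" and len: "length ts = arity \<tau> f" and wf: "\<And>t. t \<in> set ts \<Longrightarrow> wf_trm \<tau> t"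
    using App.prems by (auto simp: list_all_iff)
  have xD: "range x \<subseteq> carrier D" "\<rho> \<circ> x = e" and yD: "range y \<subseteq> carrier D" "\<rho> \<circ> y = e"
    using x y by (auto simp: fibre_iff)
  let ?X = "eval_trm (A_alg S) x" and ?Y = "eval_trm (A_alg T) y" and ?E = "eval_trm Q e"
  have X: "?X t \<in> fibre (?E t)" and Y: "?Y t \<in> fibre (?E t)" if "t \<in> set ts" for t
    using eval_A_alg_fibre[OF S wf[OF that] xD(1)] eval_A_alg_fibre[OF T wf[OF that] yD(1)]
    by (simp_all add: xD yD)
  have Z: "fadd (?E t) (?X t) (?Y t) \<in> fibre (?E t)" if "t \<in> set ts" for t
    by (intro fadd_fibre X Y that)
  have E: "map (\<rho> \<circ> ?X) ts = map ?E ts" "map (\<rho> \<circ> ?Y) ts = map ?E ts"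
    "map (\<rho> \<circ> (\<lambda>t. fadd (?E t) (?X t) (?Y t))) ts = map ?E ts"
    using X Y Z by (auto simp: fibre_iff)
  have Es: "map ?E ts \<in> tuples (carrier Q) (arity \<tau> f)"
    using fibre_base[OF X] len by (auto simp: tuples_iff)
  have IH: "map (eval_trm (A_alg (cocycle_add S T)) ?z) ts = map (\<lambda>t. fadd (?E t) (?X t) (?Y t)) ts"
    using App.IH wf by simp
  let ?q = "oper Q f (map ?E ts)"
  have "oper D f (map (\<lambda>t. fadd (?E t) (?X t) (?Y t)) ts) = fadd ?q (oper D f (map ?X ts)) (oper D f (map ?Y ts))"
    by (intro oper_D_add[OF f len] X Y)
  moreover have "cocycle_add S T f (map ?E ts) = fadd ?q (S f (map ?E ts)) (T f (map ?E ts))"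
    by (simp add: cocycle_add_def mk_cochain_apply f Es)
  moreover have "oper D f (map ?X ts) \<in> fibre ?q" "oper D f (map ?Y ts) \<in> fibre ?q"
    by (intro oper_D_fibre[OF f len] X Y; assumption)+
  \<comment> \<open>Four summands occur: the operation of D on both tuples and both cocycle values.
    The interchange law regroups them by cocycle.\<close>
  ultimately show ?case
    using cocycle_fibre[OF S f Es] cocycle_fibre[OF T f Es]
    by (simp add: IH A_alg_simps E fadd_interchange del: map_eq_conv)
qed simp

text \<open>An arbitrary environment x is written as x + 0. The identity for the sum is then the
  identity in \<open>A_alg S\<close> at x added to the one in \<open>A_alg T\<close> at the
  zeros.\<close>

lemma compatible_add:
  assumes E: "identities \<tau> E" and S: "S \<in> compatible_cocycles E" and T: "T \<in> compatible_cocycles E"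
  shows "cocycle_add S T \<in> compatible_cocycles E"
proof -
  have ST: "S \<in> cocycles" "T \<in> cocycles" "in_variety \<tau> E (A_alg S)" "in_variety \<tau> E (A_alg T)"
    using S T by (auto simp: compatible_cocycles_def)
  interpret Z: comm_group cocycle_group by (rule comm_group_cocycle_group)
  have add: "cocycle_add S T \<in> cocycles"
    using Z.m_closed[of S T] ST by (simp add: cocycle_group_simps)
  have "eval_trm (A_alg (cocycle_add S T)) x s = eval_trm (A_alg (cocycle_add S T)) x t"
    if st: "(s, t) \<in> E" and x: "range x \<subseteq> carrier D" for s t x
  proof -
    let ?e = "\<rho> \<circ> x" and ?y = "\<lambda>v. \<delta> (l (\<rho> (x v)))"
    have wf: "wf_trm \<tau> s" "wf_trm \<tau> t" using E st by (auto simp: identities_def)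
    have xf: "x v \<in> fibre (?e v)" for v using x by (auto simp: fibre_iff)
    have yf: "?y v \<in> fibre (?e v)" for v using \<delta>_fibre fibre_base[OF xf] by simp
    have x_eq: "(\<lambda>v. fadd (?e v) (x v) (?y v)) = x" using fadd_zero[OF xf] by simp
    have "eval_trm (A_alg S) x s = eval_trm (A_alg S) x t"
      using ST(3) st x by (auto simp: in_variety_def A_alg_simps(1))
    moreover have "eval_trm (A_alg T) ?y s = eval_trm (A_alg T) ?y t"
      using ST(4) st yf by (auto simp: in_variety_def A_alg_simps(1) fibre_iff image_subset_iff)
    \<comment> \<open>The two sides are added in fibres over values in Q, so these values must agree
      too; \<rho> carries the identity from \<open>A_alg S\<close> to Q.\<close>
    moreover have "eval_trm Q ?e s = eval_trm Q ?e t"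
      using \<open>eval_trm (A_alg S) x s = _\<close> eval_A_alg_fibre[OF ST(1) wf(1) x] eval_A_alg_fibre[OF ST(1) wf(2) x]
      by (simp add: fibre_iff)
    ultimately show ?thesis
      using eval_A_alg_add[where e = ?e, OF ST(1,2) wf(1), of x ?y]
        eval_A_alg_add[where e = ?e, OF ST(1,2) wf(2), of x ?y] xf yf
      by (simp only: x_eq)
  qed
  then show ?thesis
    using add algebra_A_alg[OF add]
    by (auto simp: compatible_cocycles_def in_variety_def A_alg_simps(1))
qed

text \<open>Adding zeros leaves the operations of D unchanged, so the identity map is a homomorphism
  from D onto the new algebra. Membership of D in the variety enters here.\<close>

lemma compatible_zero:
  assumes E: "identities \<tau> E" and D: "in_variety \<tau> E D"
  shows "cocycle_zero \<in> compatible_cocycles E"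
proof -
  interpret Z: comm_group cocycle_group by (rule comm_group_cocycle_group)
  have Z: "cocycle_zero \<in> cocycles"
    using Z.one_closed by (simp add: cocycle_group_simps)
  have "(\<lambda>x. x) \<in> ua_hom \<tau> D (A_alg cocycle_zero)"
  proof (rule ua_homI)
    fix f xs assume f: "f \<in> symbols \<tau>" and xs: "set xs \<subseteq> carrier D" "length xs = arity \<tau> f"
    then show "oper D f xs = oper (A_alg cocycle_zero) f (map (\<lambda>x. x) xs)"
      using oper_A_alg_fibre(1)[OF Z f xs] map_\<rho>_tuples[OF xs]
      by (simp add: A_alg_simps cocycle_zero_def mk_cochain_apply fadd_zero)
  qed (simp add: A_alg_simps)
  then have "in_variety \<tau> E (A_alg cocycle_zero)"
    by (rule in_variety_hom_image[OF E D]) (simp add: A_alg_simps)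
  with Z show ?thesis by (simp add: compatible_cocycles_def)
qed

text \<open>Fibrewise negation is a homomorphism from \<open>A_alg T\<close> onto the algebra of the
  inverse cocycle, because operations of D commute with negation.\<close>

lemma compatible_inv:
  assumes E: "identities \<tau> E" and T: "T \<in> compatible_cocycles E"
  shows "inv\<^bsub>cocycle_group\<^esub> T \<in> compatible_cocycles E"
proof -
  have Tc: "T \<in> cocycles" and TV: "in_variety \<tau> E (A_alg T)"
    using T by (auto simp: compatible_cocycles_def)
  interpret Z: comm_group cocycle_group by (rule comm_group_cocycle_group)
  let ?N = "inv\<^bsub>cocycle_group\<^esub> T" and ?h = "\<lambda>x. fneg (\<rho> x) x"
  have N: "?N \<in> cocycles"
    using Z.inv_closed[of T] Tc by (simp add: cocycle_group_simps)
  have h: "?h x \<in> fibre (\<rho> x)" "?h (?h x) = x" if "x \<in> carrier D" for x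
    using that fneg_fibre[of x "\<rho> x"] fneg_fneg[of x "\<rho> x"] by (auto simp: fibre_iff)
  have "?h \<in> ua_hom \<tau> (A_alg T) (A_alg ?N)"
  proof (rule ua_homI, unfold A_alg_simps(1))
    fix f xs assume f: "f \<in> symbols \<tau>" and xs: "set xs \<subseteq> carrier D" "length xs = arity \<tau> f"
    let ?q = "oper Q f (map \<rho> xs)"
    have \<rho>: "map \<rho> (map ?h xs) = map \<rho> xs" using h(1) xs by (auto simp: fibre_iff)
    have "oper D f (map ?h xs) = fneg ?q (oper D f (map (\<lambda>x. x) xs))"
      using xs by (intro oper_D_neg[OF f]) (auto simp: fibre_iff)
    moreover have "?N f (map \<rho> xs) = fneg ?q (T f (map \<rho> xs))"
      by (simp add: inv_cocycle_group[OF Tc] mk_cochain_apply f map_\<rho>_tuples xs)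
    moreover have "\<rho> (oper (A_alg T) f xs) = ?q"
      using oper_A_alg_fibre(3)[OF Tc f xs] by (simp add: fibre_iff)
    ultimately show "?h (oper (A_alg T) f xs) = oper (A_alg ?N) f (map ?h xs)"
      using oper_A_alg_fibre(1,2)[OF Tc f xs]
      by (simp only: A_alg_simps \<rho> map_ident fneg_fadd)
  qed (use h in \<open>auto simp: fibre_iff\<close>)
  moreover have "?h ` carrier (A_alg T) = carrier (A_alg ?N)"
    unfolding A_alg_simps
  proof (intro equalityI subsetI)
    fix x assume "x \<in> carrier D"
    then have "x = ?h (?h x)" "?h x \<in> carrier D" using h[of x] by (auto simp: fibre_iff)
    then show "x \<in> ?h ` carrier D" by (rule image_eqI)
  qed (use h in \<open>auto simp: fibre_iff\<close>)
  ultimately have "in_variety \<tau> E (A_alg ?N)"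
    by (rule in_variety_hom_image[OF E TV])
  with N show ?thesis by (simp add: compatible_cocycles_def)
qed

section \<open>The cohomology group: compatible cocycles modulo coboundaries\<close>

lemma subgroup_compatible:
  assumes E: "identities \<tau> E" and D: "in_variety \<tau> E D"
  shows "subgroup (compatible_cocycles E) cocycle_group"
proof -
  interpret Z: comm_group cocycle_group by (rule comm_group_cocycle_group)
  show ?thesis
    using compatible_add[OF E] compatible_zero[OF E D] compatible_inv[OF E]
    by (intro Z.subgroupI) (auto simp: cocycle_group_simps compatible_cocycles_def)
qed

lemma equiv_rel_iff:
  "(S, T) \<in> equiv_rel E \<longleftrightarrow> S \<in> compatible_cocycles E \<and> T \<in> compatible_cocycles E \<and>
    S \<otimes>\<^bsub>cocycle_group\<^esub> inv\<^bsub>cocycle_group\<^esub> T \<in> coboundary ` sections"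
  using equivalent_iff[of S T] by (auto simp: equiv_rel_def compatible_cocycles_def)

lemma subgroup_coboundaries: "subgroup (coboundary ` sections) cocycle_group"
  using group_hom.img_is_subgroup[OF group_hom_coboundary] by (simp add: section_group_simps)

text \<open>The coset relation of the coboundaries, restricted to compatible cocycles: unit,
  inverses and products of the subgroup give reflexivity, symmetry and transitivity.\<close>

lemma equiv_equiv_rel: "equiv (compatible_cocycles E) (equiv_rel E)"
proof -
  interpret Z: comm_group cocycle_group by (rule comm_group_cocycle_group)
  let ?B = "coboundary ` sections"
  note B = subgroup_coboundaries
  have car: "T \<in> carrier cocycle_group" if "T \<in> compatible_cocycles E" for T
    using that by (simp add: cocycle_group_simps compatible_cocycles_def)
  show ?thesis
  proof (rule equivI)
    show "equiv_rel E \<subseteq> compatible_cocycles E \<times> compatible_cocycles E"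
      by (auto simp: equiv_rel_iff)
    show "refl_on (compatible_cocycles E) (equiv_rel E)"
      using subgroup.one_closed[OF B] car by (auto simp: refl_on_def equiv_rel_iff)
    show "sym (equiv_rel E)"
    proof (rule symI, unfold equiv_rel_iff, elim conjE, intro conjI)
      fix S T assume S: "S \<in> compatible_cocycles E" and T: "T \<in> compatible_cocycles E"
        and *: "S \<otimes>\<^bsub>cocycle_group\<^esub> inv\<^bsub>cocycle_group\<^esub> T \<in> ?B"
      show "T \<otimes>\<^bsub>cocycle_group\<^esub> inv\<^bsub>cocycle_group\<^esub> S \<in> ?B"
        using subgroup.m_inv_closed[OF B *] car[OF S] car[OF T] by (simp add: Z.inv_mult_group)
    qed assumption+
    show "trans (equiv_rel E)"
    proof (rule transI, unfold equiv_rel_iff, elim conjE, intro conjI)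
      fix S T U assume S: "S \<in> compatible_cocycles E" and T: "T \<in> compatible_cocycles E"
        and U: "U \<in> compatible_cocycles E"
        and *: "S \<otimes>\<^bsub>cocycle_group\<^esub> inv\<^bsub>cocycle_group\<^esub> T \<in> ?B" "T \<otimes>\<^bsub>cocycle_group\<^esub> inv\<^bsub>cocycle_group\<^esub> U \<in> ?B"
      have "(S \<otimes>\<^bsub>cocycle_group\<^esub> inv\<^bsub>cocycle_group\<^esub> T) \<otimes>\<^bsub>cocycle_group\<^esub> (T \<otimes>\<^bsub>cocycle_group\<^esub> inv\<^bsub>cocycle_group\<^esub> U)
          = S \<otimes>\<^bsub>cocycle_group\<^esub> inv\<^bsub>cocycle_group\<^esub> U"
        using car[OF S] car[OF T] car[OF U]
        by (metis Z.inv_closed Z.inv_solve_left Z.m_assoc Z.m_closed)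
      then show "S \<otimes>\<^bsub>cocycle_group\<^esub> inv\<^bsub>cocycle_group\<^esub> U \<in> ?B"
        using subgroup.m_closed[OF B *] by simp
    qed assumption+
  qed
qed

lemma cls_eq_iff:
  "S \<in> compatible_cocycles E \<Longrightarrow> T \<in> compatible_cocycles E \<Longrightarrow> cls E S = cls E T \<longleftrightarrow> (S, T) \<in> equiv_rel E"
  unfolding cls_def using eq_equiv_class_iff[OF equiv_equiv_rel] by blast

lemma equiv_rel_add:
  assumes E: "identities \<tau> E" and "(S, S') \<in> equiv_rel E" "(T, T') \<in> equiv_rel E"
  shows "(cocycle_add S T, cocycle_add S' T') \<in> equiv_rel E"
proof -
  interpret Z: comm_group cocycle_group by (rule comm_group_cocycle_group)
  have car: "T \<in> carrier cocycle_group" if "T \<in> compatible_cocycles E" for T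
    using that by (simp add: cocycle_group_simps compatible_cocycles_def)
  note a = assms(2,3)[unfolded equiv_rel_iff]
  have "(S \<otimes>\<^bsub>cocycle_group\<^esub> T) \<otimes>\<^bsub>cocycle_group\<^esub> inv\<^bsub>cocycle_group\<^esub> (S' \<otimes>\<^bsub>cocycle_group\<^esub> T')
    = (S \<otimes>\<^bsub>cocycle_group\<^esub> inv\<^bsub>cocycle_group\<^esub> S') \<otimes>\<^bsub>cocycle_group\<^esub> (T \<otimes>\<^bsub>cocycle_group\<^esub> inv\<^bsub>cocycle_group\<^esub> T')"
    using a car by (simp add: Z.inv_mult Z.m_interchange)
  then show ?thesis
    using a subgroup.m_closed[OF subgroup_coboundaries] compatible_add[OF E]
    by (simp add: equiv_rel_iff flip: cocycle_group_simps(3))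
qed

text \<open>The product in \<open>H2\<close> is a union over representatives of both classes; by
  \<open>equiv_rel_add\<close> all sets in this union are equal.\<close>

lemma cls_hom:
  assumes E: "identities \<tau> E"
  shows "cls E \<in> hom (cocycle_group\<lparr>carrier := compatible_cocycles E\<rparr>) (H2 E)"
proof (rule homI; simp add: H2_def cocycle_group_simps)
  fix S T assume S: "S \<in> compatible_cocycles E" and T: "T \<in> compatible_cocycles E"
  show "cls E S \<in> compatible_cocycles E // equiv_rel E"
    unfolding cls_def by (rule quotientI[OF S])
  have self: "S \<in> cls E S" "T \<in> cls E T"
    unfolding cls_def using equiv_class_self[OF equiv_equiv_rel] S T by blast+
  have "cls E (cocycle_add S' T') = cls E (cocycle_add S T)" if "S' \<in> cls E S" "T' \<in> cls E T" for S' T'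
    using equiv_rel_add[OF E, of S S' T T'] equiv_class_eq[OF equiv_equiv_rel] that
    unfolding cls_def by blast
  then show "cls E (cocycle_add S T) = (\<Union>S\<in>cls E S. \<Union>T\<in>cls E T. cls E (cocycle_add S T))"
    using self by blast
qed

lemma comm_group_H2:
  assumes E: "identities \<tau> E" and D: "in_variety \<tau> E D"
  shows "comm_group (H2 E)"
proof -
  let ?Z = "cocycle_group\<lparr>carrier := compatible_cocycles E\<rparr>"
  interpret Z: comm_group ?Z
    by (rule comm_group.comm_group_subgroup[OF comm_group_cocycle_group subgroup_compatible[OF E D]])
  have "cls E ` compatible_cocycles E = compatible_cocycles E // equiv_rel E"
    by (auto simp: quotient_def cls_def)
  \<comment> \<open>\<open>hom_imp_img_comm_group\<close> concerns the codomain with carrier and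
    unit replaced by images; for \<open>H2\<close> both replacements change nothing.\<close>
  then have "H2 E = H2 E\<lparr>carrier := cls E ` carrier ?Z, one := cls E \<one>\<^bsub>?Z\<^esub>\<rparr>"
    by (simp add: H2_def cocycle_group_simps)
  then show ?thesis using Z.hom_imp_img_comm_group[OF cls_hom[OF E]] by simp
qed

end

section \<open>Automorphism groups\<close>

lemma ua_auto_iff:
  "h \<in> ua_auto \<tau> A \<longleftrightarrow> h \<in> ua_hom \<tau> A A \<and> h \<in> extensional (carrier A) \<and>
    bij_betw h (carrier A) (carrier A)"
  by (auto simp: ua_auto_def Bij_def)

lemma ua_auto_inv:
  assumes A: "is_algebra \<tau> A" and h: "h \<in> ua_auto \<tau> A"
  shows "(\<lambda>x\<in>carrier A. inv_into (carrier A) h x) \<in> ua_auto \<tau> A" (is "?g \<in> _")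
proof -
  have hom: "h \<in> ua_hom \<tau> A A" and bij: "bij_betw h (carrier A) (carrier A)"
    using h by (simp_all add: ua_auto_iff)
  have bij': "bij_betw (inv_into (carrier A) h) (carrier A) (carrier A)"
    by (rule bij_betw_inv_into[OF bij])
  have "?g \<in> ua_hom \<tau> A A"
  proof (rule ua_homI)
    show "?g a \<in> carrier A" if "a \<in> carrier A" for a
      using that bij_betwE[OF bij'] by simp
    fix f xs assume f: "f \<in> symbols \<tau>" and xs: "set xs \<subseteq> carrier A" "length xs = arity \<tau> f"
    have ys: "set (map ?g xs) \<subseteq> carrier A" "length (map ?g xs) = arity \<tau> f"
      using xs bij_betwE[OF bij'] by auto
    have "map h (map ?g xs) = xs"
      using xs(1) bij_betw_inv_into_right[OF bij] by (auto intro!: map_idI)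
    then have "h (oper A f (map ?g xs)) = oper A f xs"
      using ua_hom_oper[OF hom f ys] by simp
    then show "?g (oper A f xs) = oper A f (map ?g xs)"
      using bij_betw_inv_into_left[OF bij is_algebra_closed[OF A f ys]] is_algebra_closed[OF A f xs]
      by (simp del: map_map)
  qed
  moreover have "bij_betw ?g (carrier A) (carrier A)"
    using bij' by (subst bij_betw_restrict_eq) 
  ultimately show ?thesis by (simp add: ua_auto_iff)
qed

lemma compose_ua_auto:
  assumes "is_algebra \<tau> A" "g \<in> ua_auto \<tau> A" "h \<in> ua_auto \<tau> A"
  shows "compose (carrier A) g h \<in> ua_auto \<tau> A"
proof -
  have g: "g \<in> ua_hom \<tau> A A" and h: "h \<in> ua_hom \<tau> A A"
    using assms by (simp_all add: ua_auto_iff)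
  have "compose (carrier A) g h \<in> ua_hom \<tau> A A"
  proof (rule ua_homI)
    show "compose (carrier A) g h a \<in> carrier A" if "a \<in> carrier A" for a
      using that ua_hom_closed[OF g] ua_hom_closed[OF h] by (simp add: compose_def)
    fix f xs assume f: "f \<in> symbols \<tau>" and xs: "set xs \<subseteq> carrier A" "length xs = arity \<tau> f"
    have hxs: "set (map h xs) \<subseteq> carrier A" using xs ua_hom_closed[OF h] by auto
    have "map (compose (carrier A) g h) xs = map g (map h xs)"
      using xs by (auto simp: compose_def)
    then show "compose (carrier A) g h (oper A f xs) = oper A f (map (compose (carrier A) g h) xs)"
      using ua_hom_oper[OF h f xs] ua_hom_oper[OF g f hxs] is_algebra_closed[OF assms(1) f xs] xs
      by (simp add: compose_def del: map_map)
  qed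
  then show ?thesis using assms(2,3)
    by (auto simp: ua_auto_iff compose_extensional intro: bij_betw_compose)
qed

lemma id_ua_auto: "is_algebra \<tau> A \<Longrightarrow> (\<lambda>x\<in>carrier A. x) \<in> ua_auto \<tau> A"
  by (auto simp: ua_auto_iff is_algebra_closed subset_iff bij_betw_def inj_on_def intro!: ua_homI map_idI[symmetric]
      arg_cong[where f = "oper A _"])

lemma subgroup_ua_auto:
  assumes A: "is_algebra \<tau> A"
  shows "subgroup (ua_auto \<tau> A) (BijGroup (carrier A))"
proof (rule group.subgroupI[OF group_BijGroup])
  show "ua_auto \<tau> A \<subseteq> carrier (BijGroup (carrier A))" "ua_auto \<tau> A \<noteq> {}"
    using id_ua_auto[OF A] by (auto simp: ua_auto_def BijGroup_def)
  show "inv\<^bsub>BijGroup (carrier A)\<^esub> h \<in> ua_auto \<tau> A" if "h \<in> ua_auto \<tau> A" for h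
    using ua_auto_inv[OF A that] that by (subst inv_BijGroup) (auto simp: ua_auto_def)
  show "g \<otimes>\<^bsub>BijGroup (carrier A)\<^esub> h \<in> ua_auto \<tau> A" if "g \<in> ua_auto \<tau> A" "h \<in> ua_auto \<tau> A" for g h
    using compose_ua_auto[OF A that] that by (simp add: ua_auto_def BijGroup_def)
qed

lemma ua_AutoGroup_simps:
  "carrier (ua_AutoGroup \<tau> A) = ua_auto \<tau> A"
  "\<one>\<^bsub>ua_AutoGroup \<tau> A\<^esub> = (\<lambda>x\<in>carrier A. x)"
  "g \<in> ua_auto \<tau> A \<Longrightarrow> h \<in> ua_auto \<tau> A \<Longrightarrow> g \<otimes>\<^bsub>ua_AutoGroup \<tau> A\<^esub> h = compose (carrier A) g h"
  by (simp_all add: ua_AutoGroup_def BijGroup_def ua_auto_def)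

lemma group_ua_AutoGroup: "is_algebra \<tau> A \<Longrightarrow> group (ua_AutoGroup \<tau> A)"
  unfolding ua_AutoGroup_def by (intro subgroup.subgroup_is_group subgroup_ua_auto group_BijGroup)

lemma inv_ua_AutoGroup:
  assumes "is_algebra \<tau> A" "h \<in> ua_auto \<tau> A"
  shows "inv\<^bsub>ua_AutoGroup \<tau> A\<^esub> h = (\<lambda>x\<in>carrier A. inv_into (carrier A) h x)"
proof -
  have "inv\<^bsub>ua_AutoGroup \<tau> A\<^esub> h = inv\<^bsub>BijGroup (carrier A)\<^esub> h"
    unfolding ua_AutoGroup_def
    by (rule group.m_inv_consistent[OF group_BijGroup subgroup_ua_auto[OF assms(1)] assms(2)])
  then show ?thesis using assms(2) by (simp add: inv_BijGroup ua_auto_def)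
qed

context affine_extension
begin

section \<open>Cancellation and subtraction in the fibres\<close>

lemma fadd_commute: "a \<in> fibre q \<Longrightarrow> b \<in> fibre q \<Longrightarrow> fadd q a b = fadd q b a"
  using comm_groupE(4)[OF comm_group_fibre[OF fibre_base], of a q a b] by (simp add: fibre_group_simps)

lemma fadd_assoc:
  "a \<in> fibre q \<Longrightarrow> b \<in> fibre q \<Longrightarrow> c \<in> fibre q \<Longrightarrow> fadd q (fadd q a b) c = fadd q a (fadd q b c)"
  using comm_groupE(3)[OF comm_group_fibre[OF fibre_base], of a q a b c] by (simp add: fibre_group_simps)

lemma fadd_right_cancel:
  "a \<in> fibre q \<Longrightarrow> b \<in> fibre q \<Longrightarrow> c \<in> fibre q \<Longrightarrow> fadd q b a = fadd q c a \<longleftrightarrow> b = c"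
  using Group.group.right_cancel[OF group_fibre[OF fibre_base], of a q a b c]
  by (auto simp: fibre_group_simps)

lemma fadd_left_cancel:
  "a \<in> fibre q \<Longrightarrow> b \<in> fibre q \<Longrightarrow> c \<in> fibre q \<Longrightarrow> fadd q a b = fadd q a c \<longleftrightarrow> b = c"
  using fadd_right_cancel[of a q b c] by (simp add: fadd_commute[of a])

lemma fadd_fsub: 
  assumes "a \<in> fibre q" "b \<in> fibre q"
  shows "fadd q (fsub q a b) b = a"
proof -
  interpret comm_group "fibre_group q" by (rule comm_group_fibre[OF fibre_base[OF assms(1)]])
  show ?thesis
    using assms m_assoc[of a "inv\<^bsub>fibre_group q\<^esub> b" b] l_inv[of b] r_one[of a]
    by (simp add: fibre_group_simps fsub_def fneg_fibre)
qed

text \<open>Adding b + d to both sides removes the subtractions. In this arrangement the equivalence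
  of T and S through h reads h + T = S + F, with F the operation of D on the values of h, and
  compares two paths.\<close>

lemma fsub_eq_iff:
  assumes a: "a \<in> fibre q" and b: "b \<in> fibre q" and c: "c \<in> fibre q" and d: "d \<in> fibre q"
  shows "fsub q a b = fsub q c d \<longleftrightarrow> fadd q d a = fadd q b c"
proof -
  have "fsub q a b = fsub q c d \<longleftrightarrow> fadd q (fsub q a b) (fadd q b d) = fadd q (fsub q c d) (fadd q b d)"
    by (simp add: fadd_right_cancel fsub_fibre fadd_fibre assms)
  also have "fadd q (fsub q a b) (fadd q b d) = fadd q d a"
    using fadd_assoc[of "fsub q a b" q b d] by (simp add: fadd_fsub fsub_fibre assms fadd_commute[OF d a])
  also have "fadd q (fsub q c d) (fadd q b d) = fadd q b c"
    using fadd_assoc[of "fsub q c d" q d b]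
    by (simp add: fadd_fsub fsub_fibre assms fadd_commute[OF b d] fadd_commute[OF b c])
  finally show ?thesis .
qed

text \<open>The routes from a to b' through b and through a' have the same sum; cancelling one pair
  of equal sides leaves the other. For a' and b' the images of a and b under \<phi>, this exchanges
  preservation of differences for constancy of the displacement.\<close>

lemma col_parallelogram:
  assumes "(a, b) \<in> \<alpha>" "(a, a') \<in> \<alpha>" "(a, b') \<in> \<alpha>"
  shows "col a b = col a' b' \<longleftrightarrow> col a a' = col b b'"
proof -
  have bb: "(b, b') \<in> \<alpha>" and ab: "(a', b') \<in> \<alpha>" and pi: "\<pi> b = \<pi> a" "\<pi> a' = \<pi> a"
    using assms by (auto simp: \<alpha>_iff)
  have fib: "col a b \<in> fibre (\<pi> a)" "col b b' \<in> fibre (\<pi> a)" "col a a' \<in> fibre (\<pi> a)" "col a' b' \<in> fibre (\<pi> a)"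
    using assms bb ab pi by (simp_all add: col_fibre)
  have "fadd (\<pi> a) (col a b) (col b b') = fadd (\<pi> a) (col a' b') (col a a')"
    using fadd_col[OF assms(1) bb refl] fadd_col[OF assms(2) ab refl] fadd_commute[OF fib(4,3)] by simp
  then show ?thesis
    using fadd_left_cancel[OF fib(1,2,3)] fadd_right_cancel[OF fib(3,1,4)] by metis
qed

section \<open>The coordinate bijection \<gamma> and the associated cocycle\<close>

lemma \<gamma>_fibre: "a \<in> carrier A \<Longrightarrow> \<gamma> a \<in> fibre (\<pi> a)"
  unfolding \<gamma>_def using l_closed \<pi>_closed lifting by (intro col_fibre) (auto simp: \<alpha>_iff)

lemma l_\<alpha>: "a \<in> carrier A \<Longrightarrow> (l (\<pi> a), a) \<in> \<alpha>"
  using l_closed \<pi>_closed lifting by (auto simp: \<alpha>_iff)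

lemma \<gamma>_inject:
  assumes "a \<in> carrier A" "b \<in> carrier A" "\<gamma> a = \<gamma> b"
  shows "a = b"
proof -
  have "\<pi> a = \<pi> b" using \<gamma>_fibre[OF assms(1)] \<gamma>_fibre[OF assms(2)] assms(3) by (simp add: fibre_iff)
  then show ?thesis
    using col_inject[OF l_\<alpha>[OF assms(1)], of b] l_\<alpha>[OF assms(2)] assms(3) by (simp add: \<gamma>_def)
qed

lemma \<gamma>_surj:
  assumes "x \<in> carrier D"
  obtains a where "a \<in> carrier A" "\<pi> a = \<rho> x" "x = \<gamma> a"
proof -
  have q: "\<rho> x \<in> carrier Q" by (rule \<rho>_closed[OF assms])
  obtain a where "(l (\<rho> x), a) \<in> \<alpha>" "x = col (l (\<rho> x)) a"
    using carrier_D_cases[OF assms l_closed[OF q] lifting(2)[OF q]] .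
  then show thesis using that[of a] lifting(2)[OF q] by (auto simp: \<alpha>_iff \<gamma>_def)
qed

lemma \<gamma>_bij: "bij_betw \<gamma> (carrier A) (carrier D)"
proof -
  have "\<gamma> ` carrier A = carrier D"
    using \<gamma>_fibre \<gamma>_surj by (auto simp: fibre_iff image_iff) metis
  then show ?thesis using \<gamma>_inject by (auto simp: bij_betw_def inj_on_def)
qed

text \<open>The column \<gamma> a starts at the lifted point of the block and ends at a, so the
  column from a to b extends it to \<gamma> b.\<close>

lemma \<gamma>_col:
  assumes "(a, b) \<in> \<alpha>"
  shows "fadd (\<pi> a) (\<gamma> a) (col a b) = \<gamma> b"
proof -
  have a: "a \<in> carrier A" "\<pi> b = \<pi> a" "\<pi> (l (\<pi> a)) = \<pi> a" using assms lifting \<pi>_closed by (auto simp: \<alpha>_iff)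
  show ?thesis
    unfolding \<gamma>_def a(2) by (rule fadd_col[OF l_\<alpha>[OF a(1)] assms a(3)])
qed

lemma assoc_cocycle_apply:
  "f \<in> symbols \<tau> \<Longrightarrow> qs \<in> tuples (carrier Q) (arity \<tau> f)
    \<Longrightarrow> assoc_cocycle f qs = col (l (oper Q f qs)) (oper A f (map l qs))"
  by (simp add: assoc_cocycle_def mk_cochain_apply)

lemma oper_l:
  assumes f: "f \<in> symbols \<tau>" and qs: "qs \<in> tuples (carrier Q) (arity \<tau> f)"
  shows "oper A f (map l qs) \<in> carrier A" "\<pi> (oper A f (map l qs)) = oper Q f qs"
    "(l (oper Q f qs), oper A f (map l qs)) \<in> \<alpha>"
proof -
  show 1: "oper A f (map l qs) \<in> carrier A"
    using qs l_closed by (intro is_algebra_closed[OF algebra_A f]) (auto simp: tuples_iff)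
  show 2: "\<pi> (oper A f (map l qs)) = oper Q f qs"
    using \<pi>_oper_l[OF f, of qs "\<lambda>q. q"] qs by (auto simp: tuples_iff)
  show "(l (oper Q f qs), oper A f (map l qs)) \<in> \<alpha>"
    using l_\<alpha>[OF 1] 2 by simp
qed

lemma assoc_cocycle_cocycle: "assoc_cocycle \<in> cocycles"
  unfolding assoc_cocycle_def
  by (intro mk_cochain_in_cocycles col_fibre oper_l lifting(2) oper_Q_tuples)

lemma map_\<pi>_tuples: "set xs \<subseteq> carrier A \<Longrightarrow> length xs = n \<Longrightarrow> map \<pi> xs \<in> tuples (carrier Q) n"
  using \<pi>_closed by (auto simp: tuples_iff)

text \<open>The path from the lifted point to f(xs) passes through f applied to the lifted
  arguments: the associated cocycle is the leg up to there, the operation of D the leg after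
  it.\<close>

lemma \<gamma>_oper:
  assumes f: "f \<in> symbols \<tau>" and xs: "set xs \<subseteq> carrier A" "length xs = arity \<tau> f"
  shows "\<gamma> (oper A f xs)
    = fadd (oper Q f (map \<pi> xs)) (oper D f (map \<gamma> xs)) (assoc_cocycle f (map \<pi> xs))"
proof -
  let ?q = "oper Q f (map \<pi> xs)"
  note t = map_\<pi>_tuples[OF xs]
  have lx: "(l (\<pi> x), x) \<in> \<alpha>" if "x \<in> set xs" for x using l_\<alpha> xs that by auto
  have D: "oper D f (map \<gamma> xs) = col (oper A f (map l (map \<pi> xs))) (oper A f xs)"
    using oper_D_col[OF f xs(2), of "\<lambda>x. l (\<pi> x)" "\<lambda>x. x"] lx by (simp add: \<gamma>_def[abs_def] comp_def)
  have mem: "(oper A f (map l (map \<pi> xs)), oper A f xs) \<in> \<alpha>"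
    using oper_\<alpha>[OF f xs(2), of "\<lambda>x. l (\<pi> x)" "\<lambda>x. x"] lx by (simp add: comp_def)
  have "fadd ?q (assoc_cocycle f (map \<pi> xs)) (oper D f (map \<gamma> xs)) = \<gamma> (oper A f xs)"
    unfolding D assoc_cocycle_apply[OF f t] \<gamma>_def \<pi>_oper[OF f xs]
    by (intro fadd_col oper_l[OF f t] mem lifting(2) oper_Q_tuples[OF f t])
  moreover have "oper D f (map \<gamma> xs) \<in> fibre ?q"
    unfolding D by (intro col_fibre mem oper_l(2)[OF f t])
  ultimately show ?thesis
    using fadd_commute[of "assoc_cocycle f (map \<pi> xs)" ?q] cocycle_fibre[OF assoc_cocycle_cocycle f t] by simp
qed

lemma \<gamma>_hom: "\<gamma> \<in> ua_hom \<tau> A (A_alg assoc_cocycle)"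
proof (rule ua_homI)
  fix f xs assume f: "f \<in> symbols \<tau>" and xs: "set xs \<subseteq> carrier A" "length xs = arity \<tau> f"
  have "map \<rho> (map \<gamma> xs) = map \<pi> xs" using xs \<gamma>_fibre by (auto simp: fibre_iff)
  then show "\<gamma> (oper A f xs) = oper (A_alg assoc_cocycle) f (map \<gamma> xs)"
    by (simp only: \<gamma>_oper[OF f xs] A_alg_simps)
qed (use \<gamma>_fibre in \<open>auto simp: A_alg_simps fibre_iff\<close>)

lemma assoc_cocycle_compatible:
  assumes "identities \<tau> E" "in_variety \<tau> E A"
  shows "assoc_cocycle \<in> compatible_cocycles E"
  using in_variety_hom_image[OF assms \<gamma>_hom] \<gamma>_bij assoc_cocycle_cocycle
  by (simp add: compatible_cocycles_def A_alg_simps bij_betw_def)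

section \<open>Derivations\<close>

lemma Der_simps:
  "carrier Der = {d \<in> sections. \<forall>f\<in>symbols \<tau>. \<forall>qs\<in>tuples (carrier Q) (arity \<tau> f).
        d (oper Q f qs) = oper D f (map d qs)}"
  "\<one>\<^bsub>Der\<^esub> = (\<lambda>q\<in>carrier Q. \<delta> (l q))"
  "d \<otimes>\<^bsub>Der\<^esub> e = (\<lambda>q\<in>carrier Q. fadd q (d q) (e q))"
  by (simp_all add: Der_def)

text \<open>\<open>coboundary d\<close> collects the differences between the two sides of the
  derivation law. As a kernel, \<open>Der\<close> is a subgroup of the sections.\<close>

lemma carrier_Der: "carrier Der = kernel section_group cocycle_group coboundary"
proof -
  have "(\<forall>f\<in>symbols \<tau>. \<forall>qs\<in>tuples (carrier Q) (arity \<tau> f). d (oper Q f qs) = oper D f (map d qs))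
      \<longleftrightarrow> coboundary d = cocycle_zero" if d: "d \<in> sections" for d
  proof -
    have eq: "d (oper Q f qs) = oper D f (map d qs) \<longleftrightarrow> coboundary d f qs = cocycle_zero f qs"
      if f: "f \<in> symbols \<tau>" and qs: "qs \<in> tuples (carrier Q) (arity \<tau> f)" for f qs
    proof -
      let ?q = "oper Q f qs" and ?z = "\<delta> (l (oper Q f qs))"
      note fib = sections_oper_tuple[OF d f qs]
      have z: "?z \<in> fibre ?q" by (intro \<delta>_fibre oper_Q_tuples f qs)
      have "fsub ?q ?z ?z = ?z"
        using group.r_inv[OF group_fibre[OF fibre_base[OF z]], of ?z] z by (simp add: fibre_group_simps fsub_def)
      then show ?thesis
        using fsub_eq_iff[OF fib z z] fadd_zero[OF fib(1)] fadd_zero[OF fib(2)]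
        by (auto simp: coboundary_def cocycle_zero_def mk_cochain_apply f qs
            fadd_commute[OF z fib(1)])
    qed
    have "coboundary d \<in> cocycles" "cocycle_zero \<in> cocycles"
      using group_hom.hom_closed[OF group_hom_coboundary, of d] d comm_groupE(2)[OF comm_group_cocycle_group]
      by (auto simp: section_group_simps cocycle_group_simps)
    then show ?thesis using eq cocycle_eqI[of "coboundary d" cocycle_zero] by auto
  qed
  then show ?thesis
    by (auto simp: Der_simps kernel_def section_group_simps cocycle_group_simps)
qed

lemma Der_eq: "Der = section_group\<lparr>carrier := carrier Der\<rparr>"
  by (simp add: Der_def section_group_def product_group_def fadd_def fibre_group_def)

lemma comm_group_Der: "comm_group Der"
  using comm_group.comm_group_subgroup[OF comm_group_section_group group_hom.subgroup_kernel[OF group_hom_coboundary]]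
  by (subst Der_eq) (simp add: carrier_Der)

text \<open>\<open>der_bar\<close> adds \<open>col a b\<close> to \<gamma> a, which gives \<gamma> b
  by \<open>\<gamma>_col\<close>. From here on \<open>der_to_aut\<close> is handled through this
  criterion rather than through \<open>inv_into\<close>.\<close>

lemma der_to_aut_eq:
  assumes "(a, b) \<in> \<alpha>" "d (\<pi> a) = col a b"
  shows "der_to_aut d a = b"
proof -
  have ab: "a \<in> carrier A" "b \<in> carrier A" using assms by (auto simp: \<alpha>_iff)
  then have "\<rho> (\<gamma> a) = \<pi> a" using \<gamma>_fibre by (auto simp: fibre_iff)
  then have "der_bar d (\<gamma> a) = \<gamma> b" by (simp add: der_bar_def assms(2) \<gamma>_col[OF assms(1)])
  then show ?thesis
    using ab \<gamma>_bij by (simp add: der_to_aut_def bij_betw_def inv_into_f_f)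
qed

lemma der_to_aut_col:
  assumes d: "d \<in> sections" and a: "a \<in> carrier A"
  shows "(a, der_to_aut d a) \<in> \<alpha>" "col a (der_to_aut d a) = d (\<pi> a)"
proof -
  obtain b where b: "(a, b) \<in> \<alpha>" "d (\<pi> a) = col a b"
    using fibre_cases[OF section_fibre[OF d \<pi>_closed[OF a]] a refl] .
  then show "(a, der_to_aut d a) \<in> \<alpha>" "col a (der_to_aut d a) = d (\<pi> a)"
    using der_to_aut_eq[of a b d] by simp_all
qed

lemma der_to_aut_add:
  assumes d: "d \<in> sections" and e: "e \<in> sections" and a: "a \<in> carrier A"
  shows "der_to_aut (\<lambda>q\<in>carrier Q. fadd q (d q) (e q)) a = der_to_aut d (der_to_aut e a)"
proof -
  note ea = der_to_aut_col[OF e a]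
  have b: "der_to_aut e a \<in> carrier A" "\<pi> (der_to_aut e a) = \<pi> a" using ea(1) by (auto simp: \<alpha>_iff)
  note db = der_to_aut_col[OF d b(1)]
  show ?thesis
  proof (rule der_to_aut_eq)
    show "(a, der_to_aut d (der_to_aut e a)) \<in> \<alpha>" using ea(1) db(1) by (auto simp: \<alpha>_iff)
    have q: "\<pi> a \<in> carrier Q" by (rule \<pi>_closed[OF a])
    \<comment> \<open>The composite moves by e before d, so its column is e + d and the sum has to
      be turned around.\<close>
    have "fadd (\<pi> a) (d (\<pi> a)) (e (\<pi> a)) = fadd (\<pi> a) (e (\<pi> a)) (d (\<pi> a))"
      by (intro fadd_commute section_fibre d e q)
    then show "(\<lambda>q\<in>carrier Q. fadd q (d q) (e q)) (\<pi> a) = col a (der_to_aut d (der_to_aut e a))"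
      using fadd_col[OF ea(1) db(1) refl] q by (simp add: ea(2) db(2) b(2))
  qed
qed

lemma der_to_aut_zero: "a \<in> carrier A \<Longrightarrow> der_to_aut (\<lambda>q\<in>carrier Q. \<delta> (l q)) a = a"
  using \<delta>_l \<pi>_closed by (intro der_to_aut_eq) (auto simp: \<alpha>_iff)

text \<open>The column from each x to its image is d(\<pi> x). Applying f to these columns and using
  the derivation law gives the column that characterizes the image of f(xs).\<close>

lemma der_to_aut_hom:
  assumes d: "d \<in> carrier Der"
  shows "der_to_aut d \<in> ua_hom \<tau> A A"
proof (rule ua_homI)
  have ds: "d \<in> sections" using d by (simp add: Der_simps)
  show "der_to_aut d a \<in> carrier A" if "a \<in> carrier A" for a
    using der_to_aut_col(1)[OF ds that] by (simp add: \<alpha>_iff)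
  fix f xs assume f: "f \<in> symbols \<tau>" and xs: "set xs \<subseteq> carrier A" "length xs = arity \<tau> f"
  note col = der_to_aut_col[OF ds]
  have rel: "(x, der_to_aut d x) \<in> \<alpha>" if "x \<in> set xs" for x using col(1) xs that by auto
  show "der_to_aut d (oper A f xs) = oper A f (map (der_to_aut d) xs)"
  proof (rule der_to_aut_eq)
    show "(oper A f xs, oper A f (map (der_to_aut d) xs)) \<in> \<alpha>"
      using oper_\<alpha>[OF f xs(2), of "\<lambda>x. x" "der_to_aut d"] rel by simp
    have "d (\<pi> (oper A f xs)) = oper D f (map d (map \<pi> xs))"
      using d map_\<pi>_tuples[OF xs] f by (simp add: \<pi>_oper[OF f xs] Der_simps del: map_map)
    also have "map d (map \<pi> xs) = map (\<lambda>x. col x (der_to_aut d x)) xs"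
      using col(2) xs(1) by auto
    also have "oper D f \<dots> = col (oper A f xs) (oper A f (map (der_to_aut d) xs))"
      using oper_D_col[OF f xs(2), of "\<lambda>x. x" "der_to_aut d"] rel by simp
    finally show "d (\<pi> (oper A f xs)) = col (oper A f xs) (oper A f (map (der_to_aut d) xs))" .
  qed
qed

section \<open>The group of automorphisms preserving \<alpha>\<close>

lemma carrier_Aut_\<alpha>: "\<phi> \<in> carrier Aut_\<alpha> \<longleftrightarrow> \<phi> \<in> ua_auto \<tau> A \<and>
    (\<forall>a\<in>carrier A. \<forall>b\<in>carrier A. \<pi> (\<phi> a) = \<pi> (\<phi> b) \<longleftrightarrow> \<pi> a = \<pi> b)"
proof -
  \<comment> \<open>Inclusion of the image in \<alpha> says that \<phi> preserves fibres; equality,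
    for a bijection, says that it also reflects them.\<close>
  have "map_prod \<phi> \<phi> ` \<alpha> = \<alpha> \<longleftrightarrow>
      (\<forall>a\<in>carrier A. \<forall>b\<in>carrier A. \<pi> (\<phi> a) = \<pi> (\<phi> b) \<longleftrightarrow> \<pi> a = \<pi> b)" if "\<phi> \<in> ua_auto \<tau> A"
  proof -
    have bij: "bij_betw \<phi> (carrier A) (carrier A)" using that by (simp add: ua_auto_iff)
    have closed: "\<phi> a \<in> carrier A" if "a \<in> carrier A" for a using bij_betwE[OF bij] that by blast
    have inj: "\<phi> a = \<phi> b \<longleftrightarrow> a = b" if "a \<in> carrier A" "b \<in> carrier A" for a b
      using bij that by (auto simp: bij_betw_def inj_on_def)
    show ?thesis
    proof
      assume eq: "map_prod \<phi> \<phi> ` \<alpha> = \<alpha>"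
      show "\<forall>a\<in>carrier A. \<forall>b\<in>carrier A. \<pi> (\<phi> a) = \<pi> (\<phi> b) \<longleftrightarrow> \<pi> a = \<pi> b"
      proof (intro ballI)
        fix a b assume a: "a \<in> carrier A" and b: "b \<in> carrier A"
        have "\<pi> (\<phi> a) = \<pi> (\<phi> b) \<longleftrightarrow> (\<phi> a, \<phi> b) \<in> map_prod \<phi> \<phi> ` \<alpha>"
          unfolding eq using closed a b by (simp add: \<alpha>_iff)
        also have "\<dots> \<longleftrightarrow> (a, b) \<in> \<alpha>"
          using inj a b by (force simp: \<alpha>_iff)
        finally show "\<pi> (\<phi> a) = \<pi> (\<phi> b) \<longleftrightarrow> \<pi> a = \<pi> b" using a b by (simp add: \<alpha>_iff)
      qed
    next
      assume *: "\<forall>a\<in>carrier A. \<forall>b\<in>carrier A. \<pi> (\<phi> a) = \<pi> (\<phi> b) \<longleftrightarrow> \<pi> a = \<pi> b"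
      show "map_prod \<phi> \<phi> ` \<alpha> = \<alpha>"
      proof (intro equalityI subsetI)
        fix z assume "z \<in> \<alpha>"
        then obtain a b where z: "z = (a, b)" "(a, b) \<in> \<alpha>" by (cases z) auto
        then obtain a' b' where "a' \<in> carrier A" "b' \<in> carrier A" "a = \<phi> a'" "b = \<phi> b'"
          using bij unfolding bij_betw_def \<alpha>_iff by (metis imageE)
        then show "z \<in> map_prod \<phi> \<phi> ` \<alpha>" using z * by (force simp: \<alpha>_iff)
      qed (use * closed in \<open>auto simp: \<alpha>_iff\<close>)
    qed
  qed
  then show ?thesis by (auto simp: Aut_\<alpha>_def)
qed

lemma Aut_\<alpha>_eq: "Aut_\<alpha> = BijGroup (carrier A)\<lparr>carrier := carrier Aut_\<alpha>\<rparr>"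
  by (simp add: Aut_\<alpha>_def ua_AutoGroup_def)

lemma Aut_\<alpha>_simps:
  "\<one>\<^bsub>Aut_\<alpha>\<^esub> = (\<lambda>x\<in>carrier A. x)"
  "g \<in> carrier Aut_\<alpha> \<Longrightarrow> h \<in> carrier Aut_\<alpha> \<Longrightarrow> g \<otimes>\<^bsub>Aut_\<alpha>\<^esub> h = compose (carrier A) g h"
  using carrier_Aut_\<alpha> by (subst Aut_\<alpha>_eq; simp add: BijGroup_def ua_auto_def)+

lemma Aut_\<alpha>_closed: "\<phi> \<in> carrier Aut_\<alpha> \<Longrightarrow> a \<in> carrier A \<Longrightarrow> \<phi> a \<in> carrier A"
  using carrier_Aut_\<alpha> by (auto simp: ua_auto_iff intro: ua_hom_closed)

lemma Aut_\<alpha>_oper: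
  "\<phi> \<in> carrier Aut_\<alpha> \<Longrightarrow> f \<in> symbols \<tau> \<Longrightarrow> set xs \<subseteq> carrier A \<Longrightarrow> length xs = arity \<tau> f
    \<Longrightarrow> \<phi> (oper A f xs) = oper A f (map \<phi> xs)"
  using carrier_Aut_\<alpha> by (auto simp: ua_auto_iff intro: ua_hom_oper)

lemma Aut_\<alpha>_\<alpha>: "\<phi> \<in> carrier Aut_\<alpha> \<Longrightarrow> (a, b) \<in> \<alpha> \<Longrightarrow> (\<phi> a, \<phi> b) \<in> \<alpha>"
  using carrier_Aut_\<alpha> Aut_\<alpha>_closed by (simp add: \<alpha>_iff)

lemma Aut_\<alpha>_mm:
  "\<phi> \<in> carrier Aut_\<alpha> \<Longrightarrow> a \<in> carrier A \<Longrightarrow> b \<in> carrier A \<Longrightarrow> c \<in> carrier A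
    \<Longrightarrow> \<phi> (mm a b c) = mm (\<phi> a) (\<phi> b) (\<phi> c)"
  using carrier_Aut_\<alpha> by (intro ternary_op_hom[OF algebra_A wf_m]) (auto simp: ua_auto_iff)

lemma Aut_\<alpha>_inv:
  assumes "\<phi> \<in> carrier Aut_\<alpha>"
  shows "(\<lambda>x\<in>carrier A. inv_into (carrier A) \<phi> x) \<in> carrier Aut_\<alpha>" (is "?i \<in> _")
proof -
  have \<phi>: "\<phi> \<in> ua_auto \<tau> A" and *: "\<And>a b. a \<in> carrier A \<Longrightarrow> b \<in> carrier A \<Longrightarrow> \<pi> (\<phi> a) = \<pi> (\<phi> b) \<longleftrightarrow> \<pi> a = \<pi> b"
    using assms by (auto simp: carrier_Aut_\<alpha>)
  have bij: "bij_betw \<phi> (carrier A) (carrier A)" using \<phi> by (simp add: ua_auto_iff)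
  have "\<phi> (?i a) = a" "?i a \<in> carrier A" if "a \<in> carrier A" for a
    using that bij_betw_inv_into_right[OF bij] bij_betwE[OF bij_betw_inv_into[OF bij]] by auto
  then show ?thesis
    using ua_auto_inv[OF algebra_A \<phi>] * unfolding carrier_Aut_\<alpha> by metis
qed

lemma subgroup_Aut_\<alpha>: "subgroup (carrier Aut_\<alpha>) (BijGroup (carrier A))"
proof (rule group.subgroupI[OF group_BijGroup])
  show "carrier Aut_\<alpha> \<subseteq> carrier (BijGroup (carrier A))"
    by (auto simp: carrier_Aut_\<alpha> ua_auto_def BijGroup_def)
  have "(\<lambda>x\<in>carrier A. x) \<in> carrier Aut_\<alpha>"
    using id_ua_auto[OF algebra_A] by (simp add: carrier_Aut_\<alpha>)
  then show "carrier Aut_\<alpha> \<noteq> {}" by blast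
  show "inv\<^bsub>BijGroup (carrier A)\<^esub> \<phi> \<in> carrier Aut_\<alpha>" if "\<phi> \<in> carrier Aut_\<alpha>" for \<phi>
    using Aut_\<alpha>_inv[OF that] that by (subst inv_BijGroup) (auto simp: carrier_Aut_\<alpha> ua_auto_def)
  show "g \<otimes>\<^bsub>BijGroup (carrier A)\<^esub> h \<in> carrier Aut_\<alpha>" if "g \<in> carrier Aut_\<alpha>" "h \<in> carrier Aut_\<alpha>" for g h
    using that compose_ua_auto[OF algebra_A, of g h] Aut_\<alpha>_closed[OF that(2)]
    by (auto simp: carrier_Aut_\<alpha> ua_auto_def BijGroup_def compose_def)
qed

lemma group_Aut_\<alpha>: "group Aut_\<alpha>"
  by (subst Aut_\<alpha>_eq) (intro subgroup.subgroup_is_group subgroup_Aut_\<alpha> group_BijGroup)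

section \<open>Embedding of derivations into automorphisms\<close>

lemma der_to_aut_Aut_\<alpha>:
  assumes d: "d \<in> carrier Der"
  shows "der_to_aut d \<in> carrier Aut_\<alpha>"
proof -
  have ds: "d \<in> sections" using d by (simp add: Der_simps)
  \<comment> \<open>\<open>der_to_aut_add\<close> holds for all sections, so the inverse of d in the
    section group supplies the inverse map on A.\<close>
  define e where "e = inv\<^bsub>section_group\<^esub> d"
  have e: "e \<in> sections"
    using group.inv_closed[OF comm_group.axioms(2)[OF comm_group_section_group], of d] ds
    by (simp add: e_def section_group_simps)
  have "d \<otimes>\<^bsub>section_group\<^esub> e = \<one>\<^bsub>section_group\<^esub>" "e \<otimes>\<^bsub>section_group\<^esub> d = \<one>\<^bsub>section_group\<^esub>"
    using group.r_inv[OF comm_group.axioms(2)[OF comm_group_section_group], of d]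
      group.l_inv[OF comm_group.axioms(2)[OF comm_group_section_group], of d] ds
    by (simp_all add: e_def section_group_simps(1))
  then have inv: "der_to_aut d (der_to_aut e a) = a" "der_to_aut e (der_to_aut d a) = a" if "a \<in> carrier A" for a
    using der_to_aut_add[OF ds e that] der_to_aut_add[OF e ds that] der_to_aut_zero[OF that]
    by (simp_all add: section_group_simps)
  have closed: "der_to_aut d a \<in> carrier A" "der_to_aut e a \<in> carrier A" "\<pi> (der_to_aut d a) = \<pi> a"
    if "a \<in> carrier A" for a
    using der_to_aut_col(1)[OF ds that] der_to_aut_col(1)[OF e that] by (auto simp: \<alpha>_iff)
  have "bij_betw (der_to_aut d) (carrier A) (carrier A)"
    by (rule bij_betw_byWitness[where f' = "der_to_aut e"]) (use inv closed in auto)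
  moreover have "der_to_aut d \<in> extensional (carrier A)" by (simp add: der_to_aut_def)
  ultimately show ?thesis
    using der_to_aut_hom[OF d] closed(3) by (simp add: carrier_Aut_\<alpha> ua_auto_iff)
qed

lemma group_hom_der_to_aut: "group_hom Der Aut_\<alpha> der_to_aut"
proof (intro group_hom.intro group_hom_axioms.intro homI)
  show "group Der" using comm_group_Der by (rule comm_group.axioms(2))
  show "group Aut_\<alpha>" by (rule group_Aut_\<alpha>)
  show "der_to_aut d \<in> carrier Aut_\<alpha>" if "d \<in> carrier Der" for d
    by (rule der_to_aut_Aut_\<alpha>[OF that])
  show "der_to_aut (d \<otimes>\<^bsub>Der\<^esub> e) = der_to_aut d \<otimes>\<^bsub>Aut_\<alpha>\<^esub> der_to_aut e"
    if d: "d \<in> carrier Der" and e: "e \<in> carrier Der" for d e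
  proof -
    have "der_to_aut (d \<otimes>\<^bsub>Der\<^esub> e) = compose (carrier A) (der_to_aut d) (der_to_aut e)"
    proof (rule extensionalityI[of _ "carrier A"])
      show "der_to_aut (d \<otimes>\<^bsub>Der\<^esub> e) \<in> extensional (carrier A)" by (simp add: der_to_aut_def)
    qed (use d e der_to_aut_add[of d e] in \<open>simp_all add: Der_simps compose_def\<close>)
    then show ?thesis by (simp add: Aut_\<alpha>_simps der_to_aut_Aut_\<alpha> d e)
  qed
qed

text \<open>If all points stay fixed, the column d(q) read at the lifted point of q starts and ends
  there, so it is the zero of the fibre.\<close>

lemma kernel_der_to_aut: "kernel Der Aut_\<alpha> der_to_aut = {\<one>\<^bsub>Der\<^esub>}"
proof (intro equalityI subsetI)
  fix d assume "d \<in> kernel Der Aut_\<alpha> der_to_aut"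
  then have ds: "d \<in> sections" and eq: "der_to_aut d = (\<lambda>x\<in>carrier A. x)"
    by (auto simp: kernel_def Der_simps Aut_\<alpha>_simps)
  have "d = (\<lambda>q\<in>carrier Q. \<delta> (l q))"
  proof (rule extensionalityI[of _ "carrier Q"])
    fix q assume q: "q \<in> carrier Q"
    show "d q = (\<lambda>q\<in>carrier Q. \<delta> (l q)) q"
      using der_to_aut_col(2)[OF ds l_closed[OF q]] q l_closed[OF q] lifting(2)[OF q]
      by (simp add: eq \<delta>_def)
  qed (use ds in \<open>auto simp: sections_def PiE_iff\<close>)
  then show "d \<in> {\<one>\<^bsub>Der\<^esub>}" by (simp add: Der_simps)
qed (use subgroup.one_closed[OF group_hom.subgroup_kernel[OF group_hom_der_to_aut]] in auto)

section \<open>Compatible automorphisms and \<open>\<psi>\<close>\<close>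

lemma carrier_D_col:
  assumes "x \<in> carrier D"
  obtains a b where "(a, b) \<in> \<alpha>" "x = col a b"
  using \<gamma>_surj[OF assms] l_\<alpha> unfolding \<gamma>_def by metis

text \<open>Representatives are chosen for all classes at once, so that a list of classes becomes
  \<open>col\<close> mapped over a list, the form that \<open>oper_D_col\<close> requires.\<close>

lemma carrier_D_rep: "\<exists>a b. \<forall>x\<in>carrier D. (a x, b x) \<in> \<alpha> \<and> col (a x) (b x) = x"
proof -
  have "\<exists>p. (fst p, snd p) \<in> \<alpha> \<and> col (fst p) (snd p) = x" if x: "x \<in> carrier D" for x
  proof -
    obtain a b where "(a, b) \<in> \<alpha>" "x = col a b" using carrier_D_col[OF x] .
    then show ?thesis by (intro exI[of _ "(a, b)"]) simp
  qed
  then obtain p where p: "\<And>x. x \<in> carrier D \<Longrightarrow> (fst (p x), snd (p x)) \<in> \<alpha> \<and> col (fst (p x)) (snd (p x)) = x"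
    by metis
  show ?thesis
    by (intro exI[of _ "\<lambda>x. fst (p x)"] exI[of _ "\<lambda>x. snd (p x)"] ballI p)
qed

text \<open>\<phi> commutes with m and so preserves the relation d = m(b, a, c); all representatives
  in the union yield the same class.\<close>

lemma hat_col:
  assumes \<phi>: "\<phi> \<in> carrier Aut_\<alpha>" and ab: "(a, b) \<in> \<alpha>"
  shows "hat \<phi> (col a b) = col (\<phi> a) (\<phi> b)"
proof -
  have "col (\<phi> c) (\<phi> d) = col (\<phi> a) (\<phi> b)" if "(c, d) \<in> col a b" for c d
  proof -
    have "(a, c) \<in> \<alpha>" "d = mm b a c" using that by (auto simp: col_def \<Delta>_iff)
    then show ?thesis
      using Aut_\<alpha>_\<alpha>[OF \<phi>] Aut_\<alpha>_mm[OF \<phi>, of b a c] ab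
      by (intro col_eqI[symmetric]) (auto simp: \<alpha>_iff)
  qed
  moreover have "(a, b) \<in> col a b"
    unfolding col_def by (rule equiv_class_self[OF equiv_\<Delta> ab])
  ultimately have "(\<Union>(c, d)\<in>col a b. col (\<phi> c) (\<phi> d)) = col (\<phi> a) (\<phi> b)"
    by fast
  then show ?thesis by (simp add: hat_def col_closed[OF ab])
qed

lemma hat_extensional: "hat \<phi> \<in> extensional (carrier D)"
  by (simp add: hat_def)

lemma hat_closed: "\<phi> \<in> carrier Aut_\<alpha> \<Longrightarrow> x \<in> carrier D \<Longrightarrow> hat \<phi> x \<in> carrier D"
  by (metis carrier_D_col hat_col col_closed Aut_\<alpha>_\<alpha>)

lemma compose_Aut_\<alpha>: "g \<in> carrier Aut_\<alpha> \<Longrightarrow> h \<in> carrier Aut_\<alpha> \<Longrightarrow> compose (carrier A) g h \<in> carrier Aut_\<alpha>"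
  using monoid.m_closed[OF group.is_monoid[OF group_Aut_\<alpha>], of g h] by (simp add: Aut_\<alpha>_simps)

lemma hat_compose:
  assumes g: "g \<in> carrier Aut_\<alpha>" and h: "h \<in> carrier Aut_\<alpha>"
  shows "hat (compose (carrier A) g h) = compose (carrier D) (hat g) (hat h)"
proof (rule extensionalityI[OF hat_extensional compose_extensional])
  fix x assume x: "x \<in> carrier D"
  obtain a b where ab: "(a, b) \<in> \<alpha>" and xab: "x = col a b" using carrier_D_col[OF x] .
  then have "a \<in> carrier A" "b \<in> carrier A" by (auto simp: \<alpha>_iff)
  then show "hat (compose (carrier A) g h) x = compose (carrier D) (hat g) (hat h) x"
    unfolding compose_eq[OF x] unfolding xab hat_col[OF h ab] hat_col[OF g Aut_\<alpha>_\<alpha>[OF h ab]]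
      hat_col[OF compose_Aut_\<alpha>[OF g h] ab]
    by (simp add: compose_eq)
qed

lemma one_Aut_\<alpha>: "(\<lambda>x\<in>carrier A. x) \<in> carrier Aut_\<alpha>"
  using monoid.one_closed[OF group.is_monoid[OF group_Aut_\<alpha>]] by (simp add: Aut_\<alpha>_simps)

lemma hat_id: "hat (\<lambda>x\<in>carrier A. x) = (\<lambda>x\<in>carrier D. x)"
proof (rule extensionalityI[OF hat_extensional])
  fix x assume x: "x \<in> carrier D"
  obtain a b where ab: "(a, b) \<in> \<alpha>" and xab: "x = col a b" using carrier_D_col[OF x] .
  then show "hat (\<lambda>x\<in>carrier A. x) x = (\<lambda>x\<in>carrier D. x) x"
    using hat_col[OF one_Aut_\<alpha> ab] x by (auto simp: \<alpha>_iff)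
qed simp

lemma Aut_\<alpha>_inverse:
  assumes "\<phi> \<in> carrier Aut_\<alpha>"
  obtains \<phi>' where "\<phi>' \<in> carrier Aut_\<alpha>" "compose (carrier A) \<phi> \<phi>' = (\<lambda>x\<in>carrier A. x)"
    "compose (carrier A) \<phi>' \<phi> = (\<lambda>x\<in>carrier A. x)"
  using group.inv_closed[OF group_Aut_\<alpha> assms] group.r_inv[OF group_Aut_\<alpha> assms] group.l_inv[OF group_Aut_\<alpha> assms]
  by (simp add: Aut_\<alpha>_simps assms)

lemma compose_id_apply:
  "compose S f g = (\<lambda>x\<in>S. x) \<Longrightarrow> x \<in> S \<Longrightarrow> f (g x) = x"
  by (metis compose_eq restrict_apply')

lemma hat_auto:
  assumes \<phi>: "\<phi> \<in> carrier Aut_\<alpha>"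
  shows "hat \<phi> \<in> ua_auto \<tau> D"
proof -
  have "hat \<phi> \<in> ua_hom \<tau> D D"
  proof (rule ua_homI)
    fix f xs assume f: "f \<in> symbols \<tau>" and xs: "set xs \<subseteq> carrier D" "length xs = arity \<tau> f"
    obtain a b where ab: "\<And>x. x \<in> carrier D \<Longrightarrow> (a x, b x) \<in> \<alpha>"
      and col: "\<And>x. x \<in> carrier D \<Longrightarrow> col (a x) (b x) = x"
      using carrier_D_rep by metis
    have abx: "(a x, b x) \<in> \<alpha>" if "x \<in> set xs" for x using ab xs that by auto
    then have ax: "set (map a xs) \<subseteq> carrier A" "set (map b xs) \<subseteq> carrier A" by (auto simp: \<alpha>_iff)
    have "map (\<lambda>x. col (a x) (b x)) xs = xs" using col xs(1) by (auto intro!: map_idI)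
    then have "oper D f xs = col (oper A f (map a xs)) (oper A f (map b xs))"
      using oper_D_col[OF f xs(2), of a b] abx by simp
    then have "hat \<phi> (oper D f xs) = col (\<phi> (oper A f (map a xs))) (\<phi> (oper A f (map b xs)))"
      using hat_col[OF \<phi>] oper_\<alpha>[OF f xs(2), of a b] abx by simp
    also have "\<dots> = col (oper A f (map (\<phi> \<circ> a) xs)) (oper A f (map (\<phi> \<circ> b) xs))"
      using Aut_\<alpha>_oper[OF \<phi> f ax(1)] Aut_\<alpha>_oper[OF \<phi> f ax(2)] xs(2) by simp
    also have "\<dots> = oper D f (map (\<lambda>x. col ((\<phi> \<circ> a) x) ((\<phi> \<circ> b) x)) xs)"
      by (rule oper_D_col[OF f xs(2), symmetric]) (simp add: Aut_\<alpha>_\<alpha>[OF \<phi>] abx)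
    also have "map (\<lambda>x. col ((\<phi> \<circ> a) x) ((\<phi> \<circ> b) x)) xs = map (hat \<phi>) xs"
      using hat_col[OF \<phi> ab] col xs(1) by (auto simp: subset_iff)
    finally show "hat \<phi> (oper D f xs) = oper D f (map (hat \<phi>) xs)" .
  qed (rule hat_closed[OF \<phi>])
  moreover have "bij_betw (hat \<phi>) (carrier D) (carrier D)"
  proof -
    \<comment> \<open>\<open>hat\<close> respects composition and the identity, so the inverse of
      \<phi> provides the inverse of \<open>hat \<phi>\<close>.\<close>
    obtain \<phi>' where \<phi>': "\<phi>' \<in> carrier Aut_\<alpha>" "compose (carrier A) \<phi> \<phi>' = (\<lambda>x\<in>carrier A. x)"
      "compose (carrier A) \<phi>' \<phi> = (\<lambda>x\<in>carrier A. x)" using Aut_\<alpha>_inverse[OF \<phi>] .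
    have "compose (carrier D) (hat \<phi>) (hat \<phi>') = (\<lambda>x\<in>carrier D. x)"
      "compose (carrier D) (hat \<phi>') (hat \<phi>) = (\<lambda>x\<in>carrier D. x)"
      using hat_compose[OF \<phi> \<phi>'(1)] hat_compose[OF \<phi>'(1) \<phi>] by (simp_all add: \<phi>'(2,3) hat_id)
    from this[THEN compose_id_apply] show ?thesis
      using hat_closed[OF \<phi>] hat_closed[OF \<phi>'(1)]
      by (intro bij_betw_byWitness[where f' = "hat \<phi>'"]) auto
  qed
  ultimately show ?thesis by (simp add: ua_auto_iff hat_extensional)
qed

section \<open>The induced automorphism of Q\<close>

definition base :: "('a \<Rightarrow> 'a) \<Rightarrow> 'q \<Rightarrow> 'q"
  where "base \<phi> = (\<lambda>q\<in>carrier Q. \<pi> (\<phi> (l q)))"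

lemma \<psi>_eq: "\<psi> \<phi> = (hat \<phi>, base \<phi>)"
  by (simp add: \<psi>_def base_def)

lemma base_\<pi>: "\<phi> \<in> carrier Aut_\<alpha> \<Longrightarrow> a \<in> carrier A \<Longrightarrow> base \<phi> (\<pi> a) = \<pi> (\<phi> a)"
  using Aut_\<alpha>_\<alpha>[OF _ l_\<alpha>] \<pi>_closed by (simp add: base_def \<alpha>_iff)

lemma base_closed: "\<phi> \<in> carrier Aut_\<alpha> \<Longrightarrow> q \<in> carrier Q \<Longrightarrow> base \<phi> q \<in> carrier Q"
  using Aut_\<alpha>_closed l_closed \<pi>_closed by (simp add: base_def)

lemma base_compose:
  assumes g: "g \<in> carrier Aut_\<alpha>" and h: "h \<in> carrier Aut_\<alpha>"
  shows "base (compose (carrier A) g h) = compose (carrier Q) (base g) (base h)"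
proof (rule extensionalityI[OF _ compose_extensional])
  fix q assume q: "q \<in> carrier Q"
  have "base g (base h q) = base g (\<pi> (h (l q)))" using q by (simp add: base_def)
  also have "\<dots> = \<pi> (g (h (l q)))" by (intro base_\<pi> g Aut_\<alpha>_closed[OF h] l_closed q)
  finally show "base (compose (carrier A) g h) q = compose (carrier Q) (base g) (base h) q"
    using q l_closed by (simp add: base_def[of "compose _ _ _"] compose_eq)
qed (simp add: base_def)

lemma base_id: "base (\<lambda>x\<in>carrier A. x) = (\<lambda>q\<in>carrier Q. q)"
  using l_closed lifting by (auto simp: base_def intro!: restrict_ext)

lemma map_\<pi>_l: "qs \<in> tuples (carrier Q) n \<Longrightarrow> map \<pi> (map l qs) = qs"
  using lifting by (auto simp: tuples_iff subset_iff intro!: map_idI)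

lemma map_l_tuples: "qs \<in> tuples (carrier Q) n \<Longrightarrow> set (map l qs) \<subseteq> carrier A \<and> length (map l qs) = n"
  using l_closed by (auto simp: tuples_iff)

lemma base_auto:
  assumes \<phi>: "\<phi> \<in> carrier Aut_\<alpha>"
  shows "base \<phi> \<in> ua_auto \<tau> Q"
proof -
  have "base \<phi> \<in> ua_hom \<tau> Q Q"
  proof (rule ua_homI)
    fix f qs assume f: "f \<in> symbols \<tau>" and "set qs \<subseteq> carrier Q" "length qs = arity \<tau> f"
    then have qs: "qs \<in> tuples (carrier Q) (arity \<tau> f)" by (simp add: tuples_iff)
    define as where "as = map l qs"
    have as: "set as \<subseteq> carrier A" "length as = arity \<tau> f" and qs_as: "map \<pi> as = qs"
      using map_l_tuples[OF qs] map_\<pi>_l[OF qs] by (simp_all add: as_def)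
    have \<phi>as: "set (map \<phi> as) \<subseteq> carrier A" "length (map \<phi> as) = arity \<tau> f"
      using as Aut_\<alpha>_closed[OF \<phi>] by auto
    have "base \<phi> (oper Q f qs) = base \<phi> (\<pi> (oper A f as))"
      by (simp add: \<pi>_oper[OF f as] qs_as)
    also have "\<dots> = \<pi> (oper A f (map \<phi> as))"
      using base_\<pi>[OF \<phi>] is_algebra_closed[OF algebra_A f as] by (simp add: Aut_\<alpha>_oper[OF \<phi> f as])
    also have "\<dots> = oper Q f (map \<pi> (map \<phi> as))" by (rule \<pi>_oper[OF f \<phi>as])
    also have "map \<pi> (map \<phi> as) = map (base \<phi>) (map \<pi> as)"
      using base_\<pi>[OF \<phi>] as(1) by auto
    finally show "base \<phi> (oper Q f qs) = oper Q f (map (base \<phi>) qs)" by (simp only: qs_as)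
  qed (rule base_closed[OF \<phi>])
  moreover have "bij_betw (base \<phi>) (carrier Q) (carrier Q)"
  proof -
    obtain \<phi>' where \<phi>': "\<phi>' \<in> carrier Aut_\<alpha>" "compose (carrier A) \<phi> \<phi>' = (\<lambda>x\<in>carrier A. x)"
      "compose (carrier A) \<phi>' \<phi> = (\<lambda>x\<in>carrier A. x)" using Aut_\<alpha>_inverse[OF \<phi>] .
    have "compose (carrier Q) (base \<phi>) (base \<phi>') = (\<lambda>x\<in>carrier Q. x)"
      "compose (carrier Q) (base \<phi>') (base \<phi>) = (\<lambda>x\<in>carrier Q. x)"
      using base_compose[OF \<phi> \<phi>'(1)] base_compose[OF \<phi>'(1) \<phi>] by (simp_all add: \<phi>'(2,3) base_id)
    from this[THEN compose_id_apply] show ?thesis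
      using base_closed[OF \<phi>] base_closed[OF \<phi>'(1)]
      by (intro bij_betw_byWitness[where f' = "base \<phi>'"]) auto
  qed
  ultimately show ?thesis by (simp add: ua_auto_iff base_def)
qed

text \<open>Given (C2) and (C3), condition (C1) is automatic, because \<open>act\<close> is built from the
  operations of \<open>D\<close> and the zeros of the fibres.\<close>

lemma carrier_C_iff:
  "(\<sigma>, \<kappa>) \<in> carrier C \<longleftrightarrow> \<sigma> \<in> ua_auto \<tau> D \<and> \<kappa> \<in> ua_auto \<tau> Q \<and>
    (\<forall>x\<in>carrier D. \<rho> (\<sigma> x) = \<kappa> (\<rho> x)) \<and> (\<forall>q\<in>carrier Q. \<sigma> (\<delta> (l q)) = \<delta> (l (\<kappa> q)))"
  (is "?L \<longleftrightarrow> ?R")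
proof
  assume ?L
  then have C: "\<sigma> \<in> ua_auto \<tau> D" "\<kappa> \<in> ua_auto \<tau> Q" "\<forall>x\<in>carrier D. \<rho> (\<sigma> x) = \<kappa> (\<rho> x)"
    and C3: "\<forall>x\<in>carrier A. \<exists>y\<in>carrier A. \<sigma> (\<delta> x) = \<delta> y"
    by (auto simp: C_def)
  have "\<sigma> (\<delta> (l q)) = \<delta> (l (\<kappa> q))" if q: "q \<in> carrier Q" for q
  proof -
    \<comment> \<open>(C3) yields the zero of some fibre; (C2) locates it over \<kappa>(q), where
      there is only one zero.\<close>
    obtain y where y: "y \<in> carrier A" "\<sigma> (\<delta> (l q)) = \<delta> y" using C3 l_closed[OF q] by blast
    have "\<rho> (\<sigma> (\<delta> (l q))) = \<kappa> q"
      using C(3) \<delta>_fibre[OF q] by (auto simp: fibre_iff)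
    moreover have "\<rho> (\<delta> y) = \<pi> y" using y by (simp add: \<delta>_def \<rho>_col \<alpha>_iff)
    ultimately show ?thesis using y \<delta>_l[OF y(1)] by (simp add: \<delta>_def)
  qed
  with C show ?R by blast
next
  assume R: ?R
  have \<sigma>: "\<sigma> \<in> ua_hom \<tau> D D" using R by (simp add: ua_auto_iff)
  have "\<sigma> (act f p x q) = act f (map \<kappa> p) (\<sigma> x) (map \<kappa> q)"
    if f: "f \<in> symbols \<tau>" and i: "i \<in> {1..arity \<tau> f}" and p: "p \<in> tuples (carrier Q) (i - 1)"
      and q: "q \<in> tuples (carrier Q) (arity \<tau> f - i)" and x: "x \<in> carrier D" for f i p q x
  proof -
    let ?xs = "map (\<delta> \<circ> l) p @ [x] @ map (\<delta> \<circ> l) q"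
    have "\<delta> (l r) \<in> carrier D" if "r \<in> carrier Q" for r
      using \<delta>_fibre[OF that] by (simp add: fibre_iff)
    then have "set ?xs \<subseteq> carrier D" "length ?xs = arity \<tau> f"
      using p q x i by (auto simp: tuples_iff)
    then have "\<sigma> (oper D f ?xs) = oper D f (map \<sigma> ?xs)" by (rule ua_hom_oper[OF \<sigma> f])
    also have "map \<sigma> ?xs = map (\<delta> \<circ> l) (map \<kappa> p) @ [\<sigma> x] @ map (\<delta> \<circ> l) (map \<kappa> q)"
      using R p q by (auto simp: tuples_iff subset_iff)
    finally show ?thesis by (simp only: act_def)
  qed
  moreover have "\<exists>y\<in>carrier A. \<sigma> (\<delta> x) = \<delta> y" if x: "x \<in> carrier A" for x
  proof
    have \<kappa>: "\<kappa> (\<pi> x) \<in> carrier Q"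
      using R \<pi>_closed[OF x] by (auto simp: ua_auto_iff intro: ua_hom_closed)
    then show "l (\<kappa> (\<pi> x)) \<in> carrier A" by (rule l_closed)
    have "\<delta> x = \<delta> (l (\<pi> x))" using \<delta>_l[OF x] by (simp add: \<delta>_def)
    then show "\<sigma> (\<delta> x) = \<delta> (l (\<kappa> (\<pi> x)))" using R \<pi>_closed[OF x] by simp
  qed
  ultimately show ?L using R by (auto simp: C_def)
qed

section \<open>The group of compatible automorphisms\<close>

lemma subgroup_C: "subgroup (carrier C) (ua_AutoGroup \<tau> D \<times>\<times> ua_AutoGroup \<tau> Q)"
proof (rule group.subgroupI[OF DirProd_group[OF group_ua_AutoGroup[OF algebra_D] group_ua_AutoGroup[OF algebra_Q]]])
  show "carrier C \<subseteq> carrier (ua_AutoGroup \<tau> D \<times>\<times> ua_AutoGroup \<tau> Q)"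
    by (auto simp: carrier_C_iff ua_AutoGroup_simps)
  have zD: "\<delta> (l q) \<in> carrier D" if "q \<in> carrier Q" for q
    using \<delta>_fibre[OF that] by (simp add: fibre_iff)
  have "((\<lambda>x\<in>carrier D. x), (\<lambda>q\<in>carrier Q. q)) \<in> carrier C"
    using id_ua_auto[OF algebra_D] id_ua_auto[OF algebra_Q] \<rho>_closed zD
    by (simp add: carrier_C_iff)
  then show "carrier C \<noteq> {}" by blast
  show "c \<otimes>\<^bsub>ua_AutoGroup \<tau> D \<times>\<times> ua_AutoGroup \<tau> Q\<^esub> d \<in> carrier C"
    if "c \<in> carrier C" "d \<in> carrier C" for c d
  proof (cases c; cases d)
    fix \<sigma> \<kappa> \<sigma>' \<kappa>' assume cd: "c = (\<sigma>, \<kappa>)" "d = (\<sigma>', \<kappa>')"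
    note C = that[unfolded cd carrier_C_iff]
    have "\<sigma>' x \<in> carrier D" if "x \<in> carrier D" for x
      using C that by (auto simp: ua_auto_iff intro: ua_hom_closed)
    moreover have "\<kappa>' q \<in> carrier Q" if "q \<in> carrier Q" for q
      using C that by (auto simp: ua_auto_iff intro: ua_hom_closed)
    ultimately show ?thesis
      using C zD \<rho>_closed compose_ua_auto[OF algebra_D, of \<sigma> \<sigma>'] compose_ua_auto[OF algebra_Q, of \<kappa> \<kappa>']
      by (simp add: cd ua_AutoGroup_simps carrier_C_iff compose_eq)
  qed
  show "inv\<^bsub>ua_AutoGroup \<tau> D \<times>\<times> ua_AutoGroup \<tau> Q\<^esub> c \<in> carrier C" if "c \<in> carrier C" for c
  proof (cases c)
    fix \<sigma> \<kappa> assume c: "c = (\<sigma>, \<kappa>)"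
    note C = that[unfolded c carrier_C_iff]
    define \<sigma>' \<kappa>' where "\<sigma>' = (\<lambda>x\<in>carrier D. inv_into (carrier D) \<sigma> x)"
      and "\<kappa>' = (\<lambda>q\<in>carrier Q. inv_into (carrier Q) \<kappa> q)"
    have bij: "bij_betw \<sigma> (carrier D) (carrier D)" "bij_betw \<kappa> (carrier Q) (carrier Q)"
      using C by (auto simp: ua_auto_iff)
    have \<sigma>': "\<sigma>' x \<in> carrier D" "\<sigma> (\<sigma>' x) = x" "\<sigma>' (\<sigma> x) = x" if "x \<in> carrier D" for x
      using that bij_betw_inv_into_right[OF bij(1)] bij_betw_inv_into_left[OF bij(1)]
        bij_betwE[OF bij_betw_inv_into[OF bij(1)]] bij_betwE[OF bij(1)] by (auto simp: \<sigma>'_def)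
    have \<kappa>': "\<kappa>' x \<in> carrier Q" "\<kappa> (\<kappa>' x) = x" "\<kappa>' (\<kappa> x) = x" if "x \<in> carrier Q" for x
      using that bij_betw_inv_into_right[OF bij(2)] bij_betw_inv_into_left[OF bij(2)]
        bij_betwE[OF bij_betw_inv_into[OF bij(2)]] bij_betwE[OF bij(2)] by (auto simp: \<kappa>'_def)
    have "\<rho> (\<sigma>' x) = \<kappa>' (\<rho> x)" if "x \<in> carrier D" for x
      using \<sigma>'[OF that] C \<kappa>'(3) \<rho>_closed by metis
    moreover have "\<sigma>' (\<delta> (l q)) = \<delta> (l (\<kappa>' q))" if "q \<in> carrier Q" for q
      using \<kappa>'[OF that] C \<sigma>'(3) zD by metis
    ultimately have "(\<sigma>', \<kappa>') \<in> carrier C"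
      using ua_auto_inv[OF algebra_D, of \<sigma>] ua_auto_inv[OF algebra_Q, of \<kappa>] C
      by (simp add: carrier_C_iff \<sigma>'_def \<kappa>'_def del: restrict_apply)
    then show ?thesis
      using C unfolding c \<sigma>'_def \<kappa>'_def
      by (simp add: inv_DirProd group_ua_AutoGroup algebra_D algebra_Q ua_AutoGroup_simps inv_ua_AutoGroup)
  qed
qed

lemma C_eq: "C = (ua_AutoGroup \<tau> D \<times>\<times> ua_AutoGroup \<tau> Q)\<lparr>carrier := carrier C\<rparr>"
  by (simp add: C_def)

lemma group_C: "group C"
  by (subst C_eq) (intro subgroup.subgroup_is_group subgroup_C DirProd_group group_ua_AutoGroup algebra_D algebra_Q)

lemma C_simps:
  "\<one>\<^bsub>C\<^esub> = ((\<lambda>x\<in>carrier D. x), (\<lambda>q\<in>carrier Q. q))"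
  "(\<sigma>, \<kappa>) \<in> carrier C \<Longrightarrow> (\<sigma>', \<kappa>') \<in> carrier C
    \<Longrightarrow> (\<sigma>, \<kappa>) \<otimes>\<^bsub>C\<^esub> (\<sigma>', \<kappa>') = (compose (carrier D) \<sigma> \<sigma>', compose (carrier Q) \<kappa> \<kappa>')"
  by (subst C_eq; simp add: ua_AutoGroup_simps carrier_C_iff)+

section \<open>The homomorphism \<psi> and its kernel\<close>

lemma \<psi>_closed:
  assumes \<phi>: "\<phi> \<in> carrier Aut_\<alpha>"
  shows "\<psi> \<phi> \<in> carrier C"
  unfolding \<psi>_eq carrier_C_iff
proof (intro conjI ballI hat_auto base_auto \<phi>)
  fix x assume x: "x \<in> carrier D"
  obtain a b where ab: "(a, b) \<in> \<alpha>" and xab: "x = col a b" using carrier_D_col[OF x] .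
  then show "\<rho> (hat \<phi> x) = base \<phi> (\<rho> x)"
    unfolding xab hat_col[OF \<phi> ab] \<rho>_col[OF ab] \<rho>_col[OF Aut_\<alpha>_\<alpha>[OF \<phi> ab]]
    using base_\<pi>[OF \<phi>, of a] by (simp add: \<alpha>_iff)
next
  fix q assume q: "q \<in> carrier Q"
  have "\<phi> (l q) \<in> carrier A" using Aut_\<alpha>_closed[OF \<phi> l_closed[OF q]] .
  then show "hat \<phi> (\<delta> (l q)) = \<delta> (l (base \<phi> q))"
    using hat_col[OF \<phi>, of "l q" "l q"] \<delta>_l[of "\<phi> (l q)"] l_closed[OF q] q
    by (simp add: \<delta>_def \<alpha>_iff base_def)
qed

lemma group_hom_\<psi>: "group_hom Aut_\<alpha> C \<psi>"
proof (intro group_hom.intro group_hom_axioms.intro homI group_Aut_\<alpha> group_C \<psi>_closed)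
  fix g h assume g: "g \<in> carrier Aut_\<alpha>" and h: "h \<in> carrier Aut_\<alpha>"
  have "\<psi> (g \<otimes>\<^bsub>Aut_\<alpha>\<^esub> h) = (compose (carrier D) (hat g) (hat h), compose (carrier Q) (base g) (base h))"
    by (simp add: Aut_\<alpha>_simps(2)[OF g h] \<psi>_eq hat_compose[OF g h] base_compose[OF g h])
  then show "\<psi> (g \<otimes>\<^bsub>Aut_\<alpha>\<^esub> h) = \<psi> g \<otimes>\<^bsub>C\<^esub> \<psi> h"
    using \<psi>_closed[OF g] \<psi>_closed[OF h] by (simp add: \<psi>_eq C_simps(2))
qed

lemma der_to_aut_image: "der_to_aut ` carrier Der = kernel Aut_\<alpha> C \<psi>"
proof (intro equalityI subsetI)
  fix \<phi> assume "\<phi> \<in> der_to_aut ` carrier Der"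
  then obtain d where d: "d \<in> carrier Der" and \<phi>d: "\<phi> = der_to_aut d" by auto
  have ds: "d \<in> sections" using d by (simp add: Der_simps)
  have \<phi>: "\<phi> \<in> carrier Aut_\<alpha>" unfolding \<phi>d by (rule der_to_aut_Aut_\<alpha>[OF d])
  note col = der_to_aut_col[OF ds, folded \<phi>d]
  have "hat \<phi> = (\<lambda>x\<in>carrier D. x)"
  proof (rule extensionalityI[OF hat_extensional])
    fix x assume x: "x \<in> carrier D"
    obtain a b where ab: "(a, b) \<in> \<alpha>" and xab: "x = col a b" using carrier_D_col[OF x] .
    then have a: "a \<in> carrier A" "b \<in> carrier A" "\<pi> b = \<pi> a" by (auto simp: \<alpha>_iff)
    have "(a, \<phi> b) \<in> \<alpha>" using col(1)[OF a(2)] ab by (auto simp: \<alpha>_iff)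
    \<comment> \<open>The displacements of a and b are both d(\<pi> a); equality of these opposite
      sides of the parallelogram forces equality of the other two.\<close>
    then have "col a b = col (\<phi> a) (\<phi> b)"
      using col_parallelogram[OF ab col(1)[OF a(1)]] col(2)[OF a(1)] col(2)[OF a(2)] a(3) by simp
    then show "hat \<phi> x = (\<lambda>x\<in>carrier D. x) x" using x hat_col[OF \<phi> ab] by (simp add: xab)
  qed simp
  moreover have "base \<phi> = (\<lambda>q\<in>carrier Q. q)"
    using col(1)[OF l_closed] lifting by (auto simp: base_def \<alpha>_iff intro!: restrict_ext)
  ultimately show "\<phi> \<in> kernel Aut_\<alpha> C \<psi>" using \<phi> by (simp add: kernel_def \<psi>_eq C_simps)
next
  fix \<phi> assume "\<phi> \<in> kernel Aut_\<alpha> C \<psi>"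
  then have \<phi>: "\<phi> \<in> carrier Aut_\<alpha>" and hat: "hat \<phi> = (\<lambda>x\<in>carrier D. x)"
    and base: "base \<phi> = (\<lambda>q\<in>carrier Q. q)" by (auto simp: kernel_def \<psi>_eq C_simps)
  have rel: "(a, \<phi> a) \<in> \<alpha>" if "a \<in> carrier A" for a
    using base_\<pi>[OF \<phi> that] Aut_\<alpha>_closed[OF \<phi> that] \<pi>_closed[OF that] that by (simp add: base \<alpha>_iff)
  \<comment> \<open>The parallelogram in the other direction: a trivial \<open>hat \<phi>\<close>
    fixes \<open>col a b\<close>, so a and b are displaced by the same amount.\<close>
  have const: "col a (\<phi> a) = col b (\<phi> b)" if ab: "(a, b) \<in> \<alpha>" for a b
  proof -
    have "(a, \<phi> a) \<in> \<alpha>" "(a, \<phi> b) \<in> \<alpha>" using rel[of a] rel[of b] ab by (auto simp: \<alpha>_iff)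
    moreover have "col a b = col (\<phi> a) (\<phi> b)"
      using hat_col[OF \<phi> ab] col_closed[OF ab] by (simp add: hat)
    ultimately show ?thesis using col_parallelogram[OF ab] by simp
  qed
  \<comment> \<open>By \<open>const\<close> the displacement of the lifted point of q stands for the
    displacement of its whole fibre.\<close>
  define d where "d = (\<lambda>q\<in>carrier Q. col (l q) (\<phi> (l q)))"
  have ds: "d \<in> sections"
    unfolding sections_def d_def using rel[OF l_closed] lifting by (auto intro!: col_fibre)
  have d_\<pi>: "d (\<pi> a) = col a (\<phi> a)" if "a \<in> carrier A" for a
    using const[OF l_\<alpha>[OF that]] \<pi>_closed[OF that] by (simp add: d_def)
  have "d (oper Q f qs) = oper D f (map d qs)"
    if f: "f \<in> symbols \<tau>" and qs: "qs \<in> tuples (carrier Q) (arity \<tau> f)" for f qs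
  proof -
    define as where "as = map l qs"
    have as: "set as \<subseteq> carrier A" "length as = arity \<tau> f" and qs_as: "map \<pi> as = qs"
      using map_l_tuples[OF qs] map_\<pi>_l[OF qs] by (simp_all add: as_def)
    have rel': "(a, \<phi> a) \<in> \<alpha>" if "a \<in> set as" for a using rel as that by auto
    have "oper D f (map d qs) = oper D f (map (\<lambda>a. col a (\<phi> a)) as)"
    proof -
      have "map d qs = map (\<lambda>a. col a (\<phi> a)) as"
        unfolding qs_as[symmetric] using d_\<pi> as(1) by auto
      then show ?thesis by simp
    qed
    also have "\<dots> = col (oper A f as) (\<phi> (oper A f as))"
      using oper_D_col[OF f as(2), of "\<lambda>a. a" \<phi>] rel' by (simp add: Aut_\<alpha>_oper[OF \<phi> f as])
    also have "\<dots> = d (\<pi> (oper A f as))" using d_\<pi> is_algebra_closed[OF algebra_A f as] by simp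
    finally show ?thesis by (simp add: \<pi>_oper[OF f as] qs_as)
  qed
  with ds have "d \<in> carrier Der" by (simp add: Der_simps)
  moreover have "\<phi> = der_to_aut d"
  proof (rule extensionalityI[of _ "carrier A"])
    show "\<phi> \<in> extensional (carrier A)" using \<phi> by (simp add: carrier_Aut_\<alpha> ua_auto_iff)
    show "der_to_aut d \<in> extensional (carrier A)" by (simp add: der_to_aut_def)
    fix a assume a: "a \<in> carrier A"
    show "\<phi> a = der_to_aut d a" using der_to_aut_eq[of a "\<phi> a" d] rel[OF a] d_\<pi>[OF a] by simp
  qed
  ultimately show "\<phi> \<in> der_to_aut ` carrier Der" by blast
qed

section \<open>The Wells map\<close>

lemma C_bij:
  assumes "(\<sigma>, \<kappa>) \<in> carrier C"
  shows "bij_betw \<sigma> (carrier D) (carrier D)" "bij_betw \<kappa> (carrier Q) (carrier Q)"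
    "\<sigma> \<in> ua_hom \<tau> D D" "\<kappa> \<in> ua_hom \<tau> Q Q"
  using assms by (simp_all add: carrier_C_iff ua_auto_iff)

lemma C_fibre: "(\<sigma>, \<kappa>) \<in> carrier C \<Longrightarrow> x \<in> fibre q \<Longrightarrow> \<sigma> x \<in> fibre (\<kappa> q)"
  using ua_hom_closed[OF C_bij(3)] by (auto simp: carrier_C_iff fibre_iff)

text \<open>Fibre addition is the term m with the zero in the middle; \<sigma> commutes with terms
  and carries zeros to zeros.\<close>

lemma C_fadd:
  assumes c: "(\<sigma>, \<kappa>) \<in> carrier C" and x: "x \<in> fibre q" and y: "y \<in> fibre q"
  shows "\<sigma> (fadd q x y) = fadd (\<kappa> q) (\<sigma> x) (\<sigma> y)"
proof -
  have q: "q \<in> carrier Q" by (rule fibre_base[OF x])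
  have "\<sigma> (ternary_op D m x (\<delta> (l q)) y) = ternary_op D m (\<sigma> x) (\<sigma> (\<delta> (l q))) (\<sigma> y)"
    using x y \<delta>_fibre[OF q] by (intro ternary_op_hom[OF algebra_D wf_m C_bij(3)[OF c]]) (auto simp: fibre_iff)
  then show ?thesis using c q by (simp add: fadd_def fibre_group_def carrier_C_iff)
qed

text \<open>Writing a tuple as an image under \<kappa> keeps the inverse of \<kappa> out of later
  computations with conjugated cocycles.\<close>

lemma C_tuples:
  assumes c: "(\<sigma>, \<kappa>) \<in> carrier C" and qs: "qs \<in> tuples (carrier Q) n"
  obtains ps where "ps \<in> tuples (carrier Q) n" "qs = map \<kappa> ps" "map (inv_into (carrier Q) \<kappa>) qs = ps"
proof -
  note bij = C_bij(2)[OF c]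
  define ps where "ps = map (inv_into (carrier Q) \<kappa>) qs"
  have "ps \<in> tuples (carrier Q) n"
    using qs bij_betwE[OF bij_betw_inv_into[OF bij]] by (auto simp: ps_def tuples_iff)
  moreover have "qs = map \<kappa> ps"
    using qs bij_betw_inv_into_right[OF bij]
    by (auto simp: ps_def tuples_iff subset_iff intro!: map_idI[symmetric])
  ultimately show thesis by (rule that) (simp only: ps_def)
qed

lemma cocycle_conj_apply:
  assumes c: "(\<sigma>, \<kappa>) \<in> carrier C" and f: "f \<in> symbols \<tau>" and ps: "ps \<in> tuples (carrier Q) (arity \<tau> f)"
  shows "cocycle_conj (\<sigma>, \<kappa>) T f (map \<kappa> ps) = \<sigma> (T f ps)"
proof -
  note bij = C_bij(2)[OF c]
  have "map (inv_into (carrier Q) \<kappa>) (map \<kappa> ps) = ps"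
    using ps bij_betw_inv_into_left[OF bij] by (auto simp: tuples_iff subset_iff intro!: map_idI)
  moreover have "map \<kappa> ps \<in> tuples (carrier Q) (arity \<tau> f)"
    using ps bij_betwE[OF bij] by (auto simp: tuples_iff)
  ultimately show ?thesis by (simp add: cocycle_conj_def mk_cochain_apply f del: map_map)
qed

lemma C_oper_Q:
  assumes "(\<sigma>, \<kappa>) \<in> carrier C" "f \<in> symbols \<tau>" "ps \<in> tuples (carrier Q) (arity \<tau> f)"
  shows "oper Q f (map \<kappa> ps) = \<kappa> (oper Q f ps)"
  using ua_hom_oper[OF C_bij(4)[OF assms(1)] assms(2)] assms(3) by (simp add: tuples_iff)

lemma cocycle_conj_cocycle:
  assumes c: "(\<sigma>, \<kappa>) \<in> carrier C" and T: "T \<in> cocycles"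
  shows "cocycle_conj (\<sigma>, \<kappa>) T \<in> cocycles"
  unfolding cocycle_conj_def prod.case
proof (rule mk_cochain_in_cocycles)
  fix f qs assume f: "f \<in> symbols \<tau>" and qs: "qs \<in> tuples (carrier Q) (arity \<tau> f)"
  obtain ps where ps: "ps \<in> tuples (carrier Q) (arity \<tau> f)" "qs = map \<kappa> ps"
    "map (inv_into (carrier Q) \<kappa>) qs = ps" using C_tuples[OF c qs] .
  show "\<sigma> (T f (map (inv_into (carrier Q) \<kappa>) qs)) \<in> fibre (oper Q f qs)"
    unfolding ps(3) unfolding ps(2) C_oper_Q[OF c f ps(1)]
    by (intro C_fibre[OF c] cocycle_fibre[OF T f ps(1)])
qed

text \<open>\<sigma> is additive on fibres and moves them along \<kappa>, so it is a homomorphism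
  from \<open>A_alg T\<close> onto the algebra of the conjugated cocycle.\<close>

lemma cocycle_conj_compatible:
  assumes E: "identities \<tau> E" and c: "(\<sigma>, \<kappa>) \<in> carrier C" and T: "T \<in> compatible_cocycles E"
  shows "cocycle_conj (\<sigma>, \<kappa>) T \<in> compatible_cocycles E"
proof -
  let ?S = "cocycle_conj (\<sigma>, \<kappa>) T"
  have Tc: "T \<in> cocycles" and TV: "in_variety \<tau> E (A_alg T)"
    using T by (auto simp: compatible_cocycles_def)
  have "\<sigma> \<in> ua_hom \<tau> (A_alg T) (A_alg ?S)"
  proof (rule ua_homI, unfold A_alg_simps(1))
    fix f xs assume f: "f \<in> symbols \<tau>" and xs: "set xs \<subseteq> carrier D" "length xs = arity \<tau> f"
    note t = map_\<rho>_tuples[OF xs]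
    have \<rho>: "map \<rho> (map \<sigma> xs) = map \<kappa> (map \<rho> xs)"
      using c xs by (auto simp: carrier_C_iff)
    have "\<sigma> (oper (A_alg T) f xs)
        = fadd (\<kappa> (oper Q f (map \<rho> xs))) (\<sigma> (oper D f xs)) (\<sigma> (T f (map \<rho> xs)))"
      unfolding A_alg_simps by (intro C_fadd[OF c] oper_A_alg_fibre[OF Tc f xs])
    then show "\<sigma> (oper (A_alg T) f xs) = oper (A_alg ?S) f (map \<sigma> xs)"
      by (simp only: A_alg_simps \<rho> cocycle_conj_apply[OF c f t] C_oper_Q[OF c f t] ua_hom_oper[OF C_bij(3)[OF c] f xs])
  qed (rule ua_hom_closed[OF C_bij(3)[OF c]])
  moreover have "\<sigma> ` carrier (A_alg T) = carrier (A_alg ?S)"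
    using C_bij(1)[OF c] by (simp add: A_alg_simps bij_betw_def)
  ultimately have "in_variety \<tau> E (A_alg ?S)" by (rule in_variety_hom_image[OF E TV])
  then show ?thesis using cocycle_conj_cocycle[OF c Tc] by (simp add: compatible_cocycles_def)
qed

lemma cocycle_sub_compatible:
  assumes E: "identities \<tau> E" and D: "in_variety \<tau> E D"
    and S: "S \<in> compatible_cocycles E" and T: "T \<in> compatible_cocycles E"
  shows "cocycle_sub S T \<in> compatible_cocycles E"
proof -
  have "T \<in> cocycles" using T by (simp add: compatible_cocycles_def)
  then show ?thesis
    using subgroup.m_closed[OF subgroup_compatible[OF E D] S compatible_inv[OF E T]]
    by (simp add: cocycle_sub_eq)
qed

lemma wells_closed:
  assumes "identities \<tau> E" "in_variety \<tau> E D" "T \<in> compatible_cocycles E"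
  shows "wells E T \<in> carrier C \<rightarrow> carrier (H2 E)"
  using cocycle_sub_compatible[OF assms(1,2,3) cocycle_conj_compatible[OF assms(1) _ assms(3)]]
  by (auto simp: wells_def H2_def cls_def intro!: quotientI)

text \<open>The difference of T and its conjugate is in the zero class when it is a coboundary, that
  is, when the two are equivalent; \<open>fsub_eq_iff\<close> then clears all subtractions.\<close>

lemma wells_eq_one_iff:
  assumes E: "identities \<tau> E" and D: "in_variety \<tau> E D" and T: "T \<in> compatible_cocycles E"
    and c: "(\<sigma>, \<kappa>) \<in> carrier C"
  shows "wells E T (\<sigma>, \<kappa>) = \<one>\<^bsub>H2 E\<^esub> \<longleftrightarrow> (\<exists>h\<in>sections.
    \<forall>f\<in>symbols \<tau>. \<forall>qs\<in>tuples (carrier Q) (arity \<tau> f).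
      fadd (oper Q f qs) (h (oper Q f qs)) (T f qs)
        = fadd (oper Q f qs) (cocycle_conj (\<sigma>, \<kappa>) T f qs) (oper D f (map h qs)))"
proof -
  interpret Z: comm_group cocycle_group by (rule comm_group_cocycle_group)
  let ?S = "cocycle_conj (\<sigma>, \<kappa>) T"
  have S: "?S \<in> compatible_cocycles E" by (rule cocycle_conj_compatible[OF E c T])
  have car: "T \<in> cocycles" "?S \<in> cocycles" using T S by (auto simp: compatible_cocycles_def)
  have sub: "cocycle_sub T ?S \<in> compatible_cocycles E"
    by (rule cocycle_sub_compatible[OF E D T S])
  have zero: "cocycle_zero \<in> compatible_cocycles E" by (rule compatible_zero[OF E D])
  have "cocycle_sub T ?S \<otimes>\<^bsub>cocycle_group\<^esub> inv\<^bsub>cocycle_group\<^esub> cocycle_zero = cocycle_sub T ?S"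
    using Z.r_one[of "cocycle_sub T ?S"] Z.inv_one sub
    by (simp only: cocycle_group_simps(1,2)) (auto simp: compatible_cocycles_def)
  then have "wells E T (\<sigma>, \<kappa>) = \<one>\<^bsub>H2 E\<^esub> \<longleftrightarrow> equivalent T ?S"
    using cls_eq_iff[OF sub zero] sub zero equivalent_iff[OF car]
    by (simp add: wells_def H2_def equiv_rel_iff cocycle_sub_eq[OF car(2)])
  also have "\<dots> \<longleftrightarrow> (\<exists>h\<in>sections.
    \<forall>f\<in>symbols \<tau>. \<forall>qs\<in>tuples (carrier Q) (arity \<tau> f).
      fadd (oper Q f qs) (h (oper Q f qs)) (T f qs) = fadd (oper Q f qs) (?S f qs) (oper D f (map h qs)))"
    unfolding equivalent_def
    by (intro bex_cong ball_cong refl fsub_eq_iff cocycle_fibre[OF car(1)] cocycle_fibre[OF car(2)]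
        sections_oper_tuple)
  finally show ?thesis .
qed

section \<open>Exactness at the compatible automorphisms\<close>

lemma wells_\<psi>:
  assumes \<phi>: "\<phi> \<in> carrier Aut_\<alpha>"
  obtains h where "h \<in> sections"
    "\<And>f qs. f \<in> symbols \<tau> \<Longrightarrow> qs \<in> tuples (carrier Q) (arity \<tau> f) \<Longrightarrow>
      fadd (oper Q f qs) (h (oper Q f qs)) (assoc_cocycle f qs)
        = fadd (oper Q f qs) (cocycle_conj (\<psi> \<phi>) assoc_cocycle f qs) (oper D f (map h qs))"
proof -
  let ?\<kappa> = "base \<phi>"
  have c: "(hat \<phi>, ?\<kappa>) \<in> carrier C" using \<psi>_closed[OF \<phi>] by (simp add: \<psi>_eq)
  note bij = C_bij(2)[OF c]
  \<comment> \<open>Carrying the lifting l along \<phi> gives a second lifting, whose point over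
    \<kappa>(p) is \<phi>(l(p)).\<close>
  define a where "a = (\<lambda>q. \<phi> (l (inv_into (carrier Q) ?\<kappa> q)))"
  have a_\<kappa>: "a (?\<kappa> p) = \<phi> (l p)" if "p \<in> carrier Q" for p
    using bij_betw_inv_into_left[OF bij that] by (simp add: a_def)
  have \<phi>l: "\<phi> (l p) \<in> carrier A" "\<pi> (\<phi> (l p)) = ?\<kappa> p" if "p \<in> carrier Q" for p
    using Aut_\<alpha>_closed[OF \<phi> l_closed[OF that]] that by (simp_all add: base_def)
  \<comment> \<open>The section h is the difference of the two liftings, directed from a(q) to
    l(q).\<close>
  define h where "h = (\<lambda>q\<in>carrier Q. col (a q) (l q))"
  have h_\<kappa>: "(\<phi> (l p), l (?\<kappa> p)) \<in> \<alpha>" "h (?\<kappa> p) = col (\<phi> (l p)) (l (?\<kappa> p))" if p: "p \<in> carrier Q" for p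
    using \<phi>l[OF p] a_\<kappa>[OF p] base_closed[OF \<phi> p] l_closed[OF base_closed[OF \<phi> p]]
      lifting(2)[OF base_closed[OF \<phi> p]]
    by (simp_all add: \<alpha>_iff h_def)
  have onto: "\<exists>p\<in>carrier Q. q = ?\<kappa> p" if "q \<in> carrier Q" for q
    using bij that by (auto simp: bij_betw_def)
  have hf: "h q \<in> fibre q" if q: "q \<in> carrier Q" for q
  proof -
    obtain p where p: "p \<in> carrier Q" "q = ?\<kappa> p" using onto[OF q] by blast
    then show ?thesis using h_\<kappa>[OF p(1)] \<phi>l(2)[OF p(1)] by (simp add: col_fibre)
  qed
  have hs: "h \<in> sections" unfolding sections_def using hf by (auto simp: h_def)
  moreover have "fadd (oper Q f qs) (h (oper Q f qs)) (assoc_cocycle f qs)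
        = fadd (oper Q f qs) (cocycle_conj (\<psi> \<phi>) assoc_cocycle f qs) (oper D f (map h qs))"
    if f: "f \<in> symbols \<tau>" and qs: "qs \<in> tuples (carrier Q) (arity \<tau> f)" for f qs
  proof -
    obtain ps where ps: "ps \<in> tuples (carrier Q) (arity \<tau> f)" and qs_ps: "qs = map ?\<kappa> ps"
      using C_tuples[OF c qs] by metis
    have psQ: "set ps \<subseteq> carrier Q" "length ps = arity \<tau> f" using ps by (auto simp: tuples_iff)
    let ?p = "oper Q f ps" and ?q = "oper Q f qs"
    have p: "?p \<in> carrier Q" by (rule oper_Q_tuples[OF f ps])
    have q: "?q = ?\<kappa> ?p" unfolding qs_ps by (rule C_oper_Q[OF c f ps])
    have \<phi>f: "\<phi> (oper A f (map l ps)) = oper A f (map (\<lambda>p. \<phi> (l p)) ps)"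
      using Aut_\<alpha>_oper[OF \<phi> f, of "map l ps"] map_l_tuples[OF ps] by (simp add: comp_def)
    \<comment> \<open>The corners of a square in one block. The path u, z, w consists of h and the
      cocycle; the path u, v, w consists of the conjugated cocycle and the operation on h.\<close>
    define u v w z where "u = \<phi> (l ?p)" and "v = \<phi> (oper A f (map l ps))"
      and "w = oper A f (map l qs)" and "z = l ?q"
    have T: "assoc_cocycle f qs = col z w" unfolding w_def z_def by (rule assoc_cocycle_apply[OF f qs])
    have zw: "(z, w) \<in> \<alpha>" unfolding w_def z_def by (rule oper_l(3)[OF f qs])
    have uz: "(u, z) \<in> \<alpha>" and h: "h ?q = col u z"
      unfolding u_def z_def q using h_\<kappa>[OF p] by simp_all
    have uv: "(u, v) \<in> \<alpha>" unfolding u_def v_def by (rule Aut_\<alpha>_\<alpha>[OF \<phi> oper_l(3)[OF f ps]])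
    have pi: "\<pi> u = ?q" unfolding u_def q by (rule \<phi>l(2)[OF p])
    have S: "cocycle_conj (\<psi> \<phi>) assoc_cocycle f qs = col u v"
      unfolding \<psi>_eq qs_ps cocycle_conj_apply[OF c f ps] assoc_cocycle_apply[OF f ps] u_def v_def
      by (rule hat_col[OF \<phi> oper_l(3)[OF f ps]])
    have "map h qs = map (\<lambda>p. col (\<phi> (l p)) (l (?\<kappa> p))) ps"
      unfolding qs_ps using h_\<kappa>(2) psQ(1) by auto
    moreover have "oper D f (map (\<lambda>p. col (\<phi> (l p)) (l (?\<kappa> p))) ps)
        = col (oper A f (map (\<lambda>p. \<phi> (l p)) ps)) (oper A f (map (\<lambda>p. l (?\<kappa> p)) ps))"
      using h_\<kappa>(1) psQ by (intro oper_D_col[OF f]) auto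
    moreover have "map l qs = map (\<lambda>p. l (?\<kappa> p)) ps" by (simp add: qs_ps)
    ultimately have F: "oper D f (map h qs) = col v w"
      by (simp only: v_def w_def \<phi>f)
    have vw: "(v, w) \<in> \<alpha>" using uz uv zw by (auto simp: \<alpha>_iff)
    show ?thesis unfolding T h S F fadd_col[OF uz zw pi] fadd_col[OF uv vw pi] ..
  qed
  ultimately show thesis using that by blast
qed

text \<open>The image b of a solves \<gamma>(b) + h(\<kappa>(\<pi> a)) = \<sigma>(\<gamma> a);
  keeping h on the left leaves only sums to rearrange. The hypothesis \<open>eq\<close> enters in
  the compatibility with operations.\<close>

lemma \<psi>_lift:
  assumes c: "(\<sigma>, \<kappa>) \<in> carrier C" and h: "h \<in> sections"
    and eq: "\<And>f qs. f \<in> symbols \<tau> \<Longrightarrow> qs \<in> tuples (carrier Q) (arity \<tau> f) \<Longrightarrow>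
      fadd (oper Q f qs) (h (oper Q f qs)) (assoc_cocycle f qs)
        = fadd (oper Q f qs) (cocycle_conj (\<sigma>, \<kappa>) assoc_cocycle f qs) (oper D f (map h qs))"
  shows "\<exists>\<phi>\<in>carrier Aut_\<alpha>. \<psi> \<phi> = (\<sigma>, \<kappa>)"
proof -
  have \<sigma>: "\<sigma> \<in> extensional (carrier D)" and \<kappa>: "\<kappa> \<in> extensional (carrier Q)"
    using c by (simp_all add: carrier_C_iff ua_auto_iff)
  have \<kappa>_closed: "\<kappa> q \<in> carrier Q" if "q \<in> carrier Q" for q using bij_betwE[OF C_bij(2)[OF c]] that by blast
  have \<kappa>_inj: "\<kappa> p = \<kappa> q \<longleftrightarrow> p = q" if "p \<in> carrier Q" "q \<in> carrier Q" for p q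
    using C_bij(2)[OF c] that by (auto simp: bij_betw_def inj_on_def)
  have \<sigma>_inj: "\<sigma> x = \<sigma> y \<longleftrightarrow> x = y" if "x \<in> carrier D" "y \<in> carrier D" for x y
    using C_bij(1)[OF c] that by (auto simp: bij_betw_def inj_on_def)
  have \<sigma>\<gamma>: "\<sigma> (\<gamma> a) \<in> fibre (\<kappa> (\<pi> a))" if "a \<in> carrier A" for a
    using C_fibre[OF c \<gamma>_fibre[OF that]] .
  have h\<kappa>: "h (\<kappa> (\<pi> a)) \<in> fibre (\<kappa> (\<pi> a))" if "a \<in> carrier A" for a
    by (intro section_fibre[OF h] \<kappa>_closed \<pi>_closed that)
  have "\<exists>b. b \<in> carrier A \<and> \<pi> b = \<kappa> (\<pi> a) \<and> fadd (\<kappa> (\<pi> a)) (\<gamma> b) (h (\<kappa> (\<pi> a))) = \<sigma> (\<gamma> a)"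
    if a: "a \<in> carrier A" for a
  proof -
    let ?x = "fsub (\<kappa> (\<pi> a)) (\<sigma> (\<gamma> a)) (h (\<kappa> (\<pi> a)))"
    have x: "?x \<in> fibre (\<kappa> (\<pi> a))" by (intro fsub_fibre \<sigma>\<gamma> h\<kappa> a)
    then have "?x \<in> carrier D" "\<rho> ?x = \<kappa> (\<pi> a)" by (auto simp: fibre_iff)
    then obtain b where "b \<in> carrier A" "\<pi> b = \<kappa> (\<pi> a)" "?x = \<gamma> b" using \<gamma>_surj by metis
    then show ?thesis using fadd_fsub[OF \<sigma>\<gamma>[OF a] h\<kappa>[OF a]] by metis
  qed
  then obtain g where g: "\<And>a. a \<in> carrier A \<Longrightarrow> g a \<in> carrier A"
    "\<And>a. a \<in> carrier A \<Longrightarrow> \<pi> (g a) = \<kappa> (\<pi> a)"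
    "\<And>a. a \<in> carrier A \<Longrightarrow> fadd (\<kappa> (\<pi> a)) (\<gamma> (g a)) (h (\<kappa> (\<pi> a))) = \<sigma> (\<gamma> a)"
    by metis
  define \<phi> where "\<phi> = (\<lambda>a\<in>carrier A. g a)"
  have \<phi>: "\<phi> a \<in> carrier A" "\<pi> (\<phi> a) = \<kappa> (\<pi> a)"
    "fadd (\<kappa> (\<pi> a)) (\<gamma> (\<phi> a)) (h (\<kappa> (\<pi> a))) = \<sigma> (\<gamma> a)" if "a \<in> carrier A" for a
    using g[OF that] that by (simp_all add: \<phi>_def)
  have \<gamma>\<phi>: "\<gamma> (\<phi> a) \<in> fibre (\<kappa> (\<pi> a))" if "a \<in> carrier A" for a
    using \<gamma>_fibre[OF \<phi>(1)[OF that]] \<phi>(2)[OF that] by simp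
  \<comment> \<open>Addition cancels and \<gamma> is injective, so the equation determines the
    image. The homomorphism law and surjectivity are then shown by exhibiting solutions.\<close>
  have unique: "\<phi> a = b" if a: "a \<in> carrier A" and b: "b \<in> carrier A" "\<pi> b = \<kappa> (\<pi> a)"
    "fadd (\<kappa> (\<pi> a)) (\<gamma> b) (h (\<kappa> (\<pi> a))) = \<sigma> (\<gamma> a)" for a b
  proof -
    have "\<gamma> b \<in> fibre (\<kappa> (\<pi> a))" using \<gamma>_fibre[OF b(1)] b(2) by simp
    then have "\<gamma> (\<phi> a) = \<gamma> b"
      using fadd_right_cancel[OF h\<kappa>[OF a] \<gamma>\<phi>[OF a], of "\<gamma> b"] \<phi>(3)[OF a] b(3) by simp
    then show ?thesis by (rule \<gamma>_inject[OF \<phi>(1)[OF a] b(1)])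
  qed
  have "\<phi> \<in> ua_hom \<tau> A A"
  proof (rule ua_homI)
    fix f xs assume f: "f \<in> symbols \<tau>" and xs: "set xs \<subseteq> carrier A" "length xs = arity \<tau> f"
    have \<phi>xs: "set (map \<phi> xs) \<subseteq> carrier A" "length (map \<phi> xs) = arity \<tau> f" using xs \<phi>(1) by auto
    have xA: "x \<in> carrier A" if "x \<in> set xs" for x using xs that by auto
    note t = map_\<pi>_tuples[OF xs]
    define qs where "qs = map \<kappa> (map \<pi> xs)"
    have qs: "qs \<in> tuples (carrier Q) (arity \<tau> f)" using t \<kappa>_closed by (auto simp: qs_def tuples_iff)
    have \<pi>\<phi>: "map \<pi> (map \<phi> xs) = qs" using \<phi>(2) xs(1) by (auto simp: qs_def)
    let ?q = "oper Q f qs"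
    have q: "?q = \<kappa> (\<pi> (oper A f xs))"
      unfolding qs_def C_oper_Q[OF c f t] \<pi>_oper[OF f xs] ..
    let ?T = "assoc_cocycle f qs" and ?S = "cocycle_conj (\<sigma>, \<kappa>) assoc_cocycle f qs"
      and ?G = "oper D f (map \<gamma> (map \<phi> xs))" and ?F = "oper D f (map h qs)" and ?h = "h ?q"
    have qs': "qs = map (\<lambda>x. \<kappa> (\<pi> x)) xs" by (simp add: qs_def)
    have G: "?G \<in> fibre ?q"
      using oper_D_fibre[OF f xs(2), of "\<lambda>x. \<gamma> (\<phi> x)" "\<lambda>x. \<kappa> (\<pi> x)"] \<gamma>\<phi>[OF xA]
      by (simp add: qs' comp_def)
    have F: "?F \<in> fibre ?q" and hq: "?h \<in> fibre ?q" using sections_oper_tuple[OF h f qs] by auto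
    have T: "?T \<in> fibre ?q" by (rule cocycle_fibre[OF assoc_cocycle_cocycle f qs])
    have S: "?S \<in> fibre ?q" by (rule cocycle_fibre[OF cocycle_conj_cocycle[OF c assoc_cocycle_cocycle] f qs])
    have "oper D f (map (\<lambda>x. fadd (\<kappa> (\<pi> x)) (\<gamma> (\<phi> x)) (h (\<kappa> (\<pi> x)))) xs)
        = fadd (oper Q f (map (\<lambda>x. \<kappa> (\<pi> x)) xs)) (oper D f (map (\<lambda>x. \<gamma> (\<phi> x)) xs)) (oper D f (map (\<lambda>x. h (\<kappa> (\<pi> x))) xs))"
      by (intro oper_D_add[OF f xs(2)] \<gamma>\<phi> h\<kappa> xA)
    moreover have "map (\<lambda>x. fadd (\<kappa> (\<pi> x)) (\<gamma> (\<phi> x)) (h (\<kappa> (\<pi> x)))) xs = map \<sigma> (map \<gamma> xs)"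
      using \<phi>(3)[OF xA] by simp
    ultimately have \<sigma>D: "oper D f (map \<sigma> (map \<gamma> xs)) = fadd ?q ?G ?F"
      by (simp add: qs' comp_def)
    have \<gamma>xs: "set (map \<gamma> xs) \<subseteq> carrier D" "length (map \<gamma> xs) = arity \<tau> f"
      using xs \<gamma>_fibre by (auto simp: fibre_iff)
    have \<rho>\<gamma>: "map \<rho> (map \<gamma> xs) = map \<pi> xs" using \<gamma>_fibre xs by (auto simp: fibre_iff)
    \<comment> \<open>With G, F, S, T, h naming the terms of the \<open>let\<close> above, the left
      side is G + F + S. By \<open>eq\<close> it becomes G + T + h, and G + T is \<gamma> of f
      applied to the images.\<close>
    have "\<sigma> (\<gamma> (oper A f xs)) = fadd ?q (\<sigma> (oper D f (map \<gamma> xs))) (\<sigma> (assoc_cocycle f (map \<pi> xs)))"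
      unfolding \<gamma>_oper[OF f xs] q \<pi>_oper[OF f xs]
      using oper_A_alg_fibre(1)[OF assoc_cocycle_cocycle f \<gamma>xs] unfolding \<rho>\<gamma>
      by (intro C_fadd[OF c] cocycle_fibre[OF assoc_cocycle_cocycle f t])
    also have "\<sigma> (oper D f (map \<gamma> xs)) = fadd ?q ?G ?F"
      using ua_hom_oper[OF C_bij(3)[OF c] f \<gamma>xs] \<sigma>D by simp
    also have "\<sigma> (assoc_cocycle f (map \<pi> xs)) = ?S"
      unfolding qs_def by (rule cocycle_conj_apply[OF c f t, symmetric])
    also have "fadd ?q (fadd ?q ?G ?F) ?S = fadd ?q ?G (fadd ?q ?S ?F)"
      using fadd_assoc[OF G F S] fadd_commute[OF F S] by simp
    also have "\<dots> = fadd ?q (fadd ?q ?G ?T) ?h"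
      using eq[OF f qs] fadd_assoc[OF G T hq] fadd_commute[OF hq T] by simp
    also have "fadd ?q ?G ?T = \<gamma> (oper A f (map \<phi> xs))"
      using \<gamma>_oper[OF f \<phi>xs] by (simp only: \<pi>\<phi>)
    finally show "\<phi> (oper A f xs) = oper A f (map \<phi> xs)"
      using is_algebra_closed[OF algebra_A f xs] is_algebra_closed[OF algebra_A f \<phi>xs] \<pi>_oper[OF f \<phi>xs]
      by (intro unique) (simp_all only: \<pi>\<phi> q)
  qed (rule \<phi>(1))
  moreover have "bij_betw \<phi> (carrier A) (carrier A)"
    unfolding bij_betw_def
  proof
    show "inj_on \<phi> (carrier A)"
    proof (rule inj_onI)
      fix a b assume a: "a \<in> carrier A" and b: "b \<in> carrier A" and ab: "\<phi> a = \<phi> b"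
      have "\<kappa> (\<pi> a) = \<kappa> (\<pi> b)" using \<phi>(2)[OF a] \<phi>(2)[OF b] ab by simp
      then have "\<sigma> (\<gamma> a) = \<sigma> (\<gamma> b)" using \<phi>(3)[OF a] \<phi>(3)[OF b] ab by simp
      then have "\<gamma> a = \<gamma> b" using \<sigma>_inj \<gamma>_fibre[OF a] \<gamma>_fibre[OF b] by (auto simp: fibre_iff)
      then show "a = b" by (rule \<gamma>_inject[OF a b])
    qed
    show "\<phi> ` carrier A = carrier A"
    proof (intro equalityI subsetI)
      fix y assume y: "y \<in> carrier A"
      \<comment> \<open>The defining equation read backwards: z is the value that \<sigma>(\<gamma>
        a) must have for a preimage a, and \<sigma> is onto.\<close>
      let ?q = "\<pi> y" and ?z = "fadd (\<pi> y) (\<gamma> y) (h (\<pi> y))"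
      have z: "?z \<in> fibre ?q" by (intro fadd_fibre \<gamma>_fibre section_fibre[OF h] \<pi>_closed y)
      then have "?z \<in> \<sigma> ` carrier D" using C_bij(1)[OF c] by (simp add: bij_betw_def fibre_iff)
      then obtain x where x: "x \<in> carrier D" "\<sigma> x = ?z" by auto
      obtain a where a: "a \<in> carrier A" "\<pi> a = \<rho> x" "x = \<gamma> a" using \<gamma>_surj[OF x(1)] .
      have q: "\<pi> y = \<kappa> (\<pi> a)" using z x a(2) c by (auto simp: fibre_iff carrier_C_iff)
      have "\<phi> a = y"
        using x(2) q by (intro unique a(1) y) (simp_all add: a(3))
      then show "y \<in> \<phi> ` carrier A" using a(1) by blast
    qed (use \<phi>(1) in auto)
  qed
  ultimately have Aut: "\<phi> \<in> carrier Aut_\<alpha>"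
    using \<phi>(2) \<kappa>_inj \<pi>_closed by (simp add: carrier_Aut_\<alpha> ua_auto_iff \<phi>_def)
  have "base \<phi> = \<kappa>"
  proof (rule extensionalityI[OF _ \<kappa>])
    show "base \<phi> q = \<kappa> q" if "q \<in> carrier Q" for q
      using that \<phi>(2)[OF l_closed[OF that]] lifting(2)[OF that] by (simp add: base_def)
  qed (simp add: base_def)
  moreover have "hat \<phi> = \<sigma>"
  proof (rule extensionalityI[OF hat_extensional \<sigma>])
    fix x assume x: "x \<in> carrier D"
    obtain a b where ab: "(a, b) \<in> \<alpha>" and xab: "x = col a b" using carrier_D_col[OF x] .
    have a: "a \<in> carrier A" and b: "b \<in> carrier A" "\<pi> b = \<pi> a" using ab by (auto simp: \<alpha>_iff)
    let ?q = "\<kappa> (\<pi> a)" and ?c = "col (\<phi> a) (\<phi> b)"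
    have \<phi>ab: "(\<phi> a, \<phi> b) \<in> \<alpha>" by (rule Aut_\<alpha>_\<alpha>[OF Aut ab])
    have fib: "\<sigma> x \<in> fibre ?q" "?c \<in> fibre ?q" "\<gamma> (\<phi> a) \<in> fibre ?q" "h ?q \<in> fibre ?q" "\<sigma> (\<gamma> a) \<in> fibre ?q"
      using C_fibre[OF c col_fibre[OF ab refl]] col_fibre[OF \<phi>ab \<phi>(2)[OF a]] \<gamma>\<phi>[OF a] h\<kappa>[OF a] \<sigma>\<gamma>[OF a]
      by (simp_all add: xab)
    \<comment> \<open>The points a and b lie over the same element of Q, so their defining equations
      contain the same value of h; comparing them leaves \<sigma>(x) equal to the column between the
      images.\<close>
    have "fadd ?q (\<sigma> (\<gamma> a)) (\<sigma> x) = \<sigma> (\<gamma> b)"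
      using C_fadd[OF c \<gamma>_fibre[OF a] col_fibre[OF ab refl]] \<gamma>_col[OF ab] by (simp add: xab)
    also have "\<dots> = fadd ?q (\<gamma> (\<phi> b)) (h ?q)" using \<phi>(3)[OF b(1)] b(2) by simp
    also have "\<gamma> (\<phi> b) = fadd ?q (\<gamma> (\<phi> a)) ?c" using \<gamma>_col[OF \<phi>ab] \<phi>(2)[OF a] by simp
    also have "fadd ?q (fadd ?q (\<gamma> (\<phi> a)) ?c) (h ?q) = fadd ?q (fadd ?q (\<gamma> (\<phi> a)) (h ?q)) ?c"
      using fadd_assoc[OF fib(3,2,4)] fadd_assoc[OF fib(3,4,2)] fadd_commute[OF fib(2,4)] by simp
    also have "\<dots> = fadd ?q (\<sigma> (\<gamma> a)) ?c" using \<phi>(3)[OF a] by simp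
    finally have "\<sigma> x = ?c" using fadd_left_cancel[OF fib(5,1,2)] by simp
    then show "hat \<phi> x = \<sigma> x" using hat_col[OF Aut ab] by (simp add: xab)
  qed
  ultimately show ?thesis using Aut by (intro bexI[of _ \<phi>]) (simp_all add: \<psi>_eq)
qed

lemma \<psi>_image:
  assumes E: "identities \<tau> E" and A: "in_variety \<tau> E A" and D: "in_variety \<tau> E D"
  shows "\<psi> ` carrier Aut_\<alpha> = {c \<in> carrier C. wells E assoc_cocycle c = \<one>\<^bsub>H2 E\<^esub>}"
proof (intro equalityI subsetI)
  note iff = wells_eq_one_iff[OF E D assoc_cocycle_compatible[OF E A]]
  {
    fix c assume "c \<in> \<psi> ` carrier Aut_\<alpha>"
    then obtain \<phi> where \<phi>: "\<phi> \<in> carrier Aut_\<alpha>" and c: "c = (hat \<phi>, base \<phi>)" by (auto simp: \<psi>_eq)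
    have "c \<in> carrier C" using \<psi>_closed[OF \<phi>] by (simp add: \<psi>_eq c)
    moreover have "wells E assoc_cocycle c = \<one>\<^bsub>H2 E\<^esub>"
      using iff[of "hat \<phi>" "base \<phi>"] calculation wells_\<psi>[OF \<phi>] unfolding c \<psi>_eq by metis
    ultimately show "c \<in> {c \<in> carrier C. wells E assoc_cocycle c = \<one>\<^bsub>H2 E\<^esub>}" by simp
  next
    fix c assume "c \<in> {c \<in> carrier C. wells E assoc_cocycle c = \<one>\<^bsub>H2 E\<^esub>}"
    then have c: "(fst c, snd c) \<in> carrier C" and "wells E assoc_cocycle (fst c, snd c) = \<one>\<^bsub>H2 E\<^esub>" by simp_all
    then obtain h where "h \<in> sections" "\<forall>f\<in>symbols \<tau>. \<forall>qs\<in>tuples (carrier Q) (arity \<tau> f).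
        fadd (oper Q f qs) (h (oper Q f qs)) (assoc_cocycle f qs)
          = fadd (oper Q f qs) (cocycle_conj (fst c, snd c) assoc_cocycle f qs) (oper D f (map h qs))"
      using iff[OF c] by blast
    then have "\<exists>\<phi>\<in>carrier Aut_\<alpha>. \<psi> \<phi> = (fst c, snd c)"
      by (intro \<psi>_lift[OF c]) auto
    then show "c \<in> \<psi> ` carrier Aut_\<alpha>" by force
  }
qed

end

theorem theorem1p2:
  fixes \<tau> :: "'f signature"
    and E :: "'f identity set"
    and A :: "('f, 'a) ualgebra"
    and Q :: "('f, 'q) ualgebra"
    and \<pi> :: "'a \<Rightarrow> 'q"
    and m :: "('f, nat) trm"
    and l :: "'q \<Rightarrow> 'a"
    and T :: "('f, 'a, 'q) cochain"
  assumes "identities \<tau> E"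
    and "affine_extension \<tau> A Q \<pi> m l"
    and "in_variety \<tau> E A"
    and "in_variety \<tau> E (affine_extension.D \<tau> A \<pi>)"
    and "T = affine_extension.assoc_cocycle \<tau> A Q \<pi> l"
  shows "let Der = affine_extension.Der \<tau> A Q \<pi> m l;
             Aut_\<alpha> = affine_extension.Aut_\<alpha> \<tau> A \<pi>;
             C = affine_extension.C \<tau> A Q \<pi> l;
             H2 = affine_extension.H2 \<tau> A Q \<pi> m l E;
             j = affine_extension.der_to_aut \<tau> A \<pi> m l;
             \<psi> = affine_extension.\<psi> \<tau> A Q \<pi> l;
             W = affine_extension.wells \<tau> A Q \<pi> m l E T
         in comm_group Der \<and> comm_group H2 \<and>
            group_hom Der Aut_\<alpha> j \<and>
            group_hom Aut_\<alpha> C \<psi> \<and>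
            W \<in> carrier C \<rightarrow> carrier H2 \<and>
            kernel Der Aut_\<alpha> j = {\<one>\<^bsub>Der\<^esub>} \<and>
            j ` carrier Der = kernel Aut_\<alpha> C \<psi> \<and>
            \<psi> ` carrier Aut_\<alpha> = {c \<in> carrier C. W c = \<one>\<^bsub>H2\<^esub>}"
proof -
  interpret affine_extension \<tau> A Q \<pi> m l by (rule assms(2))
  show ?thesis
    unfolding Let_def assms(5)
    using comm_group_Der comm_group_H2[OF assms(1,4)] group_hom_der_to_aut group_hom_\<psi>
      wells_closed[OF assms(1,4) assoc_cocycle_compatible[OF assms(1,3)]]
      kernel_der_to_aut der_to_aut_image \<psi>_image[OF assms(1,3,4)]
    by blast
qed

end
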